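(* Let $G$ be a discrete group, let $H$ be a Hilbert space which is decomposed into a sum of orthogonal subspaces $H=\bigoplus_{g\in G}H_g$ (some $H_g$ may be $\{0\}$), and let $\varphi:G\to\mathbb{C}$ be a function. Suppose that the linear operator $T_\varphi:\lambda(\mathbb{C}G)\to\lambda(\mathbb{C}G)$ defined by $T_\varphi(\lambda_g)=\varphi(g)\lambda_g$ extends to a completely bounded operator on $C^*_r(G)$. Let $\Lambda=(\lambda_{s,t})_{s,t\in G}$ be the matrix given by $\lambda_{s,t}=\varphi(st^{-1})$. Then the Schur multiplication map $\Lambda_s$ is a completely bounded map of $B(H)$ into $B(H)$, $\|\Lambda_s\|_{cb}\le\|T_\varphi\|_{cb}$, and $\Lambda_s$ is an ultraweakly continuous (normal) operator on $B(H)$.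
   Context: For a discrete group $G$, $\lambda$ denotes the left regular representation on $l^2(G)$, $\lambda(\mathbb{C}G)$ is the linear span of $\{\lambda_g : g\in G\}$, and $C^*_r(G)$ is its norm closure in $B(l^2(G))$. Given $H=\bigoplus_{g\in G}H_g$, every $x\in B(H)$ has a matrix $x=(x_{s,t})_{s,t\in G}$ with $x_{s,t}\in B(H_t,H_s)$. For a scalar matrix $\Lambda=(\lambda_{s,t})_{s,t\in G}$ the formal Schur product of $\Lambda$ with $x\in B(H)$ is the matrix $\Lambda_s(x)=(\lambda_{s,t}x_{s,t})_{s,t\in G}$ (the subscript $s$ in $\Lambda_s$ stands for "Schur"); a priori it need not be the matrix of a bounded operator, and part of the assertion is that it is, for every $x\in B(H)$. The completely bounded norm of a linear map $\Phi$ is $\|\Phi\|_{cb}=\sup_n\|\mathrm{id}_{M_n(\mathbb{C})}\otimes\Phi\|$. *)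

theory Defs
  imports "HOL-Analysis.Analysis"
begin

section \<open>Complex Hilbert spaces\<close>

class complex_vector = real_vector +
  fixes scaleC :: "complex \<Rightarrow> 'a \<Rightarrow> 'a"  (infixr "*\<^sub>C" 75)
  assumes scaleC_add_right: "c *\<^sub>C (x + y) = c *\<^sub>C x + c *\<^sub>C y"
    and scaleC_add_left: "(c + d) *\<^sub>C x = c *\<^sub>C x + d *\<^sub>C x"
    and scaleC_scaleC: "c *\<^sub>C d *\<^sub>C x = (c * d) *\<^sub>C x"
    and scaleC_one: "1 *\<^sub>C x = x"
    and scaleR_scaleC: "r *\<^sub>R x = complex_of_real r *\<^sub>C x"

interpretation complex_vector: vector_space "scaleC :: complex \<Rightarrow> 'a \<Rightarrow> 'a::complex_vector"
  by unfold_locales (simp_all add: scaleC_add_right scaleC_add_left scaleC_scaleC scaleC_one)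

text \<open>The inner product is linear in the first argument.  Positive definiteness follows from
  \<open>norm_eq_sqrt_cinner\<close> and the norm axioms.\<close>

class complex_inner = complex_vector + real_normed_vector +
  fixes cinner :: "'a \<Rightarrow> 'a \<Rightarrow> complex"
  assumes cinner_commute: "cinner x y = cnj (cinner y x)"
    and cinner_add_left: "cinner (x + y) z = cinner x z + cinner y z"
    and cinner_scaleC_left: "cinner (c *\<^sub>C x) y = c * cinner x y"
    and norm_eq_sqrt_cinner: "norm x = sqrt (Re (cinner x x))"

class chilbert_space = complex_inner + complete_space

lemma norm_scaleC: "norm (c *\<^sub>C x) = cmod c * norm x" for x :: "'a::complex_inner"
proof -
  have im: "Im (cinner x x) = 0"
    using arg_cong[OF cinner_commute[of x x], of Im] by simp
  have "cinner (c *\<^sub>C x) (c *\<^sub>C x) = c * cnj c * cinner x x"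
    using cinner_commute[of x "c *\<^sub>C x"] cinner_commute[of x x]
    by (simp add: cinner_scaleC_left mult.assoc)
  also have "c * cnj c = complex_of_real ((cmod c)\<^sup>2)"
    by (simp add: complex_mult_cnj cmod_power2)
  finally show ?thesis
    by (simp add: norm_eq_sqrt_cinner im real_sqrt_mult)
qed

text \<open>The type \<open>'a \<Rightarrow>\<^sub>L 'b\<close> consists of the bounded real-linear maps; it is a complex vector
  space under pointwise operations.\<close>

instantiation blinfun :: (real_normed_vector, complex_inner) complex_vector
begin

lift_definition scaleC_blinfun :: "complex \<Rightarrow> 'a \<Rightarrow>\<^sub>L 'b \<Rightarrow> 'a \<Rightarrow>\<^sub>L 'b"
  is "\<lambda>c f x. c *\<^sub>C f x"
proof -
  fix c :: complex and f :: "'a \<Rightarrow> 'b"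
  assume "bounded_linear f"
  then interpret bounded_linear f .
  obtain K where K: "\<And>x. norm (f x) \<le> norm x * K"
    using bounded by blast
  show "bounded_linear (\<lambda>x. c *\<^sub>C f x)"
  proof (rule bounded_linear_intro[where K = "cmod c * K"])
    show "c *\<^sub>C f (x + y) = c *\<^sub>C f x + c *\<^sub>C f y" for x y
      by (simp add: add scaleC_add_right)
    show "c *\<^sub>C f (r *\<^sub>R x) = r *\<^sub>R c *\<^sub>C f x" for r x
      by (simp add: scaleR scaleR_scaleC scaleC_scaleC mult.commute)
    show "norm (c *\<^sub>C f x) \<le> norm x * (cmod c * K)" for x
      using mult_left_mono[OF K[of x], of "cmod c"] by (simp add: norm_scaleC mult_ac)
  qed
qed

instance
  by standard
    (transfer; simp add: fun_eq_iff scaleC_add_right scaleC_add_left scaleC_scaleC scaleC_one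
      scaleR_scaleC)+

end

text \<open>\<open>B(H)\<close>, the complex-linear ones among the bounded real-linear operators.\<close>

definition bounded_ops :: "('a::complex_inner \<Rightarrow>\<^sub>L 'a) set"
  where "bounded_ops = {x. \<forall>c \<xi>. blinfun_apply x (c *\<^sub>C \<xi>) = c *\<^sub>C blinfun_apply x \<xi>}"


section \<open>The Hilbert space \<open>l\<^sup>2(I)\<close>\<close>

typedef 'i ell2 = "{f :: 'i \<Rightarrow> complex. (\<lambda>i. (cmod (f i))\<^sup>2) summable_on UNIV}"
  by (rule exI[of _ "\<lambda>_. 0"]) simp

setup_lifting type_definition_ell2

lemma L2_bounded_imp_summable:
  fixes f :: "'i \<Rightarrow> complex"
  assumes "\<And>F. finite F \<Longrightarrow> L2_set (\<lambda>i. cmod (f i)) F \<le> K"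
  shows "(\<lambda>i. (cmod (f i))\<^sup>2) summable_on UNIV"
    and "sqrt (infsum (\<lambda>i. (cmod (f i))\<^sup>2) UNIV) \<le> K"
proof -
  have K: "0 \<le> K"
    using assms[of "{}"] by simp
  have le: "sum (\<lambda>i. (cmod (f i))\<^sup>2) F \<le> K\<^sup>2" if "finite F" for F
    using assms[OF that] unfolding L2_set_def by (rule sqrt_le_D)
  show s: "(\<lambda>i. (cmod (f i))\<^sup>2) summable_on UNIV"
    by (rule nonneg_bdd_above_summable_on) (auto intro!: bdd_aboveI[of _ "K\<^sup>2"] le)
  have "infsum (\<lambda>i. (cmod (f i))\<^sup>2) UNIV \<le> K\<^sup>2"
    by (rule infsum_le_finite_sums[OF s]) (simp add: le)
  then show "sqrt (infsum (\<lambda>i. (cmod (f i))\<^sup>2) UNIV) \<le> K"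
    using K by (rule real_le_lsqrt[rotated])
qed

lemma L2_set_le_sqrt_infsum:
  fixes f :: "'i \<Rightarrow> complex"
  assumes "(\<lambda>i. (cmod (f i))\<^sup>2) summable_on UNIV" "finite F"
  shows "L2_set (\<lambda>i. cmod (f i)) F \<le> sqrt (infsum (\<lambda>i. (cmod (f i))\<^sup>2) UNIV)"
  unfolding L2_set_def using finite_sum_le_infsum[OF assms] by simp

lemma L2_set_cmod_add_le:
  "L2_set (\<lambda>i. cmod (f i + g i)) F \<le> L2_set (\<lambda>i. cmod (f i)) F + L2_set (\<lambda>i. cmod (g i)) F"
  by (rule order_trans[OF L2_set_mono L2_set_triangle_ineq]) (auto simp: norm_triangle_ineq)

lemma square_summable_add:
  fixes f g :: "'i \<Rightarrow> complex"
  assumes f: "(\<lambda>i. (cmod (f i))\<^sup>2) summable_on UNIV" and g: "(\<lambda>i. (cmod (g i))\<^sup>2) summable_on UNIV"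
  shows "(\<lambda>i. (cmod (f i + g i))\<^sup>2) summable_on UNIV"
    and "sqrt (infsum (\<lambda>i. (cmod (f i + g i))\<^sup>2) UNIV)
      \<le> sqrt (infsum (\<lambda>i. (cmod (f i))\<^sup>2) UNIV) + sqrt (infsum (\<lambda>i. (cmod (g i))\<^sup>2) UNIV)"
proof -
  have *: "L2_set (\<lambda>i. cmod (f i + g i)) F
      \<le> sqrt (infsum (\<lambda>i. (cmod (f i))\<^sup>2) UNIV) + sqrt (infsum (\<lambda>i. (cmod (g i))\<^sup>2) UNIV)"
    if "finite F" for F
    using L2_set_cmod_add_le[of f g F] L2_set_le_sqrt_infsum[OF f that]
      L2_set_le_sqrt_infsum[OF g that] by linarith
  from L2_bounded_imp_summable[OF *]
  show "(\<lambda>i. (cmod (f i + g i))\<^sup>2) summable_on UNIV"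
    and "sqrt (infsum (\<lambda>i. (cmod (f i + g i))\<^sup>2) UNIV)
      \<le> sqrt (infsum (\<lambda>i. (cmod (f i))\<^sup>2) UNIV) + sqrt (infsum (\<lambda>i. (cmod (g i))\<^sup>2) UNIV)"
    by auto
qed

lemma square_summable_scale:
  fixes f :: "'i \<Rightarrow> complex"
  assumes "(\<lambda>i. (cmod (f i))\<^sup>2) summable_on UNIV"
  shows "(\<lambda>i. (cmod (c * f i))\<^sup>2) summable_on UNIV"
  using summable_on_cmult_right[OF assms, of "(cmod c)\<^sup>2"] by (simp add: norm_mult power_mult_distrib)

lemma square_summable_product:
  fixes f g :: "'i \<Rightarrow> complex"
  assumes f: "(\<lambda>i. (cmod (f i))\<^sup>2) summable_on UNIV" and g: "(\<lambda>i. (cmod (g i))\<^sup>2) summable_on UNIV"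
  shows "(\<lambda>i. f i * cnj (g i)) summable_on UNIV"
proof (rule abs_summable_summable, rule Infinite_Sum.abs_summable_on_comparison_test')
  show "(\<lambda>i. (cmod (f i))\<^sup>2 + (cmod (g i))\<^sup>2) summable_on UNIV"
    by (rule summable_on_add[OF f g])
  show "cmod (f i * cnj (g i)) \<le> (cmod (f i))\<^sup>2 + (cmod (g i))\<^sup>2" for i
    using sum_squares_bound[of "cmod (f i)" "cmod (g i)"]
      mult_nonneg_nonneg[OF norm_ge_zero[of "f i"] norm_ge_zero[of "g i"]]
    unfolding norm_mult complex_mod_cnj by linarith
qed

instantiation ell2 :: (type) complex_inner
begin

lift_definition zero_ell2 :: "'a ell2" is "\<lambda>_. 0"
  by simp

lift_definition plus_ell2 :: "'a ell2 \<Rightarrow> 'a ell2 \<Rightarrow> 'a ell2" is "\<lambda>f g i. f i + g i"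
  by (rule square_summable_add(1))

lift_definition scaleC_ell2 :: "complex \<Rightarrow> 'a ell2 \<Rightarrow> 'a ell2" is "\<lambda>c f i. c * f i"
  by (rule square_summable_scale)

lift_definition uminus_ell2 :: "'a ell2 \<Rightarrow> 'a ell2" is "\<lambda>f i. - f i"
  by simp

lift_definition minus_ell2 :: "'a ell2 \<Rightarrow> 'a ell2 \<Rightarrow> 'a ell2" is "\<lambda>f g i. f i - g i"
proof -
  fix f g :: "'a \<Rightarrow> complex"
  assume "(\<lambda>i. (cmod (f i))\<^sup>2) summable_on UNIV" "(\<lambda>i. (cmod (g i))\<^sup>2) summable_on UNIV"
  then show "(\<lambda>i. (cmod (f i - g i))\<^sup>2) summable_on UNIV"
    using square_summable_add(1)[of f "\<lambda>i. - g i"] by simp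
qed

definition scaleR_ell2 :: "real \<Rightarrow> 'a ell2 \<Rightarrow> 'a ell2"
  where "scaleR_ell2 r f = complex_of_real r *\<^sub>C f"

lift_definition cinner_ell2 :: "'a ell2 \<Rightarrow> 'a ell2 \<Rightarrow> complex"
  is "\<lambda>f g. \<Sum>\<^sub>\<infinity>i. f i * cnj (g i)" .

lift_definition norm_ell2 :: "'a ell2 \<Rightarrow> real" is "\<lambda>f. sqrt (\<Sum>\<^sub>\<infinity>i. (cmod (f i))\<^sup>2)" .

definition sgn_ell2 :: "'a ell2 \<Rightarrow> 'a ell2"
  where "sgn_ell2 f = inverse (norm f) *\<^sub>R f"

definition dist_ell2 :: "'a ell2 \<Rightarrow> 'a ell2 \<Rightarrow> real"
  where "dist_ell2 f g = norm (f - g)"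

definition uniformity_ell2 :: "('a ell2 \<times> 'a ell2) filter"
  where "uniformity_ell2 = (INF e\<in>{0<..}. principal {(f, g). dist f g < e})"

definition open_ell2 :: "'a ell2 set \<Rightarrow> bool"
  where "open_ell2 U = (\<forall>f\<in>U. \<forall>\<^sub>F (f', g) in uniformity. f' = f \<longrightarrow> g \<in> U)"

instance
proof
  fix f g h :: "'a ell2" and c d :: complex and r s :: real
  show "f + g + h = f + (g + h)" by transfer (simp add: add.assoc)
  show "f + g = g + f" by transfer (simp add: add.commute)
  show "0 + f = f" by transfer simp
  show "- f + f = 0" by transfer simp
  show "f - g = f + - g" by transfer simp
  show C1: "c *\<^sub>C (f + g) = c *\<^sub>C f + c *\<^sub>C g" by transfer (simp add: algebra_simps)
  show C2: "(c + d) *\<^sub>C f = c *\<^sub>C f + d *\<^sub>C f" by transfer (simp add: algebra_simps)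
  show C3: "c *\<^sub>C d *\<^sub>C f = (c * d) *\<^sub>C f" by transfer (simp add: algebra_simps)
  show C4: "1 *\<^sub>C f = f" by transfer simp
  show "r *\<^sub>R f = complex_of_real r *\<^sub>C f" by (rule scaleR_ell2_def)
  show "r *\<^sub>R (f + g) = r *\<^sub>R f + r *\<^sub>R g"
    unfolding scaleR_ell2_def by transfer (simp add: algebra_simps)
  show "(r + s) *\<^sub>R f = r *\<^sub>R f + s *\<^sub>R f"
    unfolding scaleR_ell2_def by transfer (simp add: algebra_simps)
  show "r *\<^sub>R s *\<^sub>R f = (r * s) *\<^sub>R f"
    unfolding scaleR_ell2_def by transfer (simp add: algebra_simps)
  show "1 *\<^sub>R f = f"
    unfolding scaleR_ell2_def by transfer simp
  show "dist f g = norm (f - g)" by (rule dist_ell2_def)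
  show "sgn f = inverse (norm f) *\<^sub>R f" by (rule sgn_ell2_def)
  show "uniformity = (INF e\<in>{0<..}. principal {(f, g :: 'a ell2). dist f g < e})"
    by (rule uniformity_ell2_def)
  show "open U = (\<forall>f\<in>U. \<forall>\<^sub>F (f', g) in uniformity. f' = f \<longrightarrow> g \<in> U)" for U :: "'a ell2 set"
    by (rule open_ell2_def)
  show "norm f = 0 \<longleftrightarrow> f = 0"
  proof
    assume "norm f = 0"
    then have "(\<Sum>\<^sub>\<infinity>i. (cmod (Rep_ell2 f i))\<^sup>2) \<le> 0"
      by (simp add: norm_ell2.rep_eq)
    then have "(cmod (Rep_ell2 f i))\<^sup>2 = 0" for i
      by (rule nonneg_infsum_le_0D) (use Rep_ell2[of f] in auto)
    then show "f = 0"
      by (simp add: Rep_ell2_inject[symmetric] zero_ell2.rep_eq fun_eq_iff)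
  next
    assume "f = 0"
    then show "norm f = 0"
      by (simp, transfer, simp)
  qed
  show "norm (f + g) \<le> norm f + norm g"
    by transfer (simp add: square_summable_add(2))
  show "norm (r *\<^sub>R f) = \<bar>r\<bar> * norm f"
    unfolding scaleR_ell2_def
    by transfer (simp add: norm_mult power_mult_distrib infsum_cmult_right' real_sqrt_mult)
  show "cinner f g = cnj (cinner g f)"
    by transfer (simp flip: infsum_cnj add: mult.commute)
  show "cinner (f + g) h = cinner f h + cinner g h"
    by transfer (simp add: distrib_right infsum_add square_summable_product)
  show "cinner (c *\<^sub>C f) g = c * cinner f g"
    by transfer (simp add: mult.assoc infsum_cmult_right')
  show "norm f = sqrt (Re (cinner f f))"
  proof -
    have "Re (\<Sum>\<^sub>\<infinity>i. Rep_ell2 f i * cnj (Rep_ell2 f i))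
        = (\<Sum>\<^sub>\<infinity>i. Re (Rep_ell2 f i * cnj (Rep_ell2 f i)))"
      by (rule infsum_Re[symmetric]) (use Rep_ell2[of f] in \<open>simp add: square_summable_product\<close>)
    also have "\<dots> = (\<Sum>\<^sub>\<infinity>i. (cmod (Rep_ell2 f i))\<^sup>2)"
      by (simp add: cmod_power2 flip: power2_eq_square)
    finally show ?thesis
      by (simp add: norm_ell2.rep_eq cinner_ell2.rep_eq)
  qed
qed

end

lemma Rep_ell2_summable: "(\<lambda>i. (cmod (Rep_ell2 f i))\<^sup>2) summable_on UNIV"
  using Rep_ell2[of f] by simp

lemma L2_set_le_norm_ell2:
  assumes "finite F"
  shows "L2_set (\<lambda>i. cmod (Rep_ell2 f i)) F \<le> norm f"
  unfolding norm_ell2.rep_eq by (rule L2_set_le_sqrt_infsum[OF Rep_ell2_summable assms])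

lemma cmod_le_norm_ell2: "cmod (Rep_ell2 f i) \<le> norm f"
  using L2_set_le_norm_ell2[of "{i}" f] by simp

instance ell2 :: (type) chilbert_space
proof
  fix X :: "nat \<Rightarrow> 'a ell2"
  assume X: "Cauchy X"
  have diff: "Rep_ell2 (X m - X n) i = Rep_ell2 (X m) i - Rep_ell2 (X n) i" for m n i
    by (simp add: minus_ell2.rep_eq)
  have "Cauchy (\<lambda>n. Rep_ell2 (X n) i)" for i
  proof (rule CauchyI)
    fix e :: real
    assume "0 < e"
    then obtain M where M: "norm (X m - X n) < e" if "m \<ge> M" "n \<ge> M" for m n
      using CauchyD[OF X] by blast
    have "cmod (Rep_ell2 (X m) i - Rep_ell2 (X n) i) < e" if "m \<ge> M" "n \<ge> M" for m n
      using cmod_le_norm_ell2[of "X m - X n" i] M[OF that] unfolding diff by linarith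
    then show "\<exists>M. \<forall>m\<ge>M. \<forall>n\<ge>M. cmod (Rep_ell2 (X m) i - Rep_ell2 (X n) i) < e"
      by blast
  qed
  then obtain L where L: "\<And>i. (\<lambda>n. Rep_ell2 (X n) i) \<longlonglongrightarrow> L i"
    unfolding Cauchy_convergent_iff convergent_LIMSEQ_iff by (rule that)
  have close: "L2_set (\<lambda>i. cmod (Rep_ell2 (X m) i - L i)) F \<le> e"
    if M: "\<forall>m\<ge>M. \<forall>n\<ge>M. norm (X m - X n) < e" and "m \<ge> M" "finite F" for M m e F
  proof (rule tendsto_upperbound)
    show "((\<lambda>n. L2_set (\<lambda>i. cmod (Rep_ell2 (X m) i - Rep_ell2 (X n) i)) F)
        \<longlongrightarrow> L2_set (\<lambda>i. cmod (Rep_ell2 (X m) i - L i)) F) sequentially"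
      unfolding L2_set_def by (intro tendsto_intros L)
    show "\<forall>\<^sub>F n in sequentially. L2_set (\<lambda>i. cmod (Rep_ell2 (X m) i - Rep_ell2 (X n) i)) F \<le> e"
    proof (rule eventually_sequentiallyI[of M])
      fix n
      assume "M \<le> n"
      then have "norm (X m - X n) < e"
        using M \<open>m \<ge> M\<close> by blast
      then show "L2_set (\<lambda>i. cmod (Rep_ell2 (X m) i - Rep_ell2 (X n) i)) F \<le> e"
        using L2_set_le_norm_ell2[OF \<open>finite F\<close>, of "X m - X n"] unfolding diff by linarith
    qed
  qed simp
  have diffs: "(\<lambda>i. (cmod (Rep_ell2 (X m) i - L i))\<^sup>2) summable_on UNIV"
    if "\<forall>m\<ge>M. \<forall>n\<ge>M. norm (X m - X n) < e" "m \<ge> M" for M m e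
    using close[OF that] by (rule L2_bounded_imp_summable(1))
  obtain M where "\<forall>m\<ge>M. \<forall>n\<ge>M. norm (X m - X n) < 1"
    using CauchyD[OF X, of 1] by auto
  from diffs[OF this order_refl]
  have "(\<lambda>i. (cmod (Rep_ell2 (X M) i + (- 1) * (Rep_ell2 (X M) i - L i)))\<^sup>2) summable_on UNIV"
    by (intro square_summable_add(1) square_summable_scale Rep_ell2_summable)
  then have "(\<lambda>i. (cmod (L i))\<^sup>2) summable_on UNIV"
    by simp
  then obtain l where l: "Rep_ell2 l = L"
    using Abs_ell2_inverse[of L] by blast
  have "X \<longlonglongrightarrow> l"
  proof (rule LIMSEQ_I)
    fix e :: real
    assume "0 < e"
    then obtain M where M: "\<forall>m\<ge>M. \<forall>n\<ge>M. norm (X m - X n) < e / 2"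
      using CauchyD[OF X, of "e / 2"] by auto
    have "norm (X m - l) \<le> e / 2" if "m \<ge> M" for m
      using L2_bounded_imp_summable(2)[OF close[OF M that]]
      by (simp add: norm_ell2.rep_eq minus_ell2.rep_eq l)
    then show "\<exists>M. \<forall>m\<ge>M. norm (X m - l) < e"
      using \<open>0 < e\<close> by (intro exI[of _ M]) fastforce
  qed
  then show "convergent X"
    by (rule convergentI)
qed

section \<open>The left regular representation\<close>

text \<open>Discrete groups are types of class \<open>group_add\<close>: the group operation, which is not assumed
  to be commutative, is written \<open>+\<close>, so that \<open>s t\<^sup>-\<^sup>1\<close> becomes \<open>s - t\<close>.\<close>

lift_definition left_translate :: "'g::group_add \<Rightarrow> 'g ell2 \<Rightarrow> 'g ell2"
  is "\<lambda>g \<xi> h. \<xi> (- g + h)"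
proof -
  fix g :: 'g and \<xi> :: "'g \<Rightarrow> complex"
  assume "(\<lambda>i. (cmod (\<xi> i))\<^sup>2) summable_on UNIV"
  then show "(\<lambda>i. (cmod (\<xi> (- g + i)))\<^sup>2) summable_on UNIV"
    by (subst summable_on_reindex_bij_betw[of "\<lambda>i. - g + i" UNIV UNIV "\<lambda>i. (cmod (\<xi> i))\<^sup>2"])
      (auto intro!: bij_betwI[of _ _ _ "\<lambda>i. g + i"] simp: add.assoc[symmetric])
qed

lift_definition left_regular :: "'g::group_add \<Rightarrow> 'g ell2 \<Rightarrow>\<^sub>L 'g ell2"
  is left_translate
proof (rule bounded_linear_intro[where K = 1])
  fix g :: 'g and \<xi> \<eta> :: "'g ell2" and r :: real
  show "left_translate g (\<xi> + \<eta>) = left_translate g \<xi> + left_translate g \<eta>"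
    by transfer simp
  show "left_translate g (r *\<^sub>R \<xi>) = r *\<^sub>R left_translate g \<xi>"
    unfolding scaleR_ell2_def by transfer simp
  show "norm (left_translate g \<xi>) \<le> norm \<xi> * 1"
  proof transfer
    fix g :: 'g and \<xi> :: "'g \<Rightarrow> complex"
    have "(\<Sum>\<^sub>\<infinity>i. (cmod (\<xi> (- g + i)))\<^sup>2) = (\<Sum>\<^sub>\<infinity>i. (cmod (\<xi> i))\<^sup>2)"
      by (rule infsum_reindex_bij_betw[of "\<lambda>i. - g + i" UNIV UNIV "\<lambda>i. (cmod (\<xi> i))\<^sup>2"])
        (auto intro!: bij_betwI[of _ _ _ "\<lambda>i. g + i"] simp: add.assoc[symmetric])
    then show "sqrt (\<Sum>\<^sub>\<infinity>i. (cmod (\<xi> (- g + i)))\<^sup>2) \<le> sqrt (\<Sum>\<^sub>\<infinity>i. (cmod (\<xi> i))\<^sup>2) * 1"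
      by simp
  qed
qed

definition group_alg :: "('g::group_add ell2 \<Rightarrow>\<^sub>L 'g ell2) set"
  where "group_alg = complex_vector.span (range left_regular)"

definition reduced_cstar :: "('g::group_add ell2 \<Rightarrow>\<^sub>L 'g ell2) set"
  where "reduced_cstar = closure group_alg"

section \<open>Complete boundedness\<close>

definition clinear_on :: "'a::complex_vector set \<Rightarrow> ('a \<Rightarrow> 'b::complex_vector) \<Rightarrow> bool"
  where "clinear_on A \<Phi> \<longleftrightarrow> (\<forall>x\<in>A. \<forall>y\<in>A. \<Phi> (x + y) = \<Phi> x + \<Phi> y) \<and>
    (\<forall>c. \<forall>x\<in>A. \<Phi> (c *\<^sub>C x) = c *\<^sub>C \<Phi> x)"

text \<open>An operator on \<open>H\<^sup>n\<close> is given by its entries \<open>X i j\<close> for \<open>i, j < n\<close>.\<close>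

definition opmat_norm :: "nat \<Rightarrow> (nat \<Rightarrow> nat \<Rightarrow> 'h::complex_inner \<Rightarrow>\<^sub>L 'h) \<Rightarrow> ennreal"
  where "opmat_norm n X =
    (SUP \<xi>\<in>{\<xi>. L2_set (\<lambda>j. norm (\<xi> j)) {..<n} \<le> 1}.
      ennreal (L2_set (\<lambda>i. norm (\<Sum>j<n. blinfun_apply (X i j) (\<xi> j))) {..<n}))"

text \<open>The norm of \<open>id \<otimes> \<Phi>\<close> on \<open>M\<^sub>n(\<complex>) \<otimes> A = M\<^sub>n(A)\<close>, where it maps \<open>(x\<^sub>i\<^sub>j)\<close> to
  \<open>(\<Phi>(x\<^sub>i\<^sub>j))\<close>.\<close>

definition amplification_norm ::
    "nat \<Rightarrow> ('h::complex_inner \<Rightarrow>\<^sub>L 'h) set \<Rightarrow> (('h \<Rightarrow>\<^sub>L 'h) \<Rightarrow> ('k::complex_inner \<Rightarrow>\<^sub>L 'k)) \<Rightarrow> ennreal"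
  where "amplification_norm n A \<Phi> =
    (SUP X\<in>{X. (\<forall>i<n. \<forall>j<n. X i j \<in> A) \<and> opmat_norm n X \<le> 1}.
      opmat_norm n (\<lambda>i j. \<Phi> (X i j)))"

definition cb_norm ::
    "('h::complex_inner \<Rightarrow>\<^sub>L 'h) set \<Rightarrow> (('h \<Rightarrow>\<^sub>L 'h) \<Rightarrow> ('k::complex_inner \<Rightarrow>\<^sub>L 'k)) \<Rightarrow> ennreal"
  where "cb_norm A \<Phi> = (SUP n. amplification_norm n A \<Phi>)"

definition completely_bounded ::
    "('h::complex_inner \<Rightarrow>\<^sub>L 'h) set \<Rightarrow> ('k::complex_inner \<Rightarrow>\<^sub>L 'k) set
      \<Rightarrow> (('h \<Rightarrow>\<^sub>L 'h) \<Rightarrow> ('k \<Rightarrow>\<^sub>L 'k)) \<Rightarrow> bool"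
  where "completely_bounded A B \<Phi> \<longleftrightarrow> clinear_on A \<Phi> \<and> \<Phi> ` A \<subseteq> B \<and> cb_norm A \<Phi> < \<infinity>"

section \<open>Schur multiplication\<close>

definition orthogonal_decomposition :: "('g \<Rightarrow> 'h::chilbert_space set) \<Rightarrow> bool"
  where "orthogonal_decomposition Hs \<longleftrightarrow>
    (\<forall>g. complex_vector.subspace (Hs g) \<and> closed (Hs g)) \<and>
    (\<forall>g h. g \<noteq> h \<longrightarrow> (\<forall>\<xi>\<in>Hs g. \<forall>\<eta>\<in>Hs h. cinner \<xi> \<eta> = 0)) \<and>
    closure (complex_vector.span (\<Union>g. Hs g)) = UNIV"

definition orth_proj :: "'h::chilbert_space set \<Rightarrow> 'h \<Rightarrow> 'h"
  where "orth_proj M \<xi> = (THE \<eta>. \<eta> \<in> M \<and> (\<forall>\<zeta>\<in>M. cinner (\<xi> - \<eta>) \<zeta> = 0))"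

text \<open>The entry \<open>x\<^sub>s\<^sub>,\<^sub>t = P\<^sub>s x|H\<^sub>t\<close> is represented by a function on \<open>H\<close> that vanishes
  outside \<open>H\<^sub>t\<close>.\<close>

definition op_matrix ::
    "('g \<Rightarrow> 'h::chilbert_space set) \<Rightarrow> ('h \<Rightarrow>\<^sub>L 'h) \<Rightarrow> 'g \<Rightarrow> 'g \<Rightarrow> 'h \<Rightarrow> 'h"
  where "op_matrix Hs x s t =
    (\<lambda>\<xi>. if \<xi> \<in> Hs t then orth_proj (Hs s) (blinfun_apply x \<xi>) else 0)"

definition schur_product ::
    "('g \<Rightarrow> 'g \<Rightarrow> complex) \<Rightarrow> ('g \<Rightarrow> 'g \<Rightarrow> 'h \<Rightarrow> 'h) \<Rightarrow> 'g \<Rightarrow> 'g \<Rightarrow> 'h \<Rightarrow> 'h::chilbert_space"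
  where "schur_product \<Lambda> X s t = (\<lambda>\<xi>. \<Lambda> s t *\<^sub>C X s t \<xi>)"

text \<open>The bounded operator whose matrix is the formal Schur product of \<open>\<Lambda>\<close> with \<open>x\<close>; the value
  is meaningful only if such an operator exists.\<close>

definition schur_map ::
    "('g \<Rightarrow> 'h::chilbert_space set) \<Rightarrow> ('g \<Rightarrow> 'g \<Rightarrow> complex) \<Rightarrow> ('h \<Rightarrow>\<^sub>L 'h) \<Rightarrow> ('h \<Rightarrow>\<^sub>L 'h)"
  where "schur_map Hs \<Lambda> x =
    (THE y. y \<in> bounded_ops \<and> op_matrix Hs y = schur_product \<Lambda> (op_matrix Hs x))"

section \<open>The ultraweak topology on \<open>B(H)\<close>\<close>

text \<open>The coarsest topology on \<open>B(H)\<close> for which all functionals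
  \<open>x \<mapsto> \<Sum>\<^sub>n \<langle>x \<xi>\<^sub>n, \<eta>\<^sub>n\<rangle>\<close> with \<open>\<Sum>\<^sub>n \<parallel>\<xi>\<^sub>n\<parallel>\<^sup>2 < \<infinity>\<close> and \<open>\<Sum>\<^sub>n \<parallel>\<eta>\<^sub>n\<parallel>\<^sup>2 < \<infinity>\<close> are continuous.\<close>

definition ultraweak :: "('h::chilbert_space \<Rightarrow>\<^sub>L 'h) topology"
  where "ultraweak = topology_generated_by
    {{x \<in> bounded_ops. (\<Sum>n. cinner (blinfun_apply x (\<xi> n)) (\<eta> n)) \<in> U} | \<xi> \<eta> U.
      summable (\<lambda>n. (norm (\<xi> n))\<^sup>2) \<and> summable (\<lambda>n. (norm (\<eta> n))\<^sup>2) \<and> open U}"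

end

theory Submission
  imports Defs
begin

text \<open>For unit vectors \<open>e\<^sub>t, f\<^sub>t \<in> H\<^sub>t\<close>, \<open>t\<close> in a finite set, the scalar matrix
  \<open>a = (\<langle>x e\<^sub>t, f\<^sub>s\<rangle>)\<close> has norm at most \<open>\<parallel>x\<parallel>\<close>.  Conjugating \<open>a \<otimes> 1\<close> by the diagonal unitary
  with entries \<open>\<lambda>\<^sub>s\<close> gives the matrix \<open>(a\<^sub>s\<^sub>t \<lambda>(s t\<^sup>-\<^sup>1))\<close> over the reduced C*-algebra, which
  \<open>T\<close> maps entrywise to \<open>(\<phi>(s t\<^sup>-\<^sup>1) a\<^sub>s\<^sub>t \<lambda>(s t\<^sup>-\<^sup>1))\<close>.  Undoing the conjugation bounds the Schur
  product of \<open>\<Lambda>\<close> and \<open>a\<close>, hence the truncations of the formal Schur product of \<open>\<Lambda>\<close> and \<open>x\<close>, by the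
  completely bounded norm of \<open>T\<close>; the same works for matrices of operators.  The truncations converge
  strongly.  By duality, Schur multiplication by \<open>\<Lambda>\<close> is also bounded for the trace norm on finite
  matrices, so it pulls ultraweakly continuous functionals back to ultraweakly continuous functionals.\<close>

section \<open>Geometry of complex Hilbert spaces\<close>

text \<open>Boundedness cannot be read off the formal product, so only finite truncations are
  estimated, with a constant independent of the finite set and of the amplification; this uniformity
  is what lets a strong limit exist and inherit the bound. Normality does not come with that limit,
  because a pointwise limit of ultraweakly continuous functionals need not be ultraweakly
  continuous. A bound in the predual is needed. For vectors with finitely many components the
  pulled-back functional involves finitely many entries of the operator, and the scalar estimate,
  with the two factors of the trace pairing exchanged, controls its trace norm. A convex separation
  in a space of matrices replaces the theory of trace class operators. Arbitrary vectors are norm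
  convergent series of such vectors, and the trace norm bounds make the resulting series of
  functionals summable. Constants in this half only have to be finite, so slack is added wherever
  positivity is convenient.\<close>

instance chilbert_space \<subseteq> banach ..

lemma cnj_sgn_mult_self: "cnj (sgn z) * z = complex_of_real (cmod z)"
  using complex_norm_square[of z]
  by (cases "z = 0") (simp_all add: sgn_eq field_simps power2_eq_square)

lemma scaleC_scaleR_commute: "c *\<^sub>C r *\<^sub>R x = r *\<^sub>R c *\<^sub>C (x :: 'a::complex_vector)"
  by (simp add: scaleR_scaleC scaleC_scaleC mult.commute)

lemma bounded_linear_scaleC: "bounded_linear (\<lambda>x :: 'a::complex_inner. c *\<^sub>C x)"
  by (rule bounded_linear_intro[where K = "cmod c"])
    (simp_all add: scaleC_add_right scaleC_scaleR_commute norm_scaleC)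

lemma tendsto_scaleC:
  fixes f :: "'i \<Rightarrow> 'a::complex_inner"
  shows "(f \<longlongrightarrow> l) F \<Longrightarrow> ((\<lambda>i. c *\<^sub>C f i) \<longlongrightarrow> c *\<^sub>C l) F"
  by (rule bounded_linear.tendsto[OF bounded_linear_scaleC])

lemma cinner_add_right: "cinner (x::'a::complex_inner) (y + z) = cinner x y + cinner x z"
  by (metis cinner_add_left cinner_commute complex_cnj_add)

lemma cinner_scaleC_right: "cinner (x::'a::complex_inner) (c *\<^sub>C y) = cnj c * cinner x y"
  by (metis cinner_scaleC_left cinner_commute complex_cnj_mult)

lemma cinner_self: "cinner (x::'a::complex_inner) x = complex_of_real ((norm x)\<^sup>2)"
proof -
  have "Im (cinner x x) = 0"
    using arg_cong[OF cinner_commute[of x x], of Im] by simp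
  moreover have "0 \<le> Re (cinner x x)"
    using norm_eq_sqrt_cinner[of x] by (metis norm_ge_zero real_sqrt_ge_0_iff)
  ultimately show ?thesis
    by (simp add: complex_eq_iff norm_eq_sqrt_cinner)
qed

lemma cinner_minus_left: "cinner (- x) (y::'a::complex_inner) = - cinner x y"
  using cinner_scaleC_left[of "-1" x y] by simp

lemma cinner_minus_right: "cinner x (- y::'a::complex_inner) = - cinner x y"
  using cinner_scaleC_right[of x "-1" y] by simp

lemma cinner_diff_left: "cinner (x - z) (y::'a::complex_inner) = cinner x y - cinner z y"
  using cinner_add_left[of x "-z" y] by (simp add: cinner_minus_left)

lemma norm_add_square: "(norm (x + y::'a::complex_inner))\<^sup>2 = (norm x)\<^sup>2 + (norm y)\<^sup>2 + 2 * Re (cinner x y)"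
proof -
  have "complex_of_real ((norm (x + y))\<^sup>2)
      = complex_of_real ((norm x)\<^sup>2) + complex_of_real ((norm y)\<^sup>2) + (cinner x y + cnj (cinner x y))"
    unfolding cinner_self[symmetric]
    by (simp add: cinner_add_left cinner_add_right cinner_commute[of y x])
  from arg_cong[OF this, of Re] show ?thesis
    by simp
qed

lemma norm_diff_square: "(norm (x - y::'a::complex_inner))\<^sup>2 = (norm x)\<^sup>2 + (norm y)\<^sup>2 - 2 * Re (cinner x y)"
  using norm_add_square[of x "- y"] by (simp add: cinner_minus_right)

lemma Re_cinner_le: "Re (cinner (x::'a::complex_inner) y) \<le> norm x * norm y"
proof (cases "x = 0 \<or> y = 0")
  case True
  then show ?thesis
    using cinner_scaleC_left[of 0 x y] cinner_scaleC_right[of x 0 y] by auto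
next
  case False
  define u v where "u = complex_of_real (inverse (norm x)) *\<^sub>C x"
    and "v = complex_of_real (inverse (norm y)) *\<^sub>C y"
  have 1: "norm u = 1" "norm v = 1"
    using False by (simp_all add: u_def v_def norm_scaleC norm_inverse)
  have "0 \<le> (norm (u - v))\<^sup>2" by simp
  then have le: "Re (cinner u v) \<le> 1"
    unfolding norm_diff_square 1 by simp
  have "x = complex_of_real (norm x) *\<^sub>C u" "y = complex_of_real (norm y) *\<^sub>C v"
    using False by (simp_all add: u_def v_def scaleC_scaleC scaleC_one)
  then have "cinner x y = complex_of_real (norm x * norm y) * cinner u v"
    by (metis cinner_scaleC_left cinner_scaleC_right complex_cnj_complex_of_real mult.assoc of_real_mult)
  then have "Re (cinner x y) = (norm x * norm y) * Re (cinner u v)"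
    by simp
  then show ?thesis
    using mult_left_mono[OF le, of "norm x * norm y"] by simp
qed

text \<open>Multiplying \<open>x\<close> by the phase \<open>c\<close> makes the inner product real
  and nonnegative, so the bound for real parts controls the modulus.\<close>

lemma cinner_Cauchy_Schwarz: "cmod (cinner (x::'a::complex_inner) y) \<le> norm x * norm y"
proof (cases "cinner x y = 0")
  case False
  define c where "c = cnj (sgn (cinner x y))"
  have c: "cmod c = 1"
    using False by (simp add: c_def norm_sgn)
  have "c * cinner x y = complex_of_real (cmod (cinner x y))"
    by (simp add: c_def cnj_sgn_mult_self)
  then have "cmod (cinner x y) = Re (cinner (c *\<^sub>C x) y)"
    by (simp add: cinner_scaleC_left)
  also have "\<dots> \<le> norm (c *\<^sub>C x) * norm y"
    by (rule Re_cinner_le)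
  finally show ?thesis
    by (simp add: norm_scaleC c)
qed simp

lemma bounded_bilinear_cinner: "bounded_bilinear (cinner :: 'a::complex_inner \<Rightarrow> 'a \<Rightarrow> complex)"
proof
  show "\<exists>K. \<forall>(a::'a) b. norm (cinner a b) \<le> norm a * norm b * K"
    by (rule exI[of _ 1]) (simp add: cinner_Cauchy_Schwarz)
qed (simp_all add: cinner_add_left cinner_add_right scaleR_scaleC cinner_scaleC_left cinner_scaleC_right
    scaleR_conv_of_real)

lemmas cinner_sum_left = bounded_bilinear.sum_left[OF bounded_bilinear_cinner]
lemmas cinner_sum_right = bounded_bilinear.sum_right[OF bounded_bilinear_cinner]
lemmas cinner_zero_left [simp] = bounded_bilinear.zero_left[OF bounded_bilinear_cinner]
lemmas cinner_zero_right [simp] = bounded_bilinear.zero_right[OF bounded_bilinear_cinner]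
lemmas tendsto_cinner = bounded_bilinear.tendsto[OF bounded_bilinear_cinner]

section \<open>Orthogonal families and unordered sums\<close>

lemma norm_sum_orthogonal:
  fixes f :: "'i \<Rightarrow> 'a::complex_inner"
  assumes "\<And>i j. i \<in> F \<Longrightarrow> j \<in> F \<Longrightarrow> i \<noteq> j \<Longrightarrow> cinner (f i) (f j) = 0"
  shows "(norm (sum f F))\<^sup>2 = (\<Sum>i\<in>F. (norm (f i))\<^sup>2)"
proof (cases "finite F")
  case True
  have "complex_of_real ((norm (sum f F))\<^sup>2) = (\<Sum>i\<in>F. \<Sum>j\<in>F. cinner (f i) (f j))"
    unfolding cinner_self[symmetric] cinner_sum_left unfolding cinner_sum_right ..
  also have "\<dots> = (\<Sum>i\<in>F. cinner (f i) (f i))"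
  proof (rule sum.cong[OF refl])
    fix i assume "i \<in> F"
    then show "(\<Sum>j\<in>F. cinner (f i) (f j)) = cinner (f i) (f i)"
      using sum.remove[OF True, of i "\<lambda>j. cinner (f i) (f j)"]
        sum.neutral[of "F - {i}" "\<lambda>j. cinner (f i) (f j)"] assms[of i] by (metis DiffE add.right_neutral insertI1)
  qed
  also have "\<dots> = complex_of_real (\<Sum>i\<in>F. (norm (f i))\<^sup>2)"
    by (simp add: cinner_self)
  finally show ?thesis
    using of_real_eq_iff by blast
qed simp

text \<open>By Pythagoras the squared norms have bounded finite sums, and the squared distance
  between the vector sums over nested finite sets is a difference of scalar sums. Hence the net of
  finite sums is Cauchy. The index type may be uncountable, so the argument runs along the filter of
  finite sets instead of a sequence.\<close>

lemma orthogonal_summable: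
  fixes f :: "'i \<Rightarrow> 'a::chilbert_space"
  assumes orth: "\<And>i j. i \<noteq> j \<Longrightarrow> cinner (f i) (f j) = 0"
    and bd: "\<And>F. finite F \<Longrightarrow> norm (sum f F) \<le> K"
  shows "f summable_on UNIV"
proof -
  let ?S = "filtermap (sum f) (finite_subsets_at_top UNIV)"
  have sq: "(norm (sum f F))\<^sup>2 = (\<Sum>i\<in>F. (norm (f i))\<^sup>2)" for F
    by (rule norm_sum_orthogonal) (rule orth)
  have summ: "(\<lambda>i. (norm (f i))\<^sup>2) summable_on UNIV"
  proof (rule nonneg_bdd_above_summable_on)
    show "bdd_above (sum (\<lambda>i. (norm (f i))\<^sup>2) ` {F. F \<subseteq> UNIV \<and> finite F})"
    proof (rule bdd_aboveI2)
      fix F assume "F \<in> {F. F \<subseteq> (UNIV :: 'i set) \<and> finite F}"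
      then show "(\<Sum>i\<in>F. (norm (f i))\<^sup>2) \<le> K\<^sup>2"
        unfolding sq[symmetric] by (intro power_mono bd) auto
    qed
  qed simp
  define A where "A = infsum (\<lambda>i. (norm (f i))\<^sup>2) UNIV"
  have lim: "((\<lambda>F. \<Sum>i\<in>F. (norm (f i))\<^sup>2) \<longlongrightarrow> A) (finite_subsets_at_top UNIV)"
    unfolding A_def by (rule infsum_tendsto[OF summ])
  have "cauchy_filter ?S"
    unfolding cauchy_filter_metric_filtermap
  proof (intro allI impI)
    fix e :: real assume e: "e > 0"
    have "eventually (\<lambda>F. dist (\<Sum>i\<in>F. (norm (f i))\<^sup>2) A < (e/2)\<^sup>2) (finite_subsets_at_top UNIV)"
      by (rule tendstoD[OF lim]) (use e in simp)
    then obtain F0 where F0: "finite F0"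
      "\<And>F. finite F \<Longrightarrow> F0 \<subseteq> F \<Longrightarrow> dist (\<Sum>i\<in>F. (norm (f i))\<^sup>2) A < (e/2)\<^sup>2"
      unfolding eventually_finite_subsets_at_top by auto
    have close: "norm (sum f F - sum f F0) < e / 2" if F: "finite F" "F0 \<subseteq> F" for F
    proof -
      have le: "(\<Sum>i\<in>F. (norm (f i))\<^sup>2) \<le> A"
        unfolding A_def by (rule finite_sum_le_infsum[OF summ F(1)]) auto
      have "sum f F - sum f F0 = sum f (F - F0)"
        using sum_diff[OF F, of f] by simp
      then have "(norm (sum f F - sum f F0))\<^sup>2 = (\<Sum>i\<in>F - F0. (norm (f i))\<^sup>2)"
        by (simp add: sq)
      also have "\<dots> = (\<Sum>i\<in>F. (norm (f i))\<^sup>2) - (\<Sum>i\<in>F0. (norm (f i))\<^sup>2)"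
        using sum_diff[OF F] by simp
      also have "\<dots> < (e/2)\<^sup>2"
        using le F0(2)[OF F0(1) order_refl] by (simp add: dist_real_def)
      finally show ?thesis
        by (rule power2_less_imp_less) (use e in simp)
    qed
    have "dist (sum f F) (sum f F') < e"
      if "finite F \<and> F0 \<subseteq> F" "finite F' \<and> F0 \<subseteq> F'" for F F'
      using close[of F] close[of F'] that dist_triangle_half_r[of "sum f F0" "sum f F" e "sum f F'"]
      by (auto simp: dist_norm norm_minus_commute)
    moreover have "eventually (\<lambda>F. finite F \<and> F0 \<subseteq> F) (finite_subsets_at_top UNIV)"
      unfolding eventually_finite_subsets_at_top by (intro exI[of _ F0]) (use F0(1) in auto)
    ultimately show "\<exists>P. eventually P (finite_subsets_at_top UNIV) \<and>
        (\<forall>x y. P x \<and> P y \<longrightarrow> dist (sum f x) (sum f y) < e)"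
      by blast
  qed
  \<comment> \<open>The class provides limits of Cauchy sequences; \<open>complete_uniform\<close>
    turns this into limits of Cauchy filters.\<close>
  moreover have "complete (UNIV :: 'a set)"
    by (metis UNIV_I Cauchy_convergent_iff completeI convergent_def)
  ultimately have "\<exists>x. ?S \<le> nhds x"
    unfolding complete_uniform
    by (metis finite_subsets_at_top_neq_bot filtermap_bot_iff iso_tuple_UNIV_I principal_UNIV top_greatest top.extremum)
  then show ?thesis
    unfolding summable_on_def has_sum_def filterlim_def by blast
qed

section \<open>Nearest points and orthogonal projections\<close>

lemma parallelogram_law:
  fixes x y :: "'a::complex_inner"
  shows "(norm (x + y))\<^sup>2 + (norm (x - y))\<^sup>2 = 2 * (norm x)\<^sup>2 + 2 * (norm y)\<^sup>2"
  by (simp add: norm_add_square norm_diff_square)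

text \<open>A minimizing sequence is Cauchy by the parallelogram law, and moving from its limit into
  \<open>S\<close> cannot bring one closer to \<open>b\<close>. The variational inequality is
  recorded instead of minimality because it yields orthogonality for subspaces and a separating
  vector for convex sets; both are used.\<close>

lemma closest_point_closed_convex:
  fixes S :: "'a::chilbert_space set"
  assumes "closed S" "convex S" "S \<noteq> {}"
  obtains c where "c \<in> S" "\<And>z. z \<in> S \<Longrightarrow> Re (cinner (z - c) (b - c)) \<le> 0"
proof -
  define d where "d = infdist b S"
  have d0: "0 \<le> d" by (simp add: d_def infdist_nonneg)
  have dle: "d \<le> norm (b - z)" if "z \<in> S" for z
    unfolding d_def using infdist_le[OF that, of b] by (simp add: dist_norm)
  have "\<exists>z\<in>S. norm (b - z) < d + inverse (real (Suc n))" for n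
  proof (rule ccontr)
    assume "\<not> ?thesis"
    then have "d + inverse (real (Suc n)) \<le> infdist b S"
      unfolding infdist_notempty[OF assms(3)]
      by (intro cINF_greatest[OF assms(3)]) (auto simp: dist_norm not_less)
    then show False by (simp add: d_def)
  qed
  then obtain z where z: "\<And>n. z n \<in> S" "\<And>n. norm (b - z n) < d + inverse (real (Suc n))"
    by metis
  have zlim: "(\<lambda>n. norm (b - z n)) \<longlonglongrightarrow> d"
  proof (rule tendsto_sandwich[of "\<lambda>_. d" _ _ "\<lambda>n. d + inverse (real (Suc n))"])
    show "(\<lambda>n. d + inverse (real (Suc n))) \<longlonglongrightarrow> d"
      using tendsto_add[OF tendsto_const[of d] LIMSEQ_inverse_real_of_nat] by simp
  qed (use z dle in \<open>auto intro: always_eventually less_imp_le\<close>)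
  have para: "(norm (z m - z n))\<^sup>2 \<le> 2 * ((norm (b - z m))\<^sup>2 - d\<^sup>2) + 2 * ((norm (b - z n))\<^sup>2 - d\<^sup>2)" for m n
  proof -
    \<comment> \<open>Convexity enters through this midpoint: its distance from \<open>b\<close> is
      at least \<open>d\<close>.\<close>
    define w where "w = (1/2) *\<^sub>R z m + (1/2) *\<^sub>R z n"
    have "w \<in> S"
      unfolding w_def by (rule convexD[OF assms(2)]) (auto simp: z)
    then have "d\<^sup>2 \<le> (norm (b - w))\<^sup>2"
      using dle d0 by (simp add: power_mono)
    moreover have "(b - z m) + (b - z n) = 2 *\<^sub>R (b - w)"
      by (simp add: w_def algebra_simps scaleR_2)
    then have "(norm ((b - z m) + (b - z n)))\<^sup>2 = 4 * (norm (b - w))\<^sup>2"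
      by (simp add: power_mult_distrib)
    moreover have "norm ((b - z m) - (b - z n)) = norm (z m - z n)"
      by (simp add: norm_minus_commute)
    ultimately show ?thesis
      using parallelogram_law[of "b - z m" "b - z n"] by simp
  qed
  have "Cauchy z"
  proof (rule CauchyI)
    fix e :: real assume e: "0 < e"
    have "(\<lambda>n. (norm (b - z n))\<^sup>2 - d\<^sup>2) \<longlonglongrightarrow> d\<^sup>2 - d\<^sup>2"
      by (intro tendsto_intros zlim)
    then have "\<forall>\<^sub>F n in sequentially. (norm (b - z n))\<^sup>2 - d\<^sup>2 < e\<^sup>2 / 4"
      by (rule order_tendstoD) (use e in simp)
    then obtain M where M: "\<And>n. n \<ge> M \<Longrightarrow> (norm (b - z n))\<^sup>2 - d\<^sup>2 < e\<^sup>2 / 4"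
      unfolding eventually_sequentially by blast
    have "norm (z m - z n) < e" if "m \<ge> M" "n \<ge> M" for m n
    proof (rule power2_less_imp_less)
      show "(norm (z m - z n))\<^sup>2 < e\<^sup>2"
        using para[of m n] add_strict_mono[OF M[OF that(1)] M[OF that(2)]] by simp
    qed (use e in simp)
    then show "\<exists>M. \<forall>m\<ge>M. \<forall>n\<ge>M. norm (z m - z n) < e" by blast
  qed
  then obtain c where c: "z \<longlonglongrightarrow> c"
    using Cauchy_convergent_iff convergent_def by blast
  have cS: "c \<in> S"
    using assms(1) z(1) c unfolding closed_sequential_limits by blast
  have "(\<lambda>n. norm (b - z n)) \<longlonglongrightarrow> norm (b - c)"
    by (intro tendsto_intros c)
  then have dc: "norm (b - c) = d"
    using LIMSEQ_unique zlim by blast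
  have "Re (cinner (y - c) (b - c)) \<le> 0" if y: "y \<in> S" for y
  proof -
    \<comment> \<open>First variation: \<open>c\<close> is compared with the point at parameter
      \<open>t\<close> on the segment to \<open>y\<close>. After division by \<open>t\<close> the
      quadratic term still carries a factor \<open>t\<close> and disappears in the limit.\<close>
    have ineq: "2 * Re (cinner (y - c) (b - c)) \<le> t * (norm (y - c))\<^sup>2" if t: "0 < t" "t < 1" for t :: real
    proof -
      have "(1 - t) *\<^sub>R c + t *\<^sub>R y \<in> S"
        by (rule convexD[OF assms(2) cS y]) (use t in auto)
      then have "d\<^sup>2 \<le> (norm (b - ((1 - t) *\<^sub>R c + t *\<^sub>R y)))\<^sup>2"
        using dle d0 by (simp add: power_mono)
      also have "b - ((1 - t) *\<^sub>R c + t *\<^sub>R y) = (b - c) - t *\<^sub>R (y - c)"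
        by (simp add: algebra_simps)
      also have "(norm \<dots>)\<^sup>2 = d\<^sup>2 + t\<^sup>2 * (norm (y - c))\<^sup>2 - 2 * t * Re (cinner (y - c) (b - c))"
        unfolding norm_diff_square[of "b - c"] dc cinner_commute[of "b - c"]
        by (simp add: power_mult_distrib scaleR_scaleC cinner_scaleC_left norm_scaleC)
      finally have "t * (2 * Re (cinner (y - c) (b - c))) \<le> t * (t * (norm (y - c))\<^sup>2)"
        by (simp add: power2_eq_square mult_ac)
      then show ?thesis using t by simp
    qed
    have "(\<lambda>n. inverse (real (Suc n)) * (norm (y - c))\<^sup>2) \<longlonglongrightarrow> 0"
      using tendsto_mult_left_zero[OF LIMSEQ_inverse_real_of_nat] by blast
    moreover have "\<forall>\<^sub>F n in sequentially.
        2 * Re (cinner (y - c) (b - c)) \<le> inverse (real (Suc n)) * (norm (y - c))\<^sup>2"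
      unfolding eventually_sequentially
      by (intro exI[of _ 1] allI impI ineq) (auto simp: field_simps)
    ultimately have "2 * Re (cinner (y - c) (b - c)) \<le> 0"
      by (intro tendsto_lowerbound[of _ 0 sequentially "2 * Re (cinner (y - c) (b - c))"]) auto
    then show ?thesis by simp
  qed
  with cS show ?thesis by (rule that)
qed

lemma csubspace_imp_convex:
  fixes M :: "'a::complex_vector set"
  assumes "complex_vector.subspace M"
  shows "convex M"
  unfolding convex_def scaleR_scaleC
  by (auto intro!: complex_vector.subspace_add complex_vector.subspace_scale assms)

text \<open>The difference of two candidates lies in \<open>M\<close> and is orthogonal to
  itself.\<close>

lemma orth_proj_unique:
  fixes M :: "'a::chilbert_space set"
  assumes "complex_vector.subspace M" "\<eta> \<in> M" "\<And>\<zeta>. \<zeta> \<in> M \<Longrightarrow> cinner (\<xi> - \<eta>) \<zeta> = 0"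
  shows "orth_proj M \<xi> = \<eta>"
  unfolding orth_proj_def
proof (rule the_equality)
  fix y assume y: "y \<in> M \<and> (\<forall>\<zeta>\<in>M. cinner (\<xi> - y) \<zeta> = 0)"
  have "y - \<eta> \<in> M"
    using y assms(1,2) by (simp add: complex_vector.subspace_diff)
  then have "cinner (\<xi> - \<eta>) (y - \<eta>) - cinner (\<xi> - y) (y - \<eta>) = 0"
    using y assms(3) by simp
  then have "cinner (y - \<eta>) (y - \<eta>) = 0"
    by (simp add: cinner_diff_left)
  then show "y = \<eta>"
    by (simp add: cinner_self)
qed (use assms in auto)

lemma orth_proj_props:
  fixes M :: "'a::chilbert_space set"
  assumes "complex_vector.subspace M" "closed M"
  shows orth_proj_in: "orth_proj M \<xi> \<in> M"
    and orth_proj_orth: "\<zeta> \<in> M \<Longrightarrow> cinner (\<xi> - orth_proj M \<xi>) \<zeta> = 0"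
proof -
  have "M \<noteq> {}"
    using complex_vector.subspace_0[OF assms(1)] by auto
  from closest_point_closed_convex[OF assms(2) csubspace_imp_convex[OF assms(1)] this]
  obtain c where c: "c \<in> M" "\<And>z. z \<in> M \<Longrightarrow> Re (cinner (z - c) (\<xi> - c)) \<le> 0"
    by blast
  have o: "cinner (\<xi> - c) \<zeta> = 0" if "\<zeta> \<in> M" for \<zeta>
  proof -
    let ?w = "cinner \<zeta> (\<xi> - c)"
    \<comment> \<open>A subspace admits every complex multiple of \<open>\<zeta>\<close>; this
      coefficient turns the inequality for real parts into a bound on the squared modulus of
      \<open>?w\<close>.\<close>
    have "Re (cinner (c + cnj ?w *\<^sub>C \<zeta> - c) (\<xi> - c)) \<le> 0"
      by (rule c(2)) (intro complex_vector.subspace_add complex_vector.subspace_scale assms c(1) that)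
    then have "(cmod ?w)\<^sup>2 \<le> 0"
      by (simp add: cinner_scaleC_left cmod_power2 flip: power2_eq_square)
    then show ?thesis
      by (subst cinner_commute) simp
  qed
  have "orth_proj M \<xi> = c"
    by (rule orth_proj_unique[OF assms(1) c(1) o])
  then show "orth_proj M \<xi> \<in> M" "\<zeta> \<in> M \<Longrightarrow> cinner (\<xi> - orth_proj M \<xi>) \<zeta> = 0"
    using c(1) o by simp_all
qed

context
  fixes M :: "'a::chilbert_space set"
  assumes sub: "complex_vector.subspace M" and cl: "closed M"
begin

lemma orth_proj_id: "\<xi> \<in> M \<Longrightarrow> orth_proj M \<xi> = \<xi>"
  by (rule orth_proj_unique[OF sub]) auto

lemma orth_proj_add: "orth_proj M (\<xi> + \<eta>) = orth_proj M \<xi> + orth_proj M \<eta>"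
proof (rule orth_proj_unique[OF sub])
  show "orth_proj M \<xi> + orth_proj M \<eta> \<in> M"
    by (intro complex_vector.subspace_add[OF sub] orth_proj_in[OF sub cl])
  show "cinner (\<xi> + \<eta> - (orth_proj M \<xi> + orth_proj M \<eta>)) \<zeta> = 0" if "\<zeta> \<in> M" for \<zeta>
    using orth_proj_orth[OF sub cl that, of \<xi>] orth_proj_orth[OF sub cl that, of \<eta>]
    by (simp add: cinner_diff_left cinner_add_left)
qed

lemma orth_proj_scaleC: "orth_proj M (c *\<^sub>C \<xi>) = c *\<^sub>C orth_proj M \<xi>"
proof (rule orth_proj_unique[OF sub])
  show "c *\<^sub>C orth_proj M \<xi> \<in> M"
    by (intro complex_vector.subspace_scale[OF sub] orth_proj_in[OF sub cl])
  show "cinner (c *\<^sub>C \<xi> - c *\<^sub>C orth_proj M \<xi>) \<zeta> = 0" if "\<zeta> \<in> M" for \<zeta>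
    using orth_proj_orth[OF sub cl that, of \<xi>]
    by (simp add: cinner_diff_left cinner_scaleC_left flip: right_diff_distrib)
qed

lemma cinner_orth_proj:
  assumes "\<eta> \<in> M"
  shows "cinner (orth_proj M \<xi>) \<eta> = cinner \<xi> \<eta>"
  using orth_proj_orth[OF sub cl assms, of \<xi>] by (simp add: cinner_diff_left)

lemma cinner_orth_proj_right:
  assumes "\<eta> \<in> M"
  shows "cinner \<eta> (orth_proj M \<xi>) = cinner \<eta> \<xi>"
  using cinner_orth_proj[OF assms, of \<xi>] cinner_commute by metis

lemma norm_orth_proj_le: "norm (orth_proj M \<xi>) \<le> norm \<xi>"
proof -
  have "(norm (orth_proj M \<xi>))\<^sup>2 = Re (cinner \<xi> (orth_proj M \<xi>))"
    using cinner_orth_proj[OF orth_proj_in[OF sub cl], of \<xi> \<xi>, symmetric] by (simp add: cinner_self)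
  also have "\<dots> \<le> norm \<xi> * norm (orth_proj M \<xi>)"
    by (rule Re_cinner_le)
  finally show ?thesis
    by (cases "orth_proj M \<xi> = 0") (auto simp: power2_eq_square)
qed

lemma bounded_linear_orth_proj: "bounded_linear (orth_proj M)"
  by (rule bounded_linear_intro[where K = 1])
    (simp_all add: orth_proj_add scaleR_scaleC orth_proj_scaleC norm_orth_proj_le)

end

lemma has_sum_sum:
  fixes f :: "'i \<Rightarrow> 'j \<Rightarrow> 'a::topological_comm_monoid_add"
  assumes "\<And>i. i \<in> I \<Longrightarrow> (f i has_sum S i) A"
  shows "((\<lambda>x. \<Sum>i\<in>I. f i x) has_sum (\<Sum>i\<in>I. S i)) A"
  using assms by (induction I rule: infinite_finite_induct) (auto intro!: has_sum_add)

section \<open>Operators on \<open>l\<^sup>2\<close>\<close>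

lemma Rep_ell2_sum: "Rep_ell2 (sum f A) i = (\<Sum>x\<in>A. Rep_ell2 (f x) i)"
  by (induction A rule: infinite_finite_induct) (simp_all add: zero_ell2.rep_eq plus_ell2.rep_eq)

lemma has_sum_norm_ell2: "((\<lambda>i. (cmod (Rep_ell2 f i))\<^sup>2) has_sum (norm f)\<^sup>2) UNIV"
  using Rep_ell2_summable[of f] by (simp add: norm_ell2.rep_eq infsum_nonneg)

text \<open>The finiteness test keeps the function square summable for every \<open>F\<close>, as
  lifting demands. Singletons give the basis vectors moved by translations; sets
  \<open>F \<times> F\<close> give finite matrices with the Hilbert-Schmidt inner product.\<close>

lift_definition ell2_fin :: "'i set \<Rightarrow> ('i \<Rightarrow> complex) \<Rightarrow> 'i ell2"
  is "\<lambda>F f i. if finite F \<and> i \<in> F then f i else 0"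
proof -
  fix F :: "'i set" and f :: "'i \<Rightarrow> complex"
  have "(\<lambda>i. (cmod (if finite F \<and> i \<in> F then f i else 0))\<^sup>2) summable_on UNIV
      \<longleftrightarrow> (\<lambda>i. (cmod (f i))\<^sup>2) summable_on (if finite F then F else {})"
    by (rule summable_on_cong_neutral) (auto split: if_splits)
  then show "(\<lambda>i. (cmod (if finite F \<and> i \<in> F then f i else 0))\<^sup>2) summable_on UNIV"
    by auto
qed

lemma norm_ell2_fin:
  assumes "finite F"
  shows "norm (ell2_fin F f) = L2_set (\<lambda>i. cmod (f i)) F"
proof -
  have "infsum (\<lambda>i. (cmod (if finite F \<and> i \<in> F then f i else 0))\<^sup>2) UNIV
      = infsum (\<lambda>i. (cmod (f i))\<^sup>2) F"
    by (rule infsum_cong_neutral) (use assms in auto)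
  then show ?thesis
    using assms by (simp add: norm_ell2.rep_eq ell2_fin.rep_eq L2_set_def)
qed

lemma cinner_ell2_fin:
  assumes "finite F"
  shows "cinner (ell2_fin F f) d = (\<Sum>i\<in>F. f i * cnj (Rep_ell2 d i))"
proof -
  have "infsum (\<lambda>i. (if finite F \<and> i \<in> F then f i else 0) * cnj (Rep_ell2 d i)) UNIV
      = infsum (\<lambda>i. f i * cnj (Rep_ell2 d i)) F"
    by (rule infsum_cong_neutral) (use assms in auto)
  then show ?thesis
    using assms by (simp add: cinner_ell2.rep_eq ell2_fin.rep_eq)
qed

lemma left_translate_add:
  "left_translate (g + h) \<xi> = left_translate g (left_translate h \<xi>)"
  by transfer (simp add: minus_add add.assoc del: add_uminus_conv_diff)

lemma norm_left_translate: "norm (left_translate g \<xi>) = norm \<xi>"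
proof -
  have "(\<Sum>\<^sub>\<infinity>i. (cmod (Rep_ell2 \<xi> (- g + i)))\<^sup>2) = (\<Sum>\<^sub>\<infinity>i. (cmod (Rep_ell2 \<xi> i))\<^sup>2)"
    by (rule infsum_reindex_bij_betw[of "\<lambda>i. - g + i" UNIV UNIV "\<lambda>i. (cmod (Rep_ell2 \<xi> i))\<^sup>2"])
      (auto intro!: bij_betwI[of _ _ _ "\<lambda>i. g + i"] simp: add.assoc[symmetric])
  then show ?thesis
    by (simp add: norm_ell2.rep_eq left_translate.rep_eq)
qed

lemma left_translate_scaleC: "left_translate g (c *\<^sub>C \<xi>) = c *\<^sub>C left_translate g \<xi>"
  by transfer simp

lemma left_translate_sum: "left_translate g (sum f A) = (\<Sum>i\<in>A. left_translate g (f i))"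
  unfolding left_regular.rep_eq[symmetric] by (rule blinfun.sum_right)

lemma left_translate_ell2_fin: "left_translate g (ell2_fin {h} f) = ell2_fin {g + h} (\<lambda>_. f h)"
proof -
  have "- g + i = h \<longleftrightarrow> i = g + h" for i
    by (metis add.assoc add.left_inverse add.right_inverse add_0)
  then show ?thesis
    by (transfer) (auto simp: fun_eq_iff)
qed

lemma ell2_fin_singleton_sum: "(\<Sum>j\<in>A. c j *\<^sub>C ell2_fin {g} (\<lambda>_. 1)) = ell2_fin {g} (\<lambda>_. sum c A)"
  by (simp add: Rep_ell2_inject[symmetric] fun_eq_iff Rep_ell2_sum scaleC_ell2.rep_eq ell2_fin.rep_eq
      if_distrib sum.If_cases)

text \<open>The matrix acts on each coordinate \<open>k\<close> of the family \<open>\<zeta>\<close>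
  separately. Summing the squared scalar inequality over all coordinates shows that
  \<open>a \<otimes> 1\<close> is a contraction whenever \<open>a\<close> is.\<close>

lemma scalar_matrix_on_ell2:
  fixes \<zeta> :: "nat \<Rightarrow> 'g ell2"
  assumes "\<And>u. L2_set (\<lambda>i. cmod (\<Sum>j<n. a i j * u j)) {..<n} \<le> L2_set (\<lambda>j. cmod (u j)) {..<n}"
  shows "L2_set (\<lambda>i. norm (\<Sum>j<n. a i j *\<^sub>C \<zeta> j)) {..<n} \<le> L2_set (\<lambda>j. norm (\<zeta> j)) {..<n}"
proof -
  have "((\<lambda>k. \<Sum>i<n. (cmod (Rep_ell2 (\<Sum>j<n. a i j *\<^sub>C \<zeta> j) k))\<^sup>2)
      has_sum (\<Sum>i<n. (norm (\<Sum>j<n. a i j *\<^sub>C \<zeta> j))\<^sup>2)) UNIV"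
    by (intro has_sum_sum has_sum_norm_ell2)
  moreover have "((\<lambda>k. \<Sum>j<n. (cmod (Rep_ell2 (\<zeta> j) k))\<^sup>2) has_sum (\<Sum>j<n. (norm (\<zeta> j))\<^sup>2)) UNIV"
    by (intro has_sum_sum has_sum_norm_ell2)
  moreover have "(\<Sum>i<n. (cmod (Rep_ell2 (\<Sum>j<n. a i j *\<^sub>C \<zeta> j) k))\<^sup>2)
      \<le> (\<Sum>j<n. (cmod (Rep_ell2 (\<zeta> j) k))\<^sup>2)" for k
    using assms[of "\<lambda>j. Rep_ell2 (\<zeta> j) k"] by (simp add: Rep_ell2_sum scaleC_ell2.rep_eq L2_set_def)
  ultimately have "(\<Sum>i<n. (norm (\<Sum>j<n. a i j *\<^sub>C \<zeta> j))\<^sup>2) \<le> (\<Sum>j<n. (norm (\<zeta> j))\<^sup>2)"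
    by (rule has_sum_mono)
  then show ?thesis
    by (simp add: L2_set_def)
qed

section \<open>Operator matrix norms as inequalities for columns of vectors\<close>

lemma opmat_norm_leI:
  assumes "\<And>\<xi>. L2_set (\<lambda>j. norm (\<xi> j)) {..<n} \<le> 1 \<Longrightarrow>
    L2_set (\<lambda>i. norm (\<Sum>j<n. blinfun_apply (X i j) (\<xi> j))) {..<n} \<le> c"
  shows "opmat_norm n X \<le> ennreal c"
  unfolding opmat_norm_def by (intro SUP_least ennreal_leI) (use assms in auto)

text \<open>Rescaling to the unit ball makes the bound homogeneous; a column of norm zero has only
  zero entries. Nonnegativity of \<open>c\<close> lets the comparison in \<open>ennreal\<close> be
  read as one of reals.\<close>

lemma opmat_norm_leD:
  fixes X :: "nat \<Rightarrow> nat \<Rightarrow> 'h::complex_inner \<Rightarrow>\<^sub>L 'h"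
  assumes le: "opmat_norm n X \<le> ennreal c" and c: "0 \<le> c"
  shows "L2_set (\<lambda>i. norm (\<Sum>j<n. blinfun_apply (X i j) (\<xi> j))) {..<n}
    \<le> c * L2_set (\<lambda>j. norm (\<xi> j)) {..<n}"
proof (cases "L2_set (\<lambda>j. norm (\<xi> j)) {..<n} = 0")
  case True
  then have "\<xi> j = 0" if "j < n" for j
    using that by (subst (asm) L2_set_eq_0_iff) auto
  then show ?thesis
    using True by (simp add: L2_set_def)
next
  case False
  define r where "r = L2_set (\<lambda>j. norm (\<xi> j)) {..<n}"
  have r: "r > 0"
    using False L2_set_nonneg[of "\<lambda>j. norm (\<xi> j)" "{..<n}"] unfolding r_def by linarith
  have scale: "L2_set (\<lambda>j. norm (inverse r *\<^sub>R \<eta> j)) {..<n} = inverse r * L2_set (\<lambda>j. norm (\<eta> j)) {..<n}"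
    for \<eta> :: "nat \<Rightarrow> 'h"
    using r by (simp add: L2_set_right_distrib)
  have "L2_set (\<lambda>j. norm (inverse r *\<^sub>R \<xi> j)) {..<n} \<le> 1"
    unfolding scale using r by (simp add: r_def[symmetric])
  then have "ennreal (L2_set (\<lambda>i. norm (\<Sum>j<n. blinfun_apply (X i j) (inverse r *\<^sub>R \<xi> j))) {..<n})
      \<le> opmat_norm n X"
    unfolding opmat_norm_def by (intro SUP_upper) simp
  with le have "L2_set (\<lambda>i. norm (\<Sum>j<n. blinfun_apply (X i j) (inverse r *\<^sub>R \<xi> j))) {..<n} \<le> c"
    using c by (meson ennreal_le_iff order_trans)
  then have "inverse r * L2_set (\<lambda>i. norm (\<Sum>j<n. blinfun_apply (X i j) (\<xi> j))) {..<n} \<le> c"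
    unfolding scale[symmetric] by (simp add: blinfun.scaleR_right scaleR_sum_right)
  then show ?thesis
    using r by (simp add: r_def[symmetric] field_simps)
qed

text \<open>Serves the duality arguments: pairing a column with itself produces its squared norm on
  the left and one factor of its norm on the right, which cancels.\<close>

lemma L2_set_le_of_square_le:
  assumes "(L2_set f A)\<^sup>2 \<le> c * L2_set f A" "0 \<le> c"
  shows "L2_set f A \<le> c"
proof (cases "L2_set f A = 0")
  case False
  then have "L2_set f A > 0"
    using L2_set_nonneg[of f A] by linarith
  then show ?thesis
    using assms(1) by (simp add: power2_eq_square)
qed (use assms(2) in simp)

lemma L2_set_square: "(L2_set f A)\<^sup>2 = (\<Sum>i\<in>A. (f i)\<^sup>2)"
  by (simp add: L2_set_def sum_nonneg)

section \<open>The transferred multiplier estimate\<close>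

lemma left_regular_in_reduced_cstar: "c *\<^sub>C left_regular g \<in> reduced_cstar"
  unfolding reduced_cstar_def group_alg_def
  by (intro subsetD[OF closure_subset] complex_vector.span_scale complex_vector.span_base) simp

text \<open>For completely bounded \<open>T\<close> the extended norm is finite, so nothing is lost
  by passing to a real number, and the estimates can use real arithmetic.\<close>

abbreviation (input) reduced_cb_norm ::
    "(('g::group_add ell2 \<Rightarrow>\<^sub>L 'g ell2) \<Rightarrow> ('k::complex_inner \<Rightarrow>\<^sub>L 'k)) \<Rightarrow> real"
  where "reduced_cb_norm T \<equiv> enn2real (cb_norm reduced_cstar T)"

context
  fixes \<phi> :: "'g::group_add \<Rightarrow> complex"
    and T :: "('g ell2 \<Rightarrow>\<^sub>L 'g ell2) \<Rightarrow> ('g ell2 \<Rightarrow>\<^sub>L 'g ell2)"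
  assumes T: "completely_bounded reduced_cstar reduced_cstar T"
    and T_left_regular: "\<And>g. T (left_regular g) = \<phi> g *\<^sub>C left_regular g"
begin

text \<open>The operator matrix \<open>(a\<^sub>i\<^sub>j \<lambda>(\<gamma>\<^sub>i\<gamma>\<^sub>j\<^sup>-\<^sup>1))\<close> is unitarily equivalent to \<open>a \<otimes> 1\<close>; the same
  computation for its image under \<open>T\<close> is done on the vectors \<open>u\<^sub>j \<delta>(\<gamma>\<^sub>j)\<close> only.\<close>

lemma multiplier_contraction_nat:
  fixes n :: nat and \<gamma> :: "nat \<Rightarrow> 'g"
  assumes a: "\<And>u. L2_set (\<lambda>i. cmod (\<Sum>j<n. a i j * u j)) {..<n} \<le> L2_set (\<lambda>j. cmod (u j)) {..<n}"
  shows "L2_set (\<lambda>i. cmod (\<Sum>j<n. \<phi> (\<gamma> i - \<gamma> j) * a i j * u j)) {..<n}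
    \<le> reduced_cb_norm T * L2_set (\<lambda>j. cmod (u j)) {..<n}"
proof -
  define X where "X = (\<lambda>i j. a i j *\<^sub>C left_regular (\<gamma> i - \<gamma> j))"
  have "opmat_norm n X \<le> ennreal 1"
  proof (rule opmat_norm_leI)
    fix \<xi> :: "nat \<Rightarrow> 'g ell2" assume \<xi>: "L2_set (\<lambda>j. norm (\<xi> j)) {..<n} \<le> 1"
    \<comment> \<open>The inverse of the diagonal unitary. In row \<open>i\<close> it leaves the
      isometry \<open>left_translate (\<gamma> i)\<close> in front of a purely scalar
      combination.\<close>
    define \<zeta> where "\<zeta> = (\<lambda>j. left_translate (- \<gamma> j) (\<xi> j))"
    have "(\<Sum>j<n. blinfun_apply (X i j) (\<xi> j)) = left_translate (\<gamma> i) (\<Sum>j<n. a i j *\<^sub>C \<zeta> j)" for i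
      unfolding X_def \<zeta>_def left_translate_sum left_translate_scaleC left_translate_add[symmetric]
      by (simp add: scaleC_blinfun.rep_eq left_regular.rep_eq)
    then have "L2_set (\<lambda>i. norm (\<Sum>j<n. blinfun_apply (X i j) (\<xi> j))) {..<n}
        = L2_set (\<lambda>i. norm (\<Sum>j<n. a i j *\<^sub>C \<zeta> j)) {..<n}"
      by (simp add: norm_left_translate)
    also have "\<dots> \<le> L2_set (\<lambda>j. norm (\<zeta> j)) {..<n}"
      by (rule scalar_matrix_on_ell2) (rule a)
    also have "\<dots> = L2_set (\<lambda>j. norm (\<xi> j)) {..<n}"
      by (simp add: \<zeta>_def norm_left_translate)
    finally show "L2_set (\<lambda>i. norm (\<Sum>j<n. blinfun_apply (X i j) (\<xi> j))) {..<n} \<le> 1"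
      using \<xi> by linarith
  qed
  then have "opmat_norm n (\<lambda>i j. T (X i j)) \<le> amplification_norm n reduced_cstar T"
    unfolding amplification_norm_def
    by (intro SUP_upper) (auto simp: X_def left_regular_in_reduced_cstar)
  also have "\<dots> \<le> cb_norm reduced_cstar T"
    unfolding cb_norm_def by (rule SUP_upper) simp
  also have "\<dots> = ennreal (reduced_cb_norm T)"
    using T by (simp add: completely_bounded_def less_top)
  finally have le: "opmat_norm n (\<lambda>i j. T (X i j)) \<le> ennreal (reduced_cb_norm T)" .
  have TX: "T (X i j) = (a i j * \<phi> (\<gamma> i - \<gamma> j)) *\<^sub>C left_regular (\<gamma> i - \<gamma> j)" for i j
    using T left_regular_in_reduced_cstar[of 1 "\<gamma> i - \<gamma> j"]
    by (simp add: X_def completely_bounded_def clinear_on_def T_left_regular scaleC_scaleC scaleC_one)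
  \<comment> \<open>Translation by \<open>\<gamma> i - \<gamma> j\<close> carries the basis vector
    at \<open>\<gamma> j\<close> to the one at \<open>\<gamma> i\<close>, so all terms of row
    \<open>i\<close> lie on one line and norms become moduli of scalars.\<close>
  define \<xi> where "\<xi> = (\<lambda>j. u j *\<^sub>C ell2_fin {\<gamma> j} (\<lambda>_. 1))"
  have "(\<Sum>j<n. blinfun_apply (T (X i j)) (\<xi> j))
      = ell2_fin {\<gamma> i} (\<lambda>_. \<Sum>j<n. \<phi> (\<gamma> i - \<gamma> j) * a i j * u j)" for i
  proof -
    have "(\<Sum>j<n. blinfun_apply (T (X i j)) (\<xi> j))
        = (\<Sum>j<n. (\<phi> (\<gamma> i - \<gamma> j) * a i j * u j) *\<^sub>C ell2_fin {\<gamma> i} (\<lambda>_. 1))"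
      unfolding TX \<xi>_def scaleC_blinfun.rep_eq left_regular.rep_eq left_translate_scaleC
        left_translate_ell2_fin
      by (simp add: scaleC_scaleC mult_ac)
    then show ?thesis
      by (simp add: ell2_fin_singleton_sum)
  qed
  moreover have "L2_set (\<lambda>i. norm (\<Sum>j<n. blinfun_apply (T (X i j)) (\<xi> j))) {..<n}
      \<le> reduced_cb_norm T * L2_set (\<lambda>j. norm (\<xi> j)) {..<n}"
    by (rule opmat_norm_leD[OF le]) simp
  ultimately show ?thesis
    by (simp add: \<xi>_def norm_scaleC norm_ell2_fin)
qed

text \<open>Enumerating \<open>I\<close> and dividing by \<open>M\<close> reduces this to
  contractive matrices; Cauchy-Schwarz leads back from columns to forms. A general labelling
  \<open>\<gamma>\<close> serves two uses: for blocks it forgets the first coordinate of a pair, and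
  in the predual estimate it is the identity.\<close>

lemma multiplier_bound:
  fixes \<gamma> :: "'i \<Rightarrow> 'g"
  assumes I: "finite I" and M: "0 < M"
    and a: "\<And>u v. cmod (\<Sum>p\<in>I. \<Sum>q\<in>I. a p q * u q * cnj (v p))
      \<le> M * L2_set (\<lambda>q. cmod (u q)) I * L2_set (\<lambda>p. cmod (v p)) I"
  shows "cmod (\<Sum>p\<in>I. \<Sum>q\<in>I. \<phi> (\<gamma> p - \<gamma> q) * a p q * u q * cnj (v p))
      \<le> reduced_cb_norm T * M * L2_set (\<lambda>q. cmod (u q)) I * L2_set (\<lambda>p. cmod (v p)) I"
proof -
  obtain h where h: "bij_betw h {..<card I} I"
    using ex_bij_betw_nat_finite[OF I] by (auto simp: atLeast0LessThan)
  define n where "n = card I"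
  have re: "(\<Sum>i<n. f (h i)) = sum f I" for f :: "'i \<Rightarrow> 'z::comm_monoid_add"
    using sum.reindex_bij_betw[OF h] by (simp add: n_def)
  have reL: "L2_set (\<lambda>i. f (h i)) {..<n} = L2_set f I" for f :: "'i \<Rightarrow> real"
    unfolding L2_set_def using re[of "\<lambda>i. (f i)\<^sup>2"] by simp
  define b where "b = (\<lambda>i j. a (h i) (h j) / M)"
  define k where "k = inv_into {..<n} h"
  have k: "k (h i) = i" if "i < n" for i
    using h that unfolding k_def n_def by (simp add: bij_betw_inv_into_left)
  have row: "L2_set (\<lambda>i. cmod (\<Sum>j<n. b i j * u j)) {..<n} \<le> L2_set (\<lambda>j. cmod (u j)) {..<n}" for u
  proof (rule L2_set_le_of_square_le)
    \<comment> \<open>A form is bounded by hypothesis, but a column has to be. So the image column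
      \<open>w\<close>, transported to \<open>I\<close> by \<open>k\<close>, is inserted as the
      second argument of the form.\<close>
    define w where "w = (\<lambda>i. \<Sum>j<n. b i j * u j)"
    have "complex_of_real ((L2_set (\<lambda>i. cmod (w i)) {..<n})\<^sup>2) = (\<Sum>i<n. w i * cnj (w i))"
      unfolding L2_set_square of_real_sum by (intro sum.cong refl) (metis complex_norm_square of_real_power)
    also have "\<dots> = (\<Sum>i<n. \<Sum>j<n. b i j * u j * cnj (w i))"
      by (subst (1) w_def) (simp add: sum_distrib_right)
    also have "\<dots> = (\<Sum>i<n. \<Sum>j<n. a (h i) (h j) * u (k (h j)) * cnj (w (k (h i)))) / M"
      by (simp add: b_def k sum_divide_distrib)
    also have "\<dots> = (\<Sum>p\<in>I. \<Sum>q\<in>I. a p q * u (k q) * cnj (w (k p))) / M"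
    proof -
      have "(\<Sum>j<n. a p (h j) * u (k (h j)) * cnj (w (k p))) = (\<Sum>q\<in>I. a p q * u (k q) * cnj (w (k p)))" for p
        by (rule re)
      then show ?thesis
        using re[of "\<lambda>p. \<Sum>q\<in>I. a p q * u (k q) * cnj (w (k p))"] by simp
    qed
    finally have "cmod (complex_of_real ((L2_set (\<lambda>i. cmod (w i)) {..<n})\<^sup>2))
        = cmod ((\<Sum>p\<in>I. \<Sum>q\<in>I. a p q * u (k q) * cnj (w (k p))) / M)"
      by (rule arg_cong)
    then have "(L2_set (\<lambda>i. cmod (w i)) {..<n})\<^sup>2
        = cmod (\<Sum>p\<in>I. \<Sum>q\<in>I. a p q * u (k q) * cnj (w (k p))) / M"
      using M unfolding norm_of_real norm_divide by simp
    also have "\<dots> \<le> (M * L2_set (\<lambda>q. cmod (u (k q))) I * L2_set (\<lambda>p. cmod (w (k p))) I) / M"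
      by (intro divide_right_mono a) (use M in simp)
    also have "\<dots> = L2_set (\<lambda>j. cmod (u j)) {..<n} * L2_set (\<lambda>i. cmod (w i)) {..<n}"
      unfolding reL[symmetric] using M by (simp add: k L2_set_def)
    finally show "(L2_set (\<lambda>i. cmod (\<Sum>j<n. b i j * u j)) {..<n})\<^sup>2
        \<le> L2_set (\<lambda>j. cmod (u j)) {..<n} * L2_set (\<lambda>i. cmod (\<Sum>j<n. b i j * u j)) {..<n}"
      by (simp add: w_def)
  qed simp
  define y where "y = (\<lambda>i. \<Sum>j<n. \<phi> (\<gamma> (h i) - \<gamma> (h j)) * b i j * u (h j))"
  have y: "L2_set (\<lambda>i. cmod (y i)) {..<n} \<le> reduced_cb_norm T * L2_set (\<lambda>q. cmod (u q)) I"
    unfolding y_def reL[symmetric] by (rule multiplier_contraction_nat) (rule row)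
  have "(\<Sum>p\<in>I. \<Sum>q\<in>I. \<phi> (\<gamma> p - \<gamma> q) * a p q * u q * cnj (v p)) = M * (\<Sum>i<n. y i * cnj (v (h i)))"
    unfolding re[symmetric] y_def b_def using M
    by (simp add: sum_distrib_right sum_distrib_left mult_ac)
  then have "cmod (\<Sum>p\<in>I. \<Sum>q\<in>I. \<phi> (\<gamma> p - \<gamma> q) * a p q * u q * cnj (v p))
      = M * cmod (\<Sum>i<n. y i * cnj (v (h i)))"
    using M by (simp add: norm_mult)
  also have "\<dots> \<le> M * (\<Sum>i<n. \<bar>cmod (y i)\<bar> * \<bar>cmod (v (h i))\<bar>)"
    by (intro mult_left_mono sum_norm_le) (use M in \<open>auto simp: norm_mult\<close>)
  also have "\<dots> \<le> M * (L2_set (\<lambda>i. cmod (y i)) {..<n} * L2_set (\<lambda>i. cmod (v (h i))) {..<n})"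
    by (intro mult_left_mono L2_set_mult_ineq) (use M in simp)
  also have "\<dots> \<le> M * (reduced_cb_norm T * L2_set (\<lambda>q. cmod (u q)) I * L2_set (\<lambda>p. cmod (v p)) I)"
    unfolding reL[of "\<lambda>p. cmod (v p)"] by (intro mult_left_mono mult_right_mono y) (use M in auto)
  finally show ?thesis
    by (simp add: mult_ac)
qed

end

section \<open>From scalar matrices to matrices of operators\<close>

lemma norm_scaleC_sgn: "complex_of_real (norm x) *\<^sub>C sgn x = (x::'a::complex_inner)"
  by (cases "x = 0") (simp_all add: sgn_div_norm scaleR_scaleC scaleC_scaleC scaleC_one)

lemma cinner_sgn_eq_0: "cinner x y = 0 \<Longrightarrow> cinner (sgn x) (sgn (y::'a::complex_inner)) = 0"
  by (simp add: sgn_div_norm scaleR_scaleC cinner_scaleC_left cinner_scaleC_right)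

text \<open>Equality can fail because \<open>sgn 0 = 0\<close>. Zero components, which are
  unavoidable when some subspace is trivial, are covered in this way.\<close>

lemma norm_sum_scaleC_sgn_le:
  fixes e :: "'i \<Rightarrow> 'a::complex_inner"
  assumes "\<And>s t. s \<in> F \<Longrightarrow> t \<in> F \<Longrightarrow> s \<noteq> t \<Longrightarrow> cinner (e s) (e t) = 0"
  shows "(norm (\<Sum>t\<in>F. u t *\<^sub>C sgn (e t)))\<^sup>2 \<le> (\<Sum>t\<in>F. (cmod (u t))\<^sup>2)"
proof -
  have "(norm (\<Sum>t\<in>F. u t *\<^sub>C sgn (e t)))\<^sup>2 = (\<Sum>t\<in>F. (norm (u t *\<^sub>C sgn (e t)))\<^sup>2)"
    by (rule norm_sum_orthogonal)
      (simp add: cinner_scaleC_left cinner_scaleC_right cinner_sgn_eq_0 assms)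
  also have "\<dots> \<le> (\<Sum>t\<in>F. (cmod (u t))\<^sup>2)"
    by (rule sum_mono) (simp add: norm_scaleC norm_sgn power_mult_distrib)
  finally show ?thesis .
qed

lemma bounded_ops_scaleC: "x \<in> bounded_ops \<Longrightarrow> blinfun_apply x (c *\<^sub>C \<xi>) = c *\<^sub>C blinfun_apply x \<xi>"
  by (simp add: bounded_ops_def)

context
  fixes \<phi> :: "'g::group_add \<Rightarrow> complex"
    and T :: "('g ell2 \<Rightarrow>\<^sub>L 'g ell2) \<Rightarrow> ('g ell2 \<Rightarrow>\<^sub>L 'g ell2)"
  assumes T: "completely_bounded reduced_cstar reduced_cstar T"
    and T_left_regular: "\<And>g. T (left_regular g) = \<phi> g *\<^sub>C left_regular g"
begin

text \<open>Once the vectors are fixed, the operator matrix becomes a single scalar matrix indexed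
  by pairs \<open>(i, s)\<close>. Amplification index and group index are merged, and
  \<open>snd\<close> recovers the group element, so the scalar estimate already covers all
  amplifications. The norms of the components serve as coefficients, and orthogonality reassembles
  them into norms of sums.\<close>

lemma block_multiplier_bound:
  fixes X :: "nat \<Rightarrow> nat \<Rightarrow> 'h::complex_inner \<Rightarrow>\<^sub>L 'h" and e f :: "nat \<Rightarrow> 'g \<Rightarrow> 'h"
  assumes F: "finite F" and M: "0 < M"
    and X: "\<And>i j. i < n \<Longrightarrow> j < n \<Longrightarrow> X i j \<in> bounded_ops"
    and bd: "\<And>\<xi>. L2_set (\<lambda>i. norm (\<Sum>j<n. blinfun_apply (X i j) (\<xi> j))) {..<n}
      \<le> M * L2_set (\<lambda>j. norm (\<xi> j)) {..<n}"
    and e: "\<And>j s t. s \<noteq> t \<Longrightarrow> cinner (e j s) (e j t) = 0"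
    and f: "\<And>i s t. s \<noteq> t \<Longrightarrow> cinner (f i s) (f i t) = 0"
  shows "cmod (\<Sum>i<n. \<Sum>s\<in>F. \<Sum>j<n. \<Sum>t\<in>F. \<phi> (s - t) * cinner (blinfun_apply (X i j) (e j t)) (f i s))
    \<le> reduced_cb_norm T * M * L2_set (\<lambda>j. norm (\<Sum>t\<in>F. e j t)) {..<n} * L2_set (\<lambda>i. norm (\<Sum>s\<in>F. f i s)) {..<n}"
proof -
  define I where "I = {..<n} \<times> F"
  define a where "a = (\<lambda>p q. cinner (blinfun_apply (X (fst p) (fst q)) (sgn (e (fst q) (snd q))))
    (sgn (f (fst p) (snd p))))"
  have I: "finite I"
    using F by (simp add: I_def)
  have sumI: "sum g I = (\<Sum>i<n. \<Sum>s\<in>F. g (i, s))" for g :: "nat \<times> 'g \<Rightarrow> 'z::comm_monoid_add"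
    by (simp add: I_def sum.cartesian_product)
  have L2I: "L2_set (\<lambda>j. norm (\<Sum>t\<in>F. u (j, t) *\<^sub>C sgn (e j t))) {..<n} \<le> L2_set (\<lambda>q. cmod (u q)) I"
    if e: "\<And>j s t. s \<noteq> t \<Longrightarrow> cinner (e j s) (e j t) = 0" for u and e :: "nat \<Rightarrow> 'g \<Rightarrow> 'h"
    unfolding L2_set_def sumI by (intro real_sqrt_le_mono sum_mono norm_sum_scaleC_sgn_le e)
  have L2I_norm: "L2_set (\<lambda>q. cmod (complex_of_real (norm (e (fst q) (snd q))))) I
      = L2_set (\<lambda>j. norm (\<Sum>t\<in>F. e j t)) {..<n}"
    if e: "\<And>j s t. s \<noteq> t \<Longrightarrow> cinner (e j s) (e j t) = 0" for e :: "nat \<Rightarrow> 'g \<Rightarrow> 'h"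
    unfolding L2_set_def sumI by (simp add: norm_sum_orthogonal e)
  \<comment> \<open>Coefficients are expanded along the normalized components. The form becomes a
    pairing of the operator matrix with the columns \<open>\<xi>\<close> and \<open>\<eta>\<close>,
    whose norms do not exceed those of \<open>u\<close> and \<open>v\<close>.\<close>
  have a_bd: "cmod (\<Sum>p\<in>I. \<Sum>q\<in>I. a p q * u q * cnj (v p))
      \<le> M * L2_set (\<lambda>q. cmod (u q)) I * L2_set (\<lambda>p. cmod (v p)) I" for u v
  proof -
    define \<xi> \<eta> where "\<xi> = (\<lambda>j. \<Sum>t\<in>F. u (j, t) *\<^sub>C sgn (e j t))"
      and "\<eta> = (\<lambda>i. \<Sum>s\<in>F. v (i, s) *\<^sub>C sgn (f i s))"
    have "(\<Sum>p\<in>I. \<Sum>q\<in>I. a p q * u q * cnj (v p))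
        = (\<Sum>i<n. cinner (\<Sum>j<n. blinfun_apply (X i j) (\<xi> j)) (\<eta> i))"
    proof -
      have row: "cinner (\<Sum>j<n. blinfun_apply (X i j) (\<xi> j)) (\<eta> i)
          = (\<Sum>s\<in>F. \<Sum>j<n. \<Sum>t\<in>F. a (i, s) (j, t) * u (j, t) * cnj (v (i, s)))" if "i < n" for i
        unfolding \<xi>_def \<eta>_def cinner_sum_right
        by (intro sum.cong refl)
          (simp add: a_def blinfun.sum_right cinner_sum_left cinner_scaleC_left cinner_scaleC_right
            bounded_ops_scaleC X that mult_ac sum_distrib_left)
      show ?thesis
        unfolding sumI by (rule sum.cong[OF refl], rule row[symmetric]) simp
    qed
    also have "cmod \<dots> \<le> (\<Sum>i<n. \<bar>norm (\<Sum>j<n. blinfun_apply (X i j) (\<xi> j))\<bar> * \<bar>norm (\<eta> i)\<bar>)"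
      by (rule sum_norm_le) (simp add: cinner_Cauchy_Schwarz)
    also have "\<dots> \<le> L2_set (\<lambda>i. norm (\<Sum>j<n. blinfun_apply (X i j) (\<xi> j))) {..<n}
        * L2_set (\<lambda>i. norm (\<eta> i)) {..<n}"
      by (rule L2_set_mult_ineq)
    also have "\<dots> \<le> (M * L2_set (\<lambda>j. norm (\<xi> j)) {..<n}) * L2_set (\<lambda>i. norm (\<eta> i)) {..<n}"
      by (intro mult_right_mono bd) simp
    also have "\<dots> \<le> (M * L2_set (\<lambda>q. cmod (u q)) I) * L2_set (\<lambda>p. cmod (v p)) I"
      unfolding \<xi>_def \<eta>_def
      by (intro mult_mono mult_left_mono L2I e f) (use M in \<open>auto intro!: mult_nonneg_nonneg\<close>)
    finally show ?thesis .
  qed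
  \<comment> \<open>Undoes the normalization; for a vanishing component both sides are 0.\<close>
  have resc: "cinner (blinfun_apply (X i j) (e j t)) (f i s)
      = a (i, s) (j, t) * complex_of_real (norm (e j t)) * cnj (complex_of_real (norm (f i s)))"
    if "i < n" "j < n" for i j s t
  proof -
    have "cinner (blinfun_apply (X i j) (complex_of_real (norm (e j t)) *\<^sub>C sgn (e j t)))
        (complex_of_real (norm (f i s)) *\<^sub>C sgn (f i s))
      = a (i, s) (j, t) * complex_of_real (norm (e j t)) * cnj (complex_of_real (norm (f i s)))"
      by (simp add: a_def cinner_scaleC_left cinner_scaleC_right bounded_ops_scaleC X that mult_ac)
    then show ?thesis
      by (simp add: norm_scaleC_sgn)
  qed
  have "(\<Sum>i<n. \<Sum>s\<in>F. \<Sum>j<n. \<Sum>t\<in>F. \<phi> (s - t) * cinner (blinfun_apply (X i j) (e j t)) (f i s))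
      = (\<Sum>p\<in>I. \<Sum>q\<in>I. \<phi> (snd p - snd q) * a p q * complex_of_real (norm (e (fst q) (snd q)))
          * cnj (complex_of_real (norm (f (fst p) (snd p)))))"
    unfolding sumI by (intro sum.cong refl) (simp add: resc mult_ac)
  also have "cmod \<dots> \<le> reduced_cb_norm T * M * L2_set (\<lambda>q. cmod (complex_of_real (norm (e (fst q) (snd q))))) I
      * L2_set (\<lambda>p. cmod (complex_of_real (norm (f (fst p) (snd p))))) I"
    by (rule multiplier_bound[OF T T_left_regular I M a_bd])
  also have "L2_set (\<lambda>q. cmod (complex_of_real (norm (e (fst q) (snd q))))) I
      = L2_set (\<lambda>j. norm (\<Sum>t\<in>F. e j t)) {..<n}"
    by (rule L2I_norm) (rule e)
  also have "L2_set (\<lambda>q. cmod (complex_of_real (norm (f (fst q) (snd q))))) I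
      = L2_set (\<lambda>j. norm (\<Sum>t\<in>F. f j t)) {..<n}"
    by (rule L2I_norm) (rule f)
  finally show ?thesis .
qed

end

section \<open>Bounded strong limits\<close>

context
  fixes Y :: "'i \<Rightarrow> 'a::real_normed_vector \<Rightarrow> 'b::banach" and \<F> :: "'i filter" and K :: real
  assumes F: "\<F> \<noteq> bot" and lin: "\<And>i. linear (Y i)" and bd: "\<And>i \<xi>. norm (Y i \<xi>) \<le> K * norm \<xi>"
begin

text \<open>The common bound makes the limits at \<open>x n\<close> a Cauchy sequence, and a
  three-epsilon estimate identifies its limit as the limit at \<open>l\<close>.\<close>

lemma closed_strong_convergence_set: "closed {\<xi>. \<exists>L. ((\<lambda>i. Y i \<xi>) \<longlongrightarrow> L) \<F>}"
  unfolding closed_sequential_limits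
proof (intro allI impI, elim conjE)
  fix x l assume "\<forall>n. x n \<in> {\<xi>. \<exists>L. ((\<lambda>i. Y i \<xi>) \<longlongrightarrow> L) \<F>}" and x: "x \<longlonglongrightarrow> l"
  then have "\<exists>L. ((\<lambda>i. Y i (x n)) \<longlongrightarrow> L) \<F>" for n
    by simp
  then obtain L where L: "\<And>n. ((\<lambda>i. Y i (x n)) \<longlongrightarrow> L n) \<F>"
    by metis
  have diff: "norm (Y i a - Y i b) \<le> \<bar>K\<bar> * norm (a - b)" for i a b
    using bd[of i "a - b"] mult_right_mono[OF abs_ge_self[of K] norm_ge_zero[of "a - b"]]
    by (simp add: linear_diff[OF lin])
  have Ldiff: "norm (L m - L n) \<le> \<bar>K\<bar> * norm (x m - x n)" for m n
  proof (rule tendsto_upperbound)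
    show "((\<lambda>i. norm (Y i (x m) - Y i (x n))) \<longlongrightarrow> norm (L m - L n)) \<F>"
      by (intro tendsto_intros L)
  qed (use F diff in auto)
  have "Cauchy L"
  proof (rule CauchyI)
    fix e :: real assume e: "0 < e"
    \<comment> \<open>The summand 1 keeps the denominator positive when \<open>K\<close> is
      0.\<close>
    obtain M where M: "\<And>m n. m \<ge> M \<Longrightarrow> n \<ge> M \<Longrightarrow> norm (x m - x n) < e / (\<bar>K\<bar> + 1)"
      using CauchyD[OF LIMSEQ_imp_Cauchy[OF x], of "e / (\<bar>K\<bar> + 1)"] e by auto
    have "norm (L m - L n) < e" if "m \<ge> M" "n \<ge> M" for m n
    proof -
      have "\<bar>K\<bar> * norm (x m - x n) \<le> (\<bar>K\<bar> + 1) * norm (x m - x n)"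
        by (intro mult_right_mono) auto
      also have "\<dots> < e"
        using M[OF that] by (simp add: field_simps add_pos_nonneg)
      finally show ?thesis
        using Ldiff[of m n] by linarith
    qed
    then show "\<exists>M. \<forall>m\<ge>M. \<forall>n\<ge>M. norm (L m - L n) < e" by blast
  qed
  then obtain L' where L': "L \<longlonglongrightarrow> L'"
    using Cauchy_convergent_iff convergent_def by blast
  have "((\<lambda>i. Y i l) \<longlongrightarrow> L') \<F>"
  proof (rule tendstoI)
    fix e :: real assume e: "0 < e"
    have "(\<lambda>n. \<bar>K\<bar> * norm (x n - l)) \<longlonglongrightarrow> \<bar>K\<bar> * norm (l - l)"
      by (intro tendsto_intros x)
    then have "\<forall>\<^sub>F n in sequentially. \<bar>K\<bar> * norm (x n - l) < e / 3"
      by (rule order_tendstoD) (use e in simp)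
    moreover have "\<forall>\<^sub>F n in sequentially. dist (L n) L' < e / 3"
      by (rule tendstoD[OF L']) (use e in simp)
    ultimately have "\<forall>\<^sub>F n in sequentially. \<bar>K\<bar> * norm (x n - l) < e / 3 \<and> dist (L n) L' < e / 3"
      by (rule eventually_conj)
    then obtain n where n: "\<bar>K\<bar> * norm (x n - l) < e / 3" "dist (L n) L' < e / 3"
      unfolding eventually_sequentially by blast
    have "\<forall>\<^sub>F i in \<F>. dist (Y i (x n)) (L n) < e / 3"
      by (rule tendstoD[OF L]) (use e in simp)
    then show "\<forall>\<^sub>F i in \<F>. dist (Y i l) L' < e"
    proof eventually_elim
      case (elim i)
      have "dist (Y i l) (Y i (x n)) < e / 3"
        using diff[of i l "x n"] n(1) by (simp add: dist_norm norm_minus_commute[of l])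
      then show ?case
        using elim n(2) dist_triangle[of "Y i l" L' "Y i (x n)"] dist_triangle[of "Y i (x n)" L' "L n"]
        by linarith
    qed
  qed
  then show "l \<in> {\<xi>. \<exists>L. ((\<lambda>i. Y i \<xi>) \<longlongrightarrow> L) \<F>}"
    by blast
qed

lemma strong_limit_blinfun:
  assumes "\<And>\<xi>. \<exists>L. ((\<lambda>i. Y i \<xi>) \<longlongrightarrow> L) \<F>"
  obtains y :: "'a \<Rightarrow>\<^sub>L 'b" where "\<And>\<xi>. ((\<lambda>i. Y i \<xi>) \<longlongrightarrow> blinfun_apply y \<xi>) \<F>"
proof -
  obtain y where y: "\<And>\<xi>. ((\<lambda>i. Y i \<xi>) \<longlongrightarrow> y \<xi>) \<F>"
    using assms by metis
  have "bounded_linear y"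
  proof (rule bounded_linear_intro[where K = K])
    fix \<xi> \<eta> r
    show "y (\<xi> + \<eta>) = y \<xi> + y \<eta>"
      using tendsto_add[OF y[of \<xi>] y[of \<eta>]] y[of "\<xi> + \<eta>"] tendsto_unique[OF F]
      by (simp add: linear_add[OF lin])
    show "y (r *\<^sub>R \<xi>) = r *\<^sub>R y \<xi>"
      using tendsto_scaleR[OF tendsto_const y[of \<xi>], of r] y[of "r *\<^sub>R \<xi>"] tendsto_unique[OF F]
      by (simp add: linear_scale[OF lin])
    show "norm (y \<xi>) \<le> norm \<xi> * K"
      by (rule tendsto_upperbound[OF tendsto_norm[OF y] _ F]) (use bd in \<open>simp add: mult.commute\<close>)
  qed
  then show ?thesis
    using that[of "Blinfun y"] y by (simp add: bounded_linear_Blinfun_apply)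
qed

end

section \<open>Orthogonal decompositions\<close>

abbreviation (input) comp_proj :: "('g \<Rightarrow> 'h::chilbert_space set) \<Rightarrow> 'g \<Rightarrow> 'h \<Rightarrow> 'h"
  where "comp_proj Hs g \<equiv> orth_proj (Hs g)"

context
  fixes Hs :: "'g \<Rightarrow> 'h::chilbert_space set"
  assumes Hs: "orthogonal_decomposition Hs"
begin

lemma component_subspace: "complex_vector.subspace (Hs g)"
  and component_closed: "closed (Hs g)"
  and component_orth: "g \<noteq> h \<Longrightarrow> \<xi> \<in> Hs g \<Longrightarrow> \<eta> \<in> Hs h \<Longrightarrow> cinner \<xi> \<eta> = 0"
  and components_dense: "closure (complex_vector.span (\<Union>g. Hs g)) = UNIV"
  using Hs unfolding orthogonal_decomposition_def by simp_all

lemmas comp_proj_in = orth_proj_in[OF component_subspace component_closed]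
  and comp_proj_id = orth_proj_id[OF component_subspace component_closed]
  and comp_proj_add = orth_proj_add[OF component_subspace component_closed]
  and comp_proj_scaleC = orth_proj_scaleC[OF component_subspace component_closed]
  and comp_proj_bounded_linear = bounded_linear_orth_proj[OF component_subspace component_closed]

lemmas comp_proj_sum = linear_sum[OF bounded_linear.linear[OF comp_proj_bounded_linear]]
  and comp_proj_0 = linear_0[OF bounded_linear.linear[OF comp_proj_bounded_linear]]

lemma comp_proj_orth: "s \<noteq> t \<Longrightarrow> cinner (comp_proj Hs s \<xi>) (comp_proj Hs t \<eta>) = 0"
  by (rule component_orth[OF _ comp_proj_in comp_proj_in])

lemma comp_proj_other: "s \<noteq> t \<Longrightarrow> \<xi> \<in> Hs t \<Longrightarrow> comp_proj Hs s \<xi> = 0"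
  by (rule orth_proj_unique[OF component_subspace])
    (simp_all add: complex_vector.subspace_0[OF component_subspace] component_orth[of t s])

lemma comp_proj_comp_proj: "comp_proj Hs s (comp_proj Hs t \<xi>) = (if s = t then comp_proj Hs t \<xi> else 0)"
  by (simp add: comp_proj_id[OF comp_proj_in] comp_proj_other[OF _ comp_proj_in])

lemma comp_proj_selfadjoint: "cinner (comp_proj Hs s \<xi>) \<eta> = cinner \<xi> (comp_proj Hs s \<eta>)"
proof -
  have "cinner (comp_proj Hs s \<xi>) \<eta> = cinner (comp_proj Hs s \<xi>) (comp_proj Hs s \<eta>)"
    by (rule cinner_orth_proj_right[OF component_subspace component_closed comp_proj_in, symmetric])
  also have "\<dots> = cinner \<xi> (comp_proj Hs s \<eta>)"
    by (rule cinner_orth_proj[OF component_subspace component_closed comp_proj_in])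
  finally show ?thesis .
qed

lemma Bessel_inequality: "norm (\<Sum>t\<in>F. comp_proj Hs t \<xi>) \<le> norm \<xi>"
proof -
  have "cinner (\<Sum>t\<in>F. comp_proj Hs t \<xi>) (\<Sum>t\<in>F. comp_proj Hs t \<xi>) = cinner \<xi> (\<Sum>t\<in>F. comp_proj Hs t \<xi>)"
  proof (cases "finite F")
    case True
    have "comp_proj Hs t (\<Sum>t\<in>F. comp_proj Hs t \<xi>) = comp_proj Hs t \<xi>" if "t \<in> F" for t
      using that True by (simp add: comp_proj_sum comp_proj_comp_proj)
    then show ?thesis
      by (simp add: cinner_sum_left comp_proj_selfadjoint) (simp add: cinner_sum_right)
  qed simp
  then have "(norm (\<Sum>t\<in>F. comp_proj Hs t \<xi>))\<^sup>2 = Re (cinner \<xi> (\<Sum>t\<in>F. comp_proj Hs t \<xi>))"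
    by (metis cinner_self Re_complex_of_real)
  also have "\<dots> \<le> norm \<xi> * norm (\<Sum>t\<in>F. comp_proj Hs t \<xi>)"
    by (rule Re_cinner_le)
  finally show ?thesis
    by (cases "(\<Sum>t\<in>F. comp_proj Hs t \<xi>) = 0") (auto simp: power2_eq_square)
qed

text \<open>The form in which density is used: a property is proved for all vectors by showing that
  those enjoying it form a closed subspace containing every component.\<close>

lemma mem_closed_subspace:
  assumes "complex_vector.subspace V" "closed V" "\<And>g. Hs g \<subseteq> V"
  shows "\<xi> \<in> V"
proof -
  have "complex_vector.span (\<Union>g. Hs g) \<subseteq> V"
    by (rule complex_vector.span_minimal) (use assms in auto)
  then have "closure (complex_vector.span (\<Union>g. Hs g)) \<subseteq> V"
    using assms(2) by (rule closure_minimal)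
  then show ?thesis
    using components_dense by auto
qed

text \<open>Such a vector is orthogonal to every component, hence by density to itself.\<close>

lemma eq_zero_if_components_zero:
  assumes "\<And>s. comp_proj Hs s \<xi> = 0"
  shows "\<xi> = 0"
proof -
  have "\<xi> \<in> {\<eta>. cinner \<xi> \<eta> = 0}"
  proof (rule mem_closed_subspace)
    show "complex_vector.subspace {\<eta>. cinner \<xi> \<eta> = 0}"
      by (rule complex_vector.subspaceI) (simp_all add: cinner_add_right cinner_scaleC_right)
    show "closed {\<eta>. cinner \<xi> \<eta> = 0}"
      by (rule closed_Collect_eq, rule linear_continuous_on,
          rule bounded_bilinear.bounded_linear_right[OF bounded_bilinear_cinner],
          rule continuous_on_const)
    show "Hs g \<subseteq> {\<eta>. cinner \<xi> \<eta> = 0}" for g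
    proof
      fix \<eta> assume "\<eta> \<in> Hs g"
      then have "cinner \<xi> \<eta> = cinner \<xi> (comp_proj Hs g \<eta>)"
        by (simp add: comp_proj_id)
      also have "\<dots> = 0"
        unfolding comp_proj_selfadjoint[symmetric] assms by simp
      finally show "\<eta> \<in> {\<eta>. cinner \<xi> \<eta> = 0}"
        by simp
    qed
  qed
  then show ?thesis
    by (simp add: cinner_self)
qed

text \<open>Supplies the uniqueness behind the description in \<open>schur_map\<close>. Operators
  with equal matrices agree on each \<open>Hs t\<close>, since all components of the images agree
  there, and then everywhere by density.\<close>

lemma op_matrix_inject:
  assumes "y \<in> bounded_ops" "z \<in> bounded_ops" "op_matrix Hs y = op_matrix Hs z"
  shows "y = z"
proof -
  have "\<xi> \<in> {\<xi>. blinfun_apply y \<xi> = blinfun_apply z \<xi>}" for \<xi>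
  proof (rule mem_closed_subspace)
    show "complex_vector.subspace {\<xi>. blinfun_apply y \<xi> = blinfun_apply z \<xi>}"
      by (rule complex_vector.subspaceI) (simp_all add: blinfun.add_right bounded_ops_scaleC assms)
    show "closed {\<xi>. blinfun_apply y \<xi> = blinfun_apply z \<xi>}"
      by (rule closed_Collect_eq; rule linear_continuous_on; rule blinfun.bounded_linear_right)
    show "Hs t \<subseteq> {\<xi>. blinfun_apply y \<xi> = blinfun_apply z \<xi>}" for t
    proof
      fix \<xi> assume \<xi>: "\<xi> \<in> Hs t"
      have "comp_proj Hs s (blinfun_apply y \<xi>) = comp_proj Hs s (blinfun_apply z \<xi>)" for s
        using fun_cong[OF fun_cong[OF fun_cong[OF assms(3)]], of s t \<xi>] \<xi>
        by (simp add: op_matrix_def)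
      then have "comp_proj Hs s (blinfun_apply y \<xi> - blinfun_apply z \<xi>) = 0" for s
        by (simp add: linear_diff[OF bounded_linear.linear[OF comp_proj_bounded_linear]])
      then have "blinfun_apply y \<xi> - blinfun_apply z \<xi> = 0"
        by (rule eq_zero_if_components_zero)
      then show "\<xi> \<in> {\<xi>. blinfun_apply y \<xi> = blinfun_apply z \<xi>}"
        by simp
    qed
  qed
  then show ?thesis
    by (intro blinfun_eqI) simp
qed

end

lemma eventually_subset_finite_subsets_at_top:
  "finite A \<Longrightarrow> \<forall>\<^sub>F F in finite_subsets_at_top UNIV. finite F \<and> A \<subseteq> F"
  unfolding eventually_finite_subsets_at_top by (intro exI[of _ A]) auto

section \<open>Existence and complete boundedness of the Schur multiplication\<close>

text \<open>The compression of the formal product to the rows and columns in \<open>F\<close>. A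
  plain function suffices because only its values at single vectors are taken to the limit.\<close>

definition schur_trunc ::
    "('g \<Rightarrow> 'h::chilbert_space set) \<Rightarrow> ('g \<Rightarrow> 'g \<Rightarrow> complex) \<Rightarrow> 'g set \<Rightarrow> ('h \<Rightarrow>\<^sub>L 'h) \<Rightarrow> 'h \<Rightarrow> 'h"
  where "schur_trunc Hs \<Lambda> F x \<xi> =
    (\<Sum>s\<in>F. \<Sum>t\<in>F. \<Lambda> s t *\<^sub>C orth_proj (Hs s) (blinfun_apply x (orth_proj (Hs t) \<xi>)))"

context
  fixes \<phi> :: "'g::group_add \<Rightarrow> complex"
    and Hs :: "'g \<Rightarrow> 'h::chilbert_space set"
    and T :: "('g ell2 \<Rightarrow>\<^sub>L 'g ell2) \<Rightarrow> ('g ell2 \<Rightarrow>\<^sub>L 'g ell2)"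
    and \<Lambda> :: "'g \<Rightarrow> 'g \<Rightarrow> complex"
  assumes Hs: "orthogonal_decomposition Hs"
    and T: "completely_bounded reduced_cstar reduced_cstar T"
    and T_left_regular: "\<And>g. T (left_regular g) = \<phi> g *\<^sub>C left_regular g"
    and \<Lambda>: "\<And>s t. \<Lambda> s t = \<phi> (s - t)"
begin

lemma linear_schur_trunc: "linear (schur_trunc Hs \<Lambda> F x)"
  by (rule linearI)
    (simp_all add: schur_trunc_def comp_proj_add[OF Hs] blinfun.add_right scaleC_add_right sum.distrib
      scaleR_sum_right scaleC_scaleR_commute blinfun.scaleR_right
      linear_scale[OF bounded_linear.linear[OF comp_proj_bounded_linear[OF Hs]]])

lemma schur_trunc_scaleC: "x \<in> bounded_ops \<Longrightarrow> schur_trunc Hs \<Lambda> F x (c *\<^sub>C \<xi>) = c *\<^sub>C schur_trunc Hs \<Lambda> F x \<xi>"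
  unfolding schur_trunc_def
  by (simp add: comp_proj_scaleC[OF Hs] bounded_ops_scaleC complex_vector.scale_sum_right scaleC_scaleC mult.commute)

lemma cinner_schur_trunc:
  "cinner (schur_trunc Hs \<Lambda> F x \<xi>) \<eta> = (\<Sum>s\<in>F. \<Sum>t\<in>F. \<phi> (s - t) * cinner (blinfun_apply x (comp_proj Hs t \<xi>)) (comp_proj Hs s \<eta>))"
  by (simp add: schur_trunc_def cinner_sum_left cinner_scaleC_left \<Lambda> comp_proj_selfadjoint[OF Hs])

text \<open>The output column \<open>\<eta>\<close> is paired with itself and the block estimate is
  applied to the components of \<open>\<xi> j\<close> and \<open>\<eta> i\<close>; Bessel's
  inequality removes the dependence on \<open>F\<close>. The constant does not depend on
  \<open>n\<close> either.\<close>

lemma block_schur_trunc_bound: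
  fixes X :: "nat \<Rightarrow> nat \<Rightarrow> 'h \<Rightarrow>\<^sub>L 'h"
  assumes M: "0 < M"
    and X: "\<And>i j. i < n \<Longrightarrow> j < n \<Longrightarrow> X i j \<in> bounded_ops"
    and bd: "\<And>\<xi>. L2_set (\<lambda>i. norm (\<Sum>j<n. blinfun_apply (X i j) (\<xi> j))) {..<n}
      \<le> M * L2_set (\<lambda>j. norm (\<xi> j)) {..<n}"
  shows "L2_set (\<lambda>i. norm (\<Sum>j<n. schur_trunc Hs \<Lambda> F (X i j) (\<xi> j))) {..<n}
    \<le> reduced_cb_norm T * M * L2_set (\<lambda>j. norm (\<xi> j)) {..<n}"
proof (cases "finite F")
  case True
  define \<eta> where "\<eta> = (\<lambda>i. \<Sum>j<n. schur_trunc Hs \<Lambda> F (X i j) (\<xi> j))"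
  have "L2_set (\<lambda>i. norm (\<eta> i)) {..<n} \<le> reduced_cb_norm T * M * L2_set (\<lambda>j. norm (\<xi> j)) {..<n}"
  proof (rule L2_set_le_of_square_le)
    have "complex_of_real ((L2_set (\<lambda>i. norm (\<eta> i)) {..<n})\<^sup>2) = (\<Sum>i<n. cinner (\<eta> i) (\<eta> i))"
      by (simp only: L2_set_square of_real_sum cinner_self)
    also have "\<dots> = (\<Sum>i<n. \<Sum>j<n. \<Sum>s\<in>F. \<Sum>t\<in>F.
        \<phi> (s - t) * cinner (blinfun_apply (X i j) (comp_proj Hs t (\<xi> j))) (comp_proj Hs s (\<eta> i)))"
      by (subst (1) \<eta>_def) (simp only: cinner_sum_left cinner_schur_trunc)
    also have "\<dots> = (\<Sum>i<n. \<Sum>s\<in>F. \<Sum>j<n. \<Sum>t\<in>F.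
        \<phi> (s - t) * cinner (blinfun_apply (X i j) (comp_proj Hs t (\<xi> j))) (comp_proj Hs s (\<eta> i)))"
      by (intro sum.cong[OF refl] sum.swap)
    finally have "(L2_set (\<lambda>i. norm (\<eta> i)) {..<n})\<^sup>2 = cmod (\<Sum>i<n. \<Sum>s\<in>F. \<Sum>j<n. \<Sum>t\<in>F.
        \<phi> (s - t) * cinner (blinfun_apply (X i j) (comp_proj Hs t (\<xi> j))) (comp_proj Hs s (\<eta> i)))"
      by (metis abs_power2 norm_of_real)
    also have "\<dots> \<le> reduced_cb_norm T * M * L2_set (\<lambda>j. norm (\<Sum>t\<in>F. comp_proj Hs t (\<xi> j))) {..<n}
        * L2_set (\<lambda>i. norm (\<Sum>s\<in>F. comp_proj Hs s (\<eta> i))) {..<n}"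
      by (rule block_multiplier_bound[OF T T_left_regular True M X bd]) (auto intro: comp_proj_orth[OF Hs])
    also have "\<dots> \<le> reduced_cb_norm T * M * L2_set (\<lambda>j. norm (\<xi> j)) {..<n} * L2_set (\<lambda>i. norm (\<eta> i)) {..<n}"
      by (intro mult_mono L2_set_mono Bessel_inequality[OF Hs] mult_nonneg_nonneg) (use M in auto)
    finally show "(L2_set (\<lambda>i. norm (\<eta> i)) {..<n})\<^sup>2
      \<le> reduced_cb_norm T * M * L2_set (\<lambda>j. norm (\<xi> j)) {..<n} * L2_set (\<lambda>i. norm (\<eta> i)) {..<n}" .
  qed (use M in simp)
  then show ?thesis
    by (simp add: \<eta>_def)
next
  case False
  then have "schur_trunc Hs \<Lambda> F (X i j) (\<xi> j) = 0" for i j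
    by (simp add: schur_trunc_def)
  then show ?thesis
    using M by (simp add: L2_set_def sum_nonneg)
qed

text \<open>The case of one block. The block estimate wants a strictly positive bound, hence
  \<open>norm x + 1\<close>; only uniformity in \<open>F\<close> matters here.\<close>

lemma schur_trunc_bound:
  assumes "x \<in> bounded_ops"
  shows "norm (schur_trunc Hs \<Lambda> F x \<xi>) \<le> reduced_cb_norm T * (norm x + 1) * norm \<xi>"
proof -
  have 1: "L2_set f {..<Suc 0} = \<bar>f 0\<bar>" for f :: "nat \<Rightarrow> real"
    by (simp add: lessThan_Suc L2_set_def)
  have "L2_set (\<lambda>i. norm (\<Sum>j<Suc 0. schur_trunc Hs \<Lambda> F x \<xi>)) {..<Suc 0}
      \<le> reduced_cb_norm T * (norm x + 1) * L2_set (\<lambda>j. norm \<xi>) {..<Suc 0}"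
  proof (rule block_schur_trunc_bound)
    fix \<xi> :: "nat \<Rightarrow> 'h"
    have "norm (blinfun_apply x (\<xi> 0)) \<le> norm x * norm (\<xi> 0)"
      by (rule norm_blinfun)
    also have "\<dots> \<le> (norm x + 1) * norm (\<xi> 0)"
      by (intro mult_right_mono) auto
    finally show "L2_set (\<lambda>i. norm (\<Sum>j<Suc 0. blinfun_apply x (\<xi> j))) {..<Suc 0}
      \<le> (norm x + 1) * L2_set (\<lambda>j. norm (\<xi> j)) {..<Suc 0}"
      unfolding 1 by (simp add: lessThan_Suc)
  qed (use assms in \<open>auto intro: add_nonneg_pos\<close>)
  then show ?thesis
    unfolding 1 by (simp add: lessThan_Suc)
qed

lemma schur_trunc_component:
  assumes "\<xi> \<in> Hs t" "finite F" "t \<in> F"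
  shows "schur_trunc Hs \<Lambda> F x \<xi> = (\<Sum>s\<in>F. \<Lambda> s t *\<^sub>C comp_proj Hs s (blinfun_apply x \<xi>))"
proof -
  have "(\<Sum>t'\<in>F. \<Lambda> s t' *\<^sub>C comp_proj Hs s (blinfun_apply x (comp_proj Hs t' \<xi>))) = \<Lambda> s t *\<^sub>C comp_proj Hs s (blinfun_apply x \<xi>)" for s
  proof -
    have "\<Lambda> s t' *\<^sub>C comp_proj Hs s (blinfun_apply x (comp_proj Hs t' \<xi>))
        = (if t' = t then \<Lambda> s t *\<^sub>C comp_proj Hs s (blinfun_apply x \<xi>) else 0)" for t'
      using assms(1) by (simp add: comp_proj_id[OF Hs] comp_proj_other[OF Hs] comp_proj_0[OF Hs])
    then show ?thesis
      using assms(2,3) by simp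
  qed
  then show ?thesis
    by (simp add: schur_trunc_def)
qed

lemma schur_trunc_convergent_component:
  assumes x: "x \<in> bounded_ops" and \<xi>: "\<xi> \<in> Hs t"
  shows "\<exists>L. ((\<lambda>F. schur_trunc Hs \<Lambda> F x \<xi>) \<longlongrightarrow> L) (finite_subsets_at_top UNIV)"
proof -
  define f where "f = (\<lambda>s. \<Lambda> s t *\<^sub>C comp_proj Hs s (blinfun_apply x \<xi>))"
  have orth: "cinner (f s) (f s') = 0" if "s \<noteq> s'" for s s'
    using comp_proj_orth[OF Hs that] by (simp add: f_def cinner_scaleC_left cinner_scaleC_right)
  have sq: "(norm (sum f F))\<^sup>2 = (\<Sum>s\<in>F. (norm (f s))\<^sup>2)" for F
    by (rule norm_sum_orthogonal) (rule orth)
  have "f summable_on UNIV"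
  proof (rule orthogonal_summable[OF orth])
    fix F :: "'g set" assume F: "finite F"
    \<comment> \<open>The partial sum is a truncation only if \<open>t\<close> belongs to the set;
      by Pythagoras, inserting \<open>t\<close> does not decrease the norm.\<close>
    have "(norm (sum f F))\<^sup>2 \<le> (norm (sum f (insert t F)))\<^sup>2"
      unfolding sq by (rule sum_mono2) (use F in auto)
    then have "norm (sum f F) \<le> norm (sum f (insert t F))"
      by simp
    also have "sum f (insert t F) = schur_trunc Hs \<Lambda> (insert t F) x \<xi>"
      unfolding f_def by (rule schur_trunc_component[symmetric]) (use \<xi> F in auto)
    also have "norm \<dots> \<le> reduced_cb_norm T * (norm x + 1) * norm \<xi>"
      by (rule schur_trunc_bound[OF x])
    finally show "norm (sum f F) \<le> reduced_cb_norm T * (norm x + 1) * norm \<xi>" .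
  qed
  from infsum_tendsto[OF this] have "((\<lambda>F. schur_trunc Hs \<Lambda> F x \<xi>) \<longlongrightarrow> infsum f UNIV) (finite_subsets_at_top UNIV)"
  proof (rule Lim_transform_eventually)
    show "\<forall>\<^sub>F F in finite_subsets_at_top UNIV. sum f F = schur_trunc Hs \<Lambda> F x \<xi>"
      using eventually_subset_finite_subsets_at_top[of "{t}"]
      by (auto elim!: eventually_mono simp: f_def schur_trunc_component[OF \<xi>])
  qed
  then show ?thesis ..
qed

text \<open>On a component the truncations are partial sums of an orthogonal series; the uniform
  bound extends convergence to the closed span.\<close>

lemma schur_trunc_convergent:
  assumes x: "x \<in> bounded_ops"
  shows "\<exists>L. ((\<lambda>F. schur_trunc Hs \<Lambda> F x \<xi>) \<longlongrightarrow> L) (finite_subsets_at_top UNIV)"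
proof -
  have "\<xi> \<in> {\<xi>. \<exists>L. ((\<lambda>F. schur_trunc Hs \<Lambda> F x \<xi>) \<longlongrightarrow> L) (finite_subsets_at_top UNIV)}"
  proof (rule mem_closed_subspace[OF Hs])
    show "complex_vector.subspace {\<xi>. \<exists>L. ((\<lambda>F. schur_trunc Hs \<Lambda> F x \<xi>) \<longlongrightarrow> L) (finite_subsets_at_top UNIV)}"
    proof (rule complex_vector.subspaceI; unfold mem_Collect_eq)
      show "\<exists>L. ((\<lambda>F. schur_trunc Hs \<Lambda> F x 0) \<longlongrightarrow> L) (finite_subsets_at_top UNIV)"
        by (auto simp: linear_0[OF linear_schur_trunc])
      show "\<exists>L. ((\<lambda>F. schur_trunc Hs \<Lambda> F x (\<xi> + \<eta>)) \<longlongrightarrow> L) (finite_subsets_at_top UNIV)"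
        if "\<exists>L. ((\<lambda>F. schur_trunc Hs \<Lambda> F x \<xi>) \<longlongrightarrow> L) (finite_subsets_at_top UNIV)"
          "\<exists>L. ((\<lambda>F. schur_trunc Hs \<Lambda> F x \<eta>) \<longlongrightarrow> L) (finite_subsets_at_top UNIV)" for \<xi> \<eta>
        using that unfolding linear_add[OF linear_schur_trunc] by (elim exE) (rule exI, rule tendsto_add)
      show "\<exists>L. ((\<lambda>F. schur_trunc Hs \<Lambda> F x (c *\<^sub>C \<xi>)) \<longlongrightarrow> L) (finite_subsets_at_top UNIV)"
        if "\<exists>L. ((\<lambda>F. schur_trunc Hs \<Lambda> F x \<xi>) \<longlongrightarrow> L) (finite_subsets_at_top UNIV)" for c \<xi>
        using that unfolding schur_trunc_scaleC[OF x] by (elim exE) (rule exI, rule tendsto_scaleC)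
    qed
    show "closed {\<xi>. \<exists>L. ((\<lambda>F. schur_trunc Hs \<Lambda> F x \<xi>) \<longlongrightarrow> L) (finite_subsets_at_top UNIV)}"
      by (rule closed_strong_convergence_set[OF _ linear_schur_trunc schur_trunc_bound[OF x]]) simp
    show "Hs t \<subseteq> {\<xi>. \<exists>L. ((\<lambda>F. schur_trunc Hs \<Lambda> F x \<xi>) \<longlongrightarrow> L) (finite_subsets_at_top UNIV)}" for t
      by (intro subsetI CollectI schur_trunc_convergent_component[OF x])
  qed
  then show ?thesis by simp
qed

text \<open>The strong limit of the truncations satisfies the description defining
  \<open>schur_map\<close>, so by uniqueness it is the operator described. The approximation
  statement is exported because the description by itself gives no handle on norms or
  linearity.\<close>

lemma schur_map_props:
  assumes x: "x \<in> bounded_ops"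
  shows schur_map_bounded: "schur_map Hs \<Lambda> x \<in> bounded_ops"
    and op_matrix_schur_map: "op_matrix Hs (schur_map Hs \<Lambda> x) = schur_product \<Lambda> (op_matrix Hs x)"
    and schur_trunc_tendsto_schur_map:
      "((\<lambda>F. schur_trunc Hs \<Lambda> F x \<xi>) \<longlongrightarrow> blinfun_apply (schur_map Hs \<Lambda> x) \<xi>) (finite_subsets_at_top UNIV)"
proof -
  obtain y where y: "\<And>\<xi>. ((\<lambda>F. schur_trunc Hs \<Lambda> F x \<xi>) \<longlongrightarrow> blinfun_apply y \<xi>) (finite_subsets_at_top UNIV)"
    by (rule strong_limit_blinfun[OF _ linear_schur_trunc schur_trunc_bound[OF x] schur_trunc_convergent[OF x]]) auto
  have y1: "y \<in> bounded_ops"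
    unfolding bounded_ops_def
  proof (intro CollectI allI)
    fix c \<xi>
    show "blinfun_apply y (c *\<^sub>C \<xi>) = c *\<^sub>C blinfun_apply y \<xi>"
      using tendsto_unique[OF _ y[of "c *\<^sub>C \<xi>"]] tendsto_scaleC[OF y[of \<xi>], of c]
      by (simp add: schur_trunc_scaleC[OF x])
  qed
  have y2: "op_matrix Hs y = schur_product \<Lambda> (op_matrix Hs x)"
  proof (intro ext)
    fix s t \<xi>
    have "comp_proj Hs s (blinfun_apply y \<xi>) = \<Lambda> s t *\<^sub>C comp_proj Hs s (blinfun_apply x \<xi>)" if \<xi>: "\<xi> \<in> Hs t"
    proof (rule tendsto_unique)
      show "((\<lambda>F. comp_proj Hs s (schur_trunc Hs \<Lambda> F x \<xi>)) \<longlongrightarrow> comp_proj Hs s (blinfun_apply y \<xi>)) (finite_subsets_at_top UNIV)"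
        by (rule bounded_linear.tendsto[OF comp_proj_bounded_linear[OF Hs] y])
      \<comment> \<open>Each matrix entry stabilizes as soon as \<open>F\<close> contains its row
        and its column.\<close>
      have "\<forall>\<^sub>F F in finite_subsets_at_top UNIV. comp_proj Hs s (schur_trunc Hs \<Lambda> F x \<xi>) = \<Lambda> s t *\<^sub>C comp_proj Hs s (blinfun_apply x \<xi>)"
        using eventually_subset_finite_subsets_at_top[of "{s, t}"]
      proof (rule eventually_mono)
        show "comp_proj Hs s (schur_trunc Hs \<Lambda> F x \<xi>) = \<Lambda> s t *\<^sub>C comp_proj Hs s (blinfun_apply x \<xi>)"
          if F: "finite F \<and> {s, t} \<subseteq> F" for F
        proof -
          have "comp_proj Hs s (\<Lambda> s' t *\<^sub>C comp_proj Hs s' (blinfun_apply x \<xi>))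
              = (if s' = s then \<Lambda> s t *\<^sub>C comp_proj Hs s (blinfun_apply x \<xi>) else 0)" for s'
            by (simp add: comp_proj_scaleC[OF Hs] comp_proj_comp_proj[OF Hs])
          then show ?thesis
            using F by (simp add: schur_trunc_component[OF \<xi>] comp_proj_sum[OF Hs])
        qed
      qed simp
      then show "((\<lambda>F. comp_proj Hs s (schur_trunc Hs \<Lambda> F x \<xi>)) \<longlongrightarrow> \<Lambda> s t *\<^sub>C comp_proj Hs s (blinfun_apply x \<xi>))
          (finite_subsets_at_top UNIV)"
        by (rule tendsto_eventually)
    qed simp
    then show "op_matrix Hs y s t \<xi> = schur_product \<Lambda> (op_matrix Hs x) s t \<xi>"
      by (simp add: op_matrix_def schur_product_def)
  qed
  have "schur_map Hs \<Lambda> x = y"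
    unfolding schur_map_def
  proof (rule the_equality)
    show "z = y" if "z \<in> bounded_ops \<and> op_matrix Hs z = schur_product \<Lambda> (op_matrix Hs x)" for z
      by (rule op_matrix_inject[OF Hs]) (use that y1 y2 in simp_all)
  qed (simp add: y1 y2)
  then show "schur_map Hs \<Lambda> x \<in> bounded_ops"
    "op_matrix Hs (schur_map Hs \<Lambda> x) = schur_product \<Lambda> (op_matrix Hs x)"
    "((\<lambda>F. schur_trunc Hs \<Lambda> F x \<xi>) \<longlongrightarrow> blinfun_apply (schur_map Hs \<Lambda> x) \<xi>) (finite_subsets_at_top UNIV)"
    using y1 y2 y by simp_all
qed

text \<open>Truncations depend linearly on the operator, and limits are unique.\<close>

lemma clinear_schur_map: "clinear_on bounded_ops (schur_map Hs \<Lambda>)"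
  unfolding clinear_on_def
proof (intro conjI ballI allI)
  fix x y :: "'h \<Rightarrow>\<^sub>L 'h" assume x: "x \<in> bounded_ops" and y: "y \<in> bounded_ops"
  have xy: "x + y \<in> bounded_ops"
    using x y by (simp add: bounded_ops_def blinfun.add_left scaleC_add_right)
  have "schur_trunc Hs \<Lambda> F (x + y) \<xi> = schur_trunc Hs \<Lambda> F x \<xi> + schur_trunc Hs \<Lambda> F y \<xi>" for F \<xi>
    by (simp add: schur_trunc_def blinfun.add_left comp_proj_add[OF Hs] scaleC_add_right sum.distrib)
  then have lim: "((\<lambda>F. schur_trunc Hs \<Lambda> F (x + y) \<xi>) \<longlongrightarrow> blinfun_apply (schur_map Hs \<Lambda> x + schur_map Hs \<Lambda> y) \<xi>)
      (finite_subsets_at_top UNIV)" for \<xi>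
    by (simp add: blinfun.add_left tendsto_add schur_trunc_tendsto_schur_map x y)
  show "schur_map Hs \<Lambda> (x + y) = schur_map Hs \<Lambda> x + schur_map Hs \<Lambda> y"
    by (intro blinfun_eqI) (rule tendsto_unique[OF _ schur_trunc_tendsto_schur_map[OF xy] lim], simp)
next
  fix c and x :: "'h \<Rightarrow>\<^sub>L 'h" assume x: "x \<in> bounded_ops"
  have cx: "c *\<^sub>C x \<in> bounded_ops"
    using x by (simp add: bounded_ops_def scaleC_blinfun.rep_eq scaleC_scaleC mult.commute)
  have "schur_trunc Hs \<Lambda> F (c *\<^sub>C x) \<xi> = c *\<^sub>C schur_trunc Hs \<Lambda> F x \<xi>" for F \<xi>
    by (simp add: schur_trunc_def scaleC_blinfun.rep_eq comp_proj_scaleC[OF Hs] complex_vector.scale_sum_right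
        scaleC_scaleC mult.commute)
  then have lim: "((\<lambda>F. schur_trunc Hs \<Lambda> F (c *\<^sub>C x) \<xi>) \<longlongrightarrow> blinfun_apply (c *\<^sub>C schur_map Hs \<Lambda> x) \<xi>)
      (finite_subsets_at_top UNIV)" for \<xi>
    by (simp add: scaleC_blinfun.rep_eq tendsto_scaleC schur_trunc_tendsto_schur_map x)
  show "schur_map Hs \<Lambda> (c *\<^sub>C x) = c *\<^sub>C schur_map Hs \<Lambda> x"
    by (intro blinfun_eqI) (rule tendsto_unique[OF _ schur_trunc_tendsto_schur_map[OF cx] lim], simp)
qed

text \<open>For a fixed column of vectors only finitely many strong limits are involved, so the norm
  of the image column is a limit of truncated ones. These obey the block estimate with constant 1
  for the unit ball, which gives the sharp comparison without any slack.\<close>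

lemma cb_norm_schur_map_le: "cb_norm bounded_ops (schur_map Hs \<Lambda>) \<le> cb_norm reduced_cstar T"
  unfolding cb_norm_def[of bounded_ops] amplification_norm_def
proof (intro SUP_least)
  fix n and X :: "nat \<Rightarrow> nat \<Rightarrow> 'h \<Rightarrow>\<^sub>L 'h"
  assume "X \<in> {X. (\<forall>i<n. \<forall>j<n. X i j \<in> bounded_ops) \<and> opmat_norm n X \<le> 1}"
  then have X: "\<And>i j. i < n \<Longrightarrow> j < n \<Longrightarrow> X i j \<in> bounded_ops" and "opmat_norm n X \<le> ennreal 1"
    by auto
  note bd = opmat_norm_leD[OF this(2) zero_le_one]
  have "opmat_norm n (\<lambda>i j. schur_map Hs \<Lambda> (X i j)) \<le> ennreal (reduced_cb_norm T)"
  proof (rule opmat_norm_leI)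
    fix \<xi> :: "nat \<Rightarrow> 'h" assume \<xi>: "L2_set (\<lambda>j. norm (\<xi> j)) {..<n} \<le> 1"
    show "L2_set (\<lambda>i. norm (\<Sum>j<n. blinfun_apply (schur_map Hs \<Lambda> (X i j)) (\<xi> j))) {..<n} \<le> reduced_cb_norm T"
    proof (rule tendsto_upperbound)
      show "((\<lambda>F. L2_set (\<lambda>i. norm (\<Sum>j<n. schur_trunc Hs \<Lambda> F (X i j) (\<xi> j))) {..<n})
        \<longlongrightarrow> L2_set (\<lambda>i. norm (\<Sum>j<n. blinfun_apply (schur_map Hs \<Lambda> (X i j)) (\<xi> j))) {..<n})
        (finite_subsets_at_top UNIV)"
        unfolding L2_set_def by (intro tendsto_intros schur_trunc_tendsto_schur_map) (auto intro: X)
      have "L2_set (\<lambda>i. norm (\<Sum>j<n. schur_trunc Hs \<Lambda> F (X i j) (\<xi> j))) {..<n} \<le> reduced_cb_norm T" for F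
        using block_schur_trunc_bound[OF zero_less_one X bd, of F \<xi>]
          mult_left_mono[OF \<xi>, of "reduced_cb_norm T"] by simp
      then show "\<forall>\<^sub>F F in finite_subsets_at_top UNIV.
          L2_set (\<lambda>i. norm (\<Sum>j<n. schur_trunc Hs \<Lambda> F (X i j) (\<xi> j))) {..<n} \<le> reduced_cb_norm T"
        by simp
    qed simp
  qed
  also have "\<dots> = cb_norm reduced_cstar T"
    using T by (simp add: completely_bounded_def less_top)
  finally show "opmat_norm n (\<lambda>i j. schur_map Hs \<Lambda> (X i j)) \<le> cb_norm reduced_cstar T" .
qed

lemma completely_bounded_schur_map: "completely_bounded bounded_ops bounded_ops (schur_map Hs \<Lambda>)"
  using le_less_trans[OF cb_norm_schur_map_le] T clinear_schur_map schur_map_bounded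
  by (simp add: completely_bounded_def image_subset_iff)

end

section \<open>Nuclear functionals on \<open>B(H)\<close>\<close>

text \<open>A quantitative form of ultraweak continuity: \<open>K\<close> bounds the trace norm of
  the functional. Bounding both square sums by the same \<open>K\<close>, and not just a product,
  makes the bounds add under concatenation. Unconditional sums allow double series to be
  rearranged.\<close>

definition nuclear :: "real \<Rightarrow> (('h::chilbert_space \<Rightarrow>\<^sub>L 'h) \<Rightarrow> complex) \<Rightarrow> bool"
  where "nuclear K f \<longleftrightarrow> (\<exists>(\<alpha> :: nat \<Rightarrow> 'h) \<beta> A B.
    ((\<lambda>n. (norm (\<alpha> n))\<^sup>2) has_sum A) UNIV \<and> ((\<lambda>n. (norm (\<beta> n))\<^sup>2) has_sum B) UNIV \<and> A \<le> K \<and> B \<le> K \<and>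
    (\<forall>x\<in>bounded_ops. ((\<lambda>n. cinner (blinfun_apply x (\<alpha> n)) (\<beta> n)) has_sum f x) UNIV))"

lemma nuclearI:
  fixes \<alpha> \<beta> :: "nat \<Rightarrow> 'h::chilbert_space"
  assumes "((\<lambda>n. (norm (\<alpha> n))\<^sup>2) has_sum A) UNIV" "((\<lambda>n. (norm (\<beta> n))\<^sup>2) has_sum B) UNIV" "A \<le> K" "B \<le> K"
    and "\<And>x. x \<in> bounded_ops \<Longrightarrow> ((\<lambda>n. cinner (blinfun_apply x (\<alpha> n)) (\<beta> n)) has_sum f x) UNIV"
  shows "nuclear K f"
  unfolding nuclear_def
  by (rule exI[of _ \<alpha>], rule exI[of _ \<beta>], rule exI[of _ A], rule exI[of _ B]) (intro conjI ballI assms)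

lemma nuclearE:
  fixes f :: "('h::chilbert_space \<Rightarrow>\<^sub>L 'h) \<Rightarrow> complex"
  assumes "nuclear K f"
  obtains \<alpha> \<beta> :: "nat \<Rightarrow> 'h" and A B where
    "((\<lambda>n. (norm (\<alpha> n))\<^sup>2) has_sum A) UNIV" "((\<lambda>n. (norm (\<beta> n))\<^sup>2) has_sum B) UNIV" "A \<le> K" "B \<le> K"
    "\<And>x. x \<in> bounded_ops \<Longrightarrow> ((\<lambda>n. cinner (blinfun_apply x (\<alpha> n)) (\<beta> n)) has_sum f x) UNIV"
  using assms unfolding nuclear_def by (elim exE conjE) (rule that, assumption+, erule (1) bspec)

lemma square_summable_cinner:
  fixes \<alpha> \<beta> :: "'i \<Rightarrow> 'h::chilbert_space"
  assumes "(\<lambda>n. (norm (\<alpha> n))\<^sup>2) summable_on I" "(\<lambda>n. (norm (\<beta> n))\<^sup>2) summable_on I"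
  shows "(\<lambda>n. norm (cinner (blinfun_apply x (\<alpha> n)) (\<beta> n))) summable_on I"
proof (rule Infinite_Sum.abs_summable_on_comparison_test')
  show "(\<lambda>n. norm x * ((norm (\<alpha> n))\<^sup>2 + (norm (\<beta> n))\<^sup>2)) summable_on I"
    by (intro summable_on_cmult_right summable_on_add assms)
  show "norm (cinner (blinfun_apply x (\<alpha> n)) (\<beta> n)) \<le> norm x * ((norm (\<alpha> n))\<^sup>2 + (norm (\<beta> n))\<^sup>2)" for n
  proof -
    have "norm (cinner (blinfun_apply x (\<alpha> n)) (\<beta> n)) \<le> norm (blinfun_apply x (\<alpha> n)) * norm (\<beta> n)"
      by (rule cinner_Cauchy_Schwarz)
    also have "\<dots> \<le> (norm x * norm (\<alpha> n)) * norm (\<beta> n)"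
      by (intro mult_right_mono norm_blinfun) simp
    also have "\<dots> = norm x * (norm (\<alpha> n) * norm (\<beta> n))"
      by (simp add: mult_ac)
    also have "\<dots> \<le> norm x * ((norm (\<alpha> n))\<^sup>2 + (norm (\<beta> n))\<^sup>2)"
    proof (rule mult_left_mono)
      show "norm (\<alpha> n) * norm (\<beta> n) \<le> (norm (\<alpha> n))\<^sup>2 + (norm (\<beta> n))\<^sup>2"
        using sum_squares_bound[of "norm (\<alpha> n)" "norm (\<beta> n)"]
          mult_nonneg_nonneg[OF norm_ge_zero[of "\<alpha> n"] norm_ge_zero[of "\<beta> n"]] by linarith
    qed simp
    finally show ?thesis .
  qed
qed

lemma nuclear_cong:
  assumes f: "nuclear K f" and eq: "\<And>x. x \<in> bounded_ops \<Longrightarrow> f x = g x"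
  shows "nuclear K g"
  by (rule nuclearE[OF f], rule nuclearI, assumption+) (simp flip: eq)

lemma nuclear_mono:
  assumes f: "nuclear K f" and le: "K \<le> K'"
  shows "nuclear K' f"
  by (rule nuclearE[OF f], rule nuclearI) (assumption | rule order_trans[OF _ le])+

lemma nuclear_zero: "0 \<le> K \<Longrightarrow> nuclear K (\<lambda>_. 0)"
  by (rule nuclearI[of "\<lambda>_. 0" 0 "\<lambda>_. 0" 0]) auto

text \<open>The representing sequences are concatenated through a bijection of pairs with naturals.
  Square sums add up to at most \<open>S\<close>, which makes the double series of inner products
  absolutely convergent, so it may be summed row by row.\<close>

lemma nuclear_countable_sum:
  fixes f :: "nat \<Rightarrow> ('h::chilbert_space \<Rightarrow>\<^sub>L 'h) \<Rightarrow> complex"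
  assumes f: "\<And>i. nuclear (K i) (f i)" and K: "(K has_sum S) UNIV"
    and g: "\<And>x. x \<in> bounded_ops \<Longrightarrow> ((\<lambda>i. f i x) has_sum g x) UNIV"
  shows "nuclear S g"
proof -
  \<comment> \<open>Bundling the conditions lets one choice pick compatible sequences and sums for
    every \<open>i\<close>.\<close>
  define Q where "Q = (\<lambda>i (\<alpha> :: nat \<Rightarrow> 'h) \<beta> A B.
    ((\<lambda>n. (norm (\<alpha> n))\<^sup>2) has_sum A) UNIV \<and> ((\<lambda>n. (norm (\<beta> n))\<^sup>2) has_sum B) UNIV \<and> A \<le> K i \<and> B \<le> K i \<and>
    (\<forall>x\<in>bounded_ops. ((\<lambda>n. cinner (blinfun_apply x (\<alpha> n)) (\<beta> n)) has_sum f i x) UNIV))"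
  have "\<exists>\<alpha> \<beta> A B. Q i \<alpha> \<beta> A B" for i
    using f[of i] unfolding nuclear_def Q_def .
  then obtain \<alpha> \<beta> A B where Q: "\<And>i. Q i (\<alpha> i) (\<beta> i) (A i) (B i)"
    by metis
  have a: "\<And>i. ((\<lambda>n. (norm (\<alpha> i n))\<^sup>2) has_sum A i) UNIV" "\<And>i. A i \<le> K i"
    and b: "\<And>i. ((\<lambda>n. (norm (\<beta> i n))\<^sup>2) has_sum B i) UNIV" "\<And>i. B i \<le> K i"
    and ab: "\<And>i x. x \<in> bounded_ops \<Longrightarrow> ((\<lambda>n. cinner (blinfun_apply x (\<alpha> i n)) (\<beta> i n)) has_sum f i x) UNIV"
    using Q by (simp_all add: Q_def)
  let ?d = prod_decode
  have re: "((\<lambda>n. h (?d n)) has_sum s) UNIV \<longleftrightarrow> (h has_sum s) (UNIV \<times> UNIV)"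
    for h :: "nat \<times> nat \<Rightarrow> 'z::{topological_comm_monoid_add,t2_space}" and s
    using has_sum_reindex_bij_betw[OF bij_prod_decode, of h s] by simp
  have sq: "\<exists>s. s \<le> S \<and> ((\<lambda>p. (norm (\<gamma> (fst p) (snd p)))\<^sup>2) has_sum s) (UNIV \<times> UNIV)"
    if "\<And>i. ((\<lambda>n. (norm (\<gamma> i n))\<^sup>2) has_sum C i) UNIV" "\<And>i. C i \<le> K i"
    for \<gamma> :: "nat \<Rightarrow> nat \<Rightarrow> 'h" and C
  proof -
    have C0: "0 \<le> C i" for i
      by (rule has_sum_nonneg[OF that(1)]) simp
    have C: "C summable_on UNIV"
      using summable_on_comparison_test[OF has_sum_imp_summable[OF K] that(2) C0] by simp
    have "infsum C UNIV \<le> S"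
      by (rule has_sum_mono[OF has_sum_infsum[OF C] K]) (rule that(2))
    moreover have "((\<lambda>p. (norm (\<gamma> (fst p) (snd p)))\<^sup>2) has_sum infsum C UNIV) (UNIV \<times> UNIV)"
      by (rule has_sum_SigmaI[OF _ has_sum_infsum[OF C] summable_on_SigmaI[OF _ C]])
        (simp_all add: that(1))
    ultimately show ?thesis
      by (intro exI conjI)
  qed
  obtain A' where A': "A' \<le> S" "((\<lambda>p. (norm (\<alpha> (fst p) (snd p)))\<^sup>2) has_sum A') (UNIV \<times> UNIV)"
    using sq[OF a] by (elim exE conjE)
  obtain B' where B': "B' \<le> S" "((\<lambda>p. (norm (\<beta> (fst p) (snd p)))\<^sup>2) has_sum B') (UNIV \<times> UNIV)"
    using sq[OF b] by (elim exE conjE)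
  show ?thesis
  proof (rule nuclearI)
    show "((\<lambda>n. (norm (\<alpha> (fst (?d n)) (snd (?d n))))\<^sup>2) has_sum A') UNIV"
      using A'(2) re[of "\<lambda>p. (norm (\<alpha> (fst p) (snd p)))\<^sup>2"] by simp
    show "((\<lambda>n. (norm (\<beta> (fst (?d n)) (snd (?d n))))\<^sup>2) has_sum B') UNIV"
      using B'(2) re[of "\<lambda>p. (norm (\<beta> (fst p) (snd p)))\<^sup>2"] by simp
    fix x :: "'h \<Rightarrow>\<^sub>L 'h" assume x: "x \<in> bounded_ops"
    let ?c = "\<lambda>p. cinner (blinfun_apply x (\<alpha> (fst p) (snd p))) (\<beta> (fst p) (snd p))"
    have "?c summable_on UNIV \<times> UNIV"
      by (rule abs_summable_summable, rule square_summable_cinner)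
        (rule has_sum_imp_summable[OF A'(2)], rule has_sum_imp_summable[OF B'(2)])
    then have "(?c has_sum g x) (UNIV \<times> UNIV)"
      by (intro has_sum_SigmaI[OF _ g[OF x]]) (simp_all add: ab[OF x])
    then show "((\<lambda>n. ?c (?d n)) has_sum g x) UNIV"
      using re[of ?c] by simp
  qed (use A' B' in auto)
qed

lemma nuclear_add:
  fixes f g :: "('h::chilbert_space \<Rightarrow>\<^sub>L 'h) \<Rightarrow> complex"
  assumes f: "nuclear K f" and g: "nuclear L g"
  shows "nuclear (K + L) (\<lambda>x. f x + g x)"
proof (rule nuclear_countable_sum)
  let ?h = "\<lambda>a b i::nat. if i = 0 then a else if i = 1 then b else 0"
  have hs: "(?h a b has_sum (a + b)) UNIV" for a b :: "'z::{topological_comm_monoid_add,t2_space}"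
    by (rule has_sum_finite_neutralI[of "{0, 1}"]) auto
  show "(?h K L has_sum (K + L)) UNIV"
    by (rule hs)
  show "((\<lambda>i. ?h (f x) (g x) i) has_sum (f x + g x)) UNIV" for x
    by (rule hs)
  show "nuclear (?h K L i) (\<lambda>x. ?h (f x) (g x) i)" for i
    using f g nuclear_zero[of 0, where ?'a = 'h] by simp
qed

lemma nuclear_sum:
  assumes "\<And>i. i \<in> I \<Longrightarrow> nuclear (K i) (f i)"
  shows "nuclear (sum K I) (\<lambda>x. \<Sum>i\<in>I. f i x)"
  using assms by (induction I rule: infinite_finite_induct) (simp_all add: nuclear_zero nuclear_add)

lemma nuclear_scale:
  fixes f :: "('h::chilbert_space \<Rightarrow>\<^sub>L 'h) \<Rightarrow> complex"
  assumes "nuclear K f"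
  shows "nuclear (cmod c * K) (\<lambda>x. c * f x)"
proof (cases "c = 0")
  case True
  then show ?thesis by (simp add: nuclear_zero)
next
  case False
  obtain \<alpha> \<beta> :: "nat \<Rightarrow> 'h" and A B where
    a: "((\<lambda>n. (norm (\<alpha> n))\<^sup>2) has_sum A) UNIV" and b: "((\<lambda>n. (norm (\<beta> n))\<^sup>2) has_sum B) UNIV"
    and AB: "A \<le> K" "B \<le> K"
    and ab: "\<And>x. x \<in> bounded_ops \<Longrightarrow> ((\<lambda>n. cinner (blinfun_apply x (\<alpha> n)) (\<beta> n)) has_sum f x) UNIV"
    by (rule nuclearE[OF assms]) (rule that)
  \<comment> \<open>Giving each sequence a factor of modulus \<open>sqrt (cmod c)\<close> multiplies
    both square sums by \<open>cmod c\<close>; the phase goes to \<open>\<alpha>\<close>.\<close>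
  define r where "r = sqrt (cmod c)"
  have r: "r > 0" "r\<^sup>2 = cmod c"
    using False by (simp_all add: r_def)
  have c: "cmod (c / of_real r) = r"
    using r by (simp add: norm_divide power2_eq_square[symmetric] field_simps)
  show ?thesis
  proof (rule nuclearI)
    show "((\<lambda>n. (norm ((c / of_real r) *\<^sub>C \<alpha> n))\<^sup>2) has_sum cmod c * A) UNIV"
      unfolding norm_scaleC c power_mult_distrib r(2) by (rule has_sum_cmult_right[OF a])
    show "((\<lambda>n. (norm (of_real r *\<^sub>C \<beta> n))\<^sup>2) has_sum cmod c * B) UNIV"
      using has_sum_cmult_right[OF b, of "cmod c"] r
      by (simp add: norm_scaleC power_mult_distrib)
    show "((\<lambda>n. cinner (blinfun_apply x ((c / of_real r) *\<^sub>C \<alpha> n)) (of_real r *\<^sub>C \<beta> n)) has_sum c * f x) UNIV"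
      if x: "x \<in> bounded_ops" for x
      using has_sum_cmult_right[OF ab[OF x], of c] r
      by (simp add: bounded_ops_scaleC[OF x] cinner_scaleC_left cinner_scaleC_right)
  qed (intro mult_left_mono AB norm_ge_zero)+
qed

text \<open>Normalizing both vectors before scaling yields the product of the norms; using
  \<open>a\<close> and \<open>b\<close> directly would give the larger of their squares.\<close>

lemma nuclear_rank_one:
  fixes a b :: "'h::chilbert_space"
  shows "nuclear (norm a * norm b) (\<lambda>x. cinner (blinfun_apply x a) b)"
proof -
  have 1: "((\<lambda>n::nat. if n = 0 then z else 0) has_sum z) UNIV"
    for z :: "'z::{topological_comm_monoid_add,t2_space}"
    by (rule has_sum_finite_neutralI[of "{0}"]) auto
  have sq: "((\<lambda>n::nat. (norm (if n = 0 then v else 0))\<^sup>2) has_sum (norm v)\<^sup>2) UNIV" for v :: 'h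
    using 1[of "(norm v)\<^sup>2"] by (rule has_sum_cong[THEN iffD1, rotated]) simp
  have le: "(norm (sgn v))\<^sup>2 \<le> 1" for v :: 'h
    by (simp add: norm_sgn)
  have "nuclear 1 (\<lambda>x. cinner (blinfun_apply x (sgn a)) (sgn b))"
  proof (rule nuclearI[OF sq sq le le])
    show "((\<lambda>n::nat. cinner (blinfun_apply x (if n = 0 then sgn a else 0)) (if n = 0 then sgn b else 0))
      has_sum cinner (blinfun_apply x (sgn a)) (sgn b)) UNIV" for x
      using 1[of "cinner (blinfun_apply x (sgn a)) (sgn b)"]
      by (rule has_sum_cong[THEN iffD1, rotated]) simp
  qed
  from nuclear_scale[OF this, of "of_real (norm a * norm b)"]
  have "nuclear (norm a * norm b) (\<lambda>x. of_real (norm a * norm b) * cinner (blinfun_apply x (sgn a)) (sgn b))"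
    by (simp add: norm_mult)
  then show ?thesis
  proof (rule nuclear_cong)
    show "of_real (norm a * norm b) * cinner (blinfun_apply x (sgn a)) (sgn b) = cinner (blinfun_apply x a) b"
      if x: "x \<in> bounded_ops" for x
    proof -
      have "cinner (blinfun_apply x (of_real (norm a) *\<^sub>C sgn a)) (of_real (norm b) *\<^sub>C sgn b)
          = of_real (norm a * norm b) * cinner (blinfun_apply x (sgn a)) (sgn b)"
        by (simp add: bounded_ops_scaleC[OF x] cinner_scaleC_left cinner_scaleC_right)
      then show ?thesis
        by (simp add: norm_scaleC_sgn)
    qed
  qed
qed

text \<open>On \<open>bounded_ops\<close> the functional equals a defining series of the topology,
  so the set is one of the generators.\<close>

lemma nuclear_openin_ultraweak:
  fixes f :: "('h::chilbert_space \<Rightarrow>\<^sub>L 'h) \<Rightarrow> complex"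
  assumes "nuclear K f" "open U"
  shows "openin ultraweak {x \<in> bounded_ops. f x \<in> U}"
proof -
  obtain \<alpha> \<beta> :: "nat \<Rightarrow> 'h" and A B where
    a: "((\<lambda>n. (norm (\<alpha> n))\<^sup>2) has_sum A) UNIV" and b: "((\<lambda>n. (norm (\<beta> n))\<^sup>2) has_sum B) UNIV"
    and "A \<le> K" "B \<le> K"
    and ab: "\<And>x. x \<in> bounded_ops \<Longrightarrow> ((\<lambda>n. cinner (blinfun_apply x (\<alpha> n)) (\<beta> n)) has_sum f x) UNIV"
    by (rule nuclearE[OF assms(1)]) (rule that)
  have "f x = (\<Sum>n. cinner (blinfun_apply x (\<alpha> n)) (\<beta> n))" if "x \<in> bounded_ops" for x
    by (rule sums_unique[OF has_sum_imp_sums[OF ab[OF that]]])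
  then have "{x \<in> bounded_ops. f x \<in> U}
      = {x \<in> bounded_ops. (\<Sum>n. cinner (blinfun_apply x (\<alpha> n)) (\<beta> n)) \<in> U}"
    by auto
  moreover have "summable (\<lambda>n. (norm (\<alpha> n))\<^sup>2)" "summable (\<lambda>n. (norm (\<beta> n))\<^sup>2)"
    using sums_summable[OF has_sum_imp_sums[OF a]] sums_summable[OF has_sum_imp_sums[OF b]] .
  ultimately show ?thesis
    unfolding ultraweak_def using assms(2) by (intro topology_generated_by_Basis) blast
qed

text \<open>The assumption \<open>dual\<close> says that \<open>b\<close> has trace norm at most \<open>K\<close>.  The matrices satisfying the
  conclusion with \<open>K\<close> form a convex set; if \<open>b\<close> is not in its closure for the Hilbert-Schmidt norm,
  the nearest point yields a separating operator.  On a finite index set, the remaining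
  Hilbert-Schmidt distance costs only \<open>\<delta>\<close>.\<close>

lemma nuclear_finite_matrix:
  fixes e f :: "'g \<Rightarrow> 'h::chilbert_space" and b :: "'g \<Rightarrow> 'g \<Rightarrow> complex"
  assumes F: "finite F" and K: "0 < K" and \<delta>: "0 < \<delta>"
    and e: "\<And>s t. s \<noteq> t \<Longrightarrow> cinner (e s) (e t) = 0"
    and f: "\<And>s t. s \<noteq> t \<Longrightarrow> cinner (f s) (f t) = 0"
    and dual: "\<And>M a. 0 < M \<Longrightarrow> (\<And>u v. cmod (\<Sum>p\<in>F. \<Sum>q\<in>F. a p q * u q * cnj (v p))
        \<le> M * L2_set (\<lambda>q. cmod (u q)) F * L2_set (\<lambda>p. cmod (v p)) F)
      \<Longrightarrow> cmod (\<Sum>p\<in>F. \<Sum>q\<in>F. b p q * a p q) \<le> K * M"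
  shows "nuclear (K + \<delta>) (\<lambda>x. \<Sum>p\<in>F. \<Sum>q\<in>F. b p q * cinner (blinfun_apply x (sgn (e q))) (sgn (f p)))"
proof -
  \<comment> \<open>Coefficient matrices are viewed as vectors of \<open>ell2\<close>, where the
    nearest point argument is available; linearity in \<open>z\<close> makes \<open>S\<close>
    convex.\<close>
  define \<Phi> where "\<Phi> = (\<lambda>(z :: ('g \<times> 'g) ell2) (x :: 'h \<Rightarrow>\<^sub>L 'h).
    \<Sum>p\<in>F. \<Sum>q\<in>F. Rep_ell2 z (p, q) * cinner (blinfun_apply x (sgn (e q))) (sgn (f p)))"
  define S where "S = {z. nuclear K (\<Phi> z)}"
  have \<Phi>_add: "\<Phi> (z + w) = (\<lambda>x. \<Phi> z x + \<Phi> w x)" for z w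
    by (simp add: \<Phi>_def fun_eq_iff plus_ell2.rep_eq distrib_right sum.distrib)
  have \<Phi>_scaleR: "\<Phi> (r *\<^sub>R z) = (\<lambda>x. of_real r * \<Phi> z x)" for r z
    by (simp add: \<Phi>_def fun_eq_iff scaleR_ell2_def scaleC_ell2.rep_eq sum_distrib_left mult.assoc)
  have zero: "0 \<in> S"
    using K by (simp add: S_def \<Phi>_def zero_ell2.rep_eq nuclear_zero)
  have "convex S"
    unfolding convex_def
  proof (intro ballI allI impI)
    fix z w and r t :: real assume "z \<in> S" "w \<in> S" and rt: "0 \<le> r" "0 \<le> t" "r + t = 1"
    then have "nuclear (cmod (of_real r) * K + cmod (of_real t) * K) (\<Phi> (r *\<^sub>R z + t *\<^sub>R w))"
      unfolding \<Phi>_add \<Phi>_scaleR by (intro nuclear_add nuclear_scale) (auto simp: S_def)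
    also have "cmod (of_real r) * K + cmod (of_real t) * K = K"
      using rt by (simp flip: distrib_right)
    finally show "r *\<^sub>R z + t *\<^sub>R w \<in> S"
      by (simp add: S_def)
  qed
  then have conv: "convex (closure S)"
    by (rule convex_closure)
  define B where "B = ell2_fin (F \<times> F) (\<lambda>(p, q). b p q)"
  have "closure S \<noteq> {}"
    using zero by auto
  from closest_point_closed_convex[OF closed_closure conv this, of B]
  obtain c where c: "c \<in> closure S" "\<And>z. z \<in> closure S \<Longrightarrow> Re (cinner (z - c) (B - c)) \<le> 0"
    by metis
  \<comment> \<open>The separating direction. On \<open>S\<close> the real part of the pairing with
    \<open>d\<close> is at most \<open>\<rho>\<close>, while at \<open>B\<close> it exceeds
    \<open>\<rho>\<close> by the squared norm of \<open>d\<close>.\<close>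
  define d where "d = B - c"
  define \<rho> where "\<rho> = Re (cinner c d)"
  have le: "Re (cinner z d) \<le> \<rho>" if "z \<in> S" for z
    using c(2)[OF subsetD[OF closure_subset that]] unfolding \<rho>_def d_def by (simp add: cinner_diff_left)
  have \<rho>: "0 \<le> \<rho>"
    using le[OF zero] by simp
  have cin: "cinner (ell2_fin (F \<times> F) h) d = (\<Sum>p\<in>F. \<Sum>q\<in>F. h (p, q) * cnj (Rep_ell2 d (p, q)))" for h
    using F by (simp add: cinner_ell2_fin sum.cartesian_product case_prod_beta)
  have "d = 0"
  proof (rule ccontr)
    assume "d \<noteq> 0"
    define \<sigma> where "\<sigma> = Re (cinner B d)"
    have "\<sigma> - \<rho> = Re (cinner d d)"
      using cinner_diff_left[of B c d] by (simp add: \<sigma>_def \<rho>_def flip: d_def)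
    also have "\<dots> > 0"
      using \<open>d \<noteq> 0\<close> by (simp add: cinner_self)
    finally have \<sigma>: "\<rho> < \<sigma>" by simp
    \<comment> \<open>Conjugation makes the bilinear pairing of \<open>b\<close> with
      \<open>a\<close> equal to \<open>cinner B d\<close>.\<close>
    define a where "a = (\<lambda>p q. cnj (Rep_ell2 d (p, q)))"
    have a: "cmod (\<Sum>p\<in>F. \<Sum>q\<in>F. a p q * u q * cnj (v p))
        \<le> (\<rho> + \<sigma>) / (2 * K) * L2_set (\<lambda>q. cmod (u q)) F * L2_set (\<lambda>p. cmod (v p)) F" for u v
    proof -
      define n where "n = L2_set (\<lambda>q. cmod (u q)) F * L2_set (\<lambda>p. cmod (v p)) F"
      define y where "y = (\<Sum>p\<in>F. \<Sum>q\<in>F. a p q * u q * cnj (v p))"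
      have n0: "0 \<le> n" by (simp add: n_def)
      have "cmod y \<le> \<rho> / K * n"
      proof (cases "n = 0")
        case True
        then have "(\<forall>q\<in>F. u q = 0) \<or> (\<forall>p\<in>F. v p = 0)"
          using F by (simp add: n_def L2_set_eq_0_iff)
        then have "y = 0"
          unfolding y_def by (auto intro!: sum.neutral)
        then show ?thesis using True by simp
      next
        case False
        \<comment> \<open>The modulus puts the rank one matrix \<open>z\<close> into
          \<open>S\<close>, and the phase makes its pairing with \<open>d\<close> equal to
          \<open>K / n * cmod y\<close>. Thus the bound \<open>\<rho>\<close> on \<open>S\<close>
          becomes an operator norm bound for \<open>a\<close>.\<close>
        define k where "k = of_real (K / n) * cnj (sgn y)"
        have "cmod k * n \<le> K"
          using n0 K False by (simp add: k_def norm_mult norm_divide norm_sgn)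
        define z where "z = ell2_fin (F \<times> F) (\<lambda>(p, q). k * (u q * cnj (v p)))"
        define U V where "U = (\<Sum>q\<in>F. u q *\<^sub>C sgn (e q))" and "V = (\<Sum>p\<in>F. v p *\<^sub>C sgn (f p))"
        have "norm U \<le> L2_set (\<lambda>q. cmod (u q)) F"
          unfolding L2_set_def U_def by (intro real_le_rsqrt norm_sum_scaleC_sgn_le e)
        moreover have "norm V \<le> L2_set (\<lambda>p. cmod (v p)) F"
          unfolding L2_set_def V_def by (intro real_le_rsqrt norm_sum_scaleC_sgn_le f)
        ultimately have "norm U * norm V \<le> n"
          unfolding n_def by (intro mult_mono) auto
        then have "cmod k * (norm U * norm V) \<le> K"
          using mult_left_mono[of "norm U * norm V" n "cmod k"] \<open>cmod k * n \<le> K\<close> by simp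
        with nuclear_scale[OF nuclear_rank_one[of U V], of k]
        have "nuclear K (\<lambda>x. k * cinner (blinfun_apply x U) V)"
          by (rule nuclear_mono)
        moreover have "k * cinner (blinfun_apply x U) V = \<Phi> z x" if x: "x \<in> bounded_ops" for x
          using F
          by (simp add: \<Phi>_def z_def ell2_fin.rep_eq U_def V_def blinfun.sum_right cinner_sum_right
              cinner_sum_left bounded_ops_scaleC[OF x] cinner_scaleC_left cinner_scaleC_right
              sum_distrib_left mult_ac)
        ultimately have "nuclear K (\<Phi> z)"
          by (rule nuclear_cong)
        then have "z \<in> S"
          by (simp add: S_def)
        then have "Re (cinner z d) \<le> \<rho>" by (rule le)
        also have "cinner z d = k * y"
          unfolding z_def cin y_def a_def by (simp add: sum_distrib_left mult_ac)
        also have "k * y = of_real (K / n * cmod y)"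
          by (simp add: k_def mult.assoc cnj_sgn_mult_self)
        finally show ?thesis
          using K n0 False by (simp add: field_simps)
      qed
      \<comment> \<open>The midpoint of \<open>\<rho>\<close> and \<open>\<sigma>\<close> is
        positive even if \<open>\<rho>\<close> is 0, as \<open>dual\<close> requires, and still
        below \<open>\<sigma>\<close>, which gives the contradiction.\<close>
      also have "\<dots> \<le> (\<rho> + \<sigma>) / (2 * K) * n"
        by (intro mult_right_mono n0) (use K \<sigma> in \<open>simp add: field_simps\<close>)
      finally show ?thesis
        by (simp add: y_def n_def mult.assoc)
    qed
    have "cmod (\<Sum>p\<in>F. \<Sum>q\<in>F. b p q * a p q) \<le> K * ((\<rho> + \<sigma>) / (2 * K))"
      by (rule dual[OF _ a]) (use K \<rho> \<sigma> in simp)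
    also have "(\<Sum>p\<in>F. \<Sum>q\<in>F. b p q * a p q) = cinner B d"
      unfolding B_def cin a_def by simp
    finally have "\<sigma> \<le> (\<rho> + \<sigma>) / 2"
      using K complex_Re_le_cmod[of "cinner B d"] unfolding \<sigma>_def by simp
    then show False using \<sigma> by simp
  qed
  then have "B \<in> closure S"
    using c(1) by (simp add: d_def)
  \<comment> \<open>There are \<open>m - 1\<close> entries, each contributing at most
    \<open>\<delta> / m\<close>; the extra 1 keeps \<open>m\<close> positive for empty
    \<open>F\<close>.\<close>
  define m where "m = real (card F) * real (card F) + 1"
  have m: "m > 0" by (simp add: m_def add_nonneg_pos)
  obtain z where z: "z \<in> S" "dist z B < \<delta> / m"
    using \<open>B \<in> closure S\<close> \<delta> m unfolding closure_approachable by (meson divide_pos_pos)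
  define w where "w = B - z"
  have w: "cmod (Rep_ell2 w pq) \<le> \<delta> / m" for pq
    using cmod_le_norm_ell2[of w pq] z(2) by (simp add: w_def dist_norm norm_minus_commute)
  have entry: "nuclear (\<delta> / m) (\<lambda>x. Rep_ell2 w (p, q) * cinner (blinfun_apply x (sgn (e q))) (sgn (f p)))" for p q
  proof (rule nuclear_mono[OF nuclear_scale[OF nuclear_rank_one]])
    have "norm (sgn (e q)) * norm (sgn (f p)) \<le> 1 * 1"
      by (intro mult_mono) (auto simp: norm_sgn)
    then have "cmod (Rep_ell2 w (p, q)) * (norm (sgn (e q)) * norm (sgn (f p))) \<le> cmod (Rep_ell2 w (p, q)) * 1"
      by (intro mult_left_mono) auto
    then show "cmod (Rep_ell2 w (p, q)) * (norm (sgn (e q)) * norm (sgn (f p))) \<le> \<delta> / m"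
      using w[of "(p, q)"] by simp
  qed
  have "nuclear (\<Sum>p\<in>F. \<Sum>q\<in>F. \<delta> / m) (\<Phi> w)"
    unfolding \<Phi>_def by (intro nuclear_sum entry)
  moreover have "(\<Sum>p\<in>F. \<Sum>q\<in>F. \<delta> / m) \<le> \<delta>"
  proof -
    have "(\<Sum>p\<in>F. \<Sum>q\<in>F. \<delta> / m) = (m - 1) * \<delta> / m"
      by (simp add: m_def)
    also have "\<dots> \<le> \<delta>"
      using m \<delta> by (simp add: field_simps)
    finally show ?thesis .
  qed
  ultimately have "nuclear \<delta> (\<Phi> w)"
    by (rule nuclear_mono)
  then have "nuclear (K + \<delta>) (\<lambda>x. \<Phi> z x + \<Phi> w x)"
    using z(1) by (intro nuclear_add) (simp_all add: S_def)
  also have "(\<lambda>x. \<Phi> z x + \<Phi> w x) = \<Phi> B"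
    by (simp flip: \<Phi>_add add: w_def)
  also have "\<Phi> B = (\<lambda>x. \<Sum>p\<in>F. \<Sum>q\<in>F. b p q * cinner (blinfun_apply x (sgn (e q))) (sgn (f p)))"
    using F by (simp add: \<Phi>_def B_def ell2_fin.rep_eq)
  finally show ?thesis .
qed

section \<open>Ultraweak continuity of the Schur multiplication\<close>

text \<open>Differences of approximants with geometrically decreasing errors form a telescoping
  series. Their norms are at most \<open>3/2 * norm \<xi>\<close> times powers of one half, which
  sum to \<open>3 * norm \<xi>\<close>.\<close>

lemma dense_subspace_series:
  fixes D :: "'a::real_normed_vector set"
  assumes D: "\<forall>\<xi>\<in>D. \<forall>\<eta>\<in>D. \<xi> - \<eta> \<in> D" and dense: "closure D = UNIV" and zero: "0 \<in> D"
  obtains d s where "\<And>k::nat. d k \<in> D" "((\<lambda>k. norm (d k)) has_sum s) UNIV" "s \<le> 3 * norm \<xi>"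
    "\<And>h :: 'a \<Rightarrow> complex. bounded_linear h \<Longrightarrow> ((\<lambda>k. h (d k)) has_sum h \<xi>) UNIV"
proof (cases "\<xi> = 0")
  case True
  show ?thesis
    by (rule that[of "\<lambda>_. 0" 0]) (use True zero in \<open>auto dest: linear_simps\<close>)
next
  case False
  have "\<exists>p\<in>D. norm (p - \<xi>) < norm \<xi> * (1/2)^k" for k :: nat
    using dense False closure_approachable[of \<xi> D] by (auto simp: dist_norm)
  then obtain p' where p': "\<And>k. p' k \<in> D" "\<And>k. norm (p' k - \<xi>) < norm \<xi> * (1/2)^k"
    by metis
  \<comment> \<open>Starting at 0 makes the telescoping sum equal to the whole vector, and the error
    bound holds with equality at index 0.\<close>
  define p where "p = (\<lambda>k::nat. if k = 0 then 0 else p' k)"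
  have p: "p k \<in> D" "norm (p k - \<xi>) \<le> norm \<xi> * (1/2)^k" for k
    using p'[of k] zero by (auto simp: p_def)
  define d where "d = (\<lambda>k. p (Suc k) - p k)"
  have nd: "norm (d k) \<le> norm \<xi> * (3/2) * (1/2)^k" for k
  proof -
    have "norm (d k) \<le> norm (p (Suc k) - \<xi>) + norm (p k - \<xi>)"
      using norm_triangle_ineq4[of "p (Suc k) - \<xi>" "p k - \<xi>"] by (simp add: d_def)
    also have "\<dots> \<le> norm \<xi> * (1/2)^Suc k + norm \<xi> * (1/2)^k"
      by (intro add_mono p)
    finally show ?thesis by simp
  qed
  have geo: "(\<lambda>k. norm \<xi> * (3/2) * (1/2)^k) sums (3 * norm \<xi>)"
    using sums_mult[OF geometric_sums[of "1/2 :: real"], of "norm \<xi> * (3/2)"] by simp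
  have sd: "summable (\<lambda>k. norm (d k))"
    by (rule summable_comparison_test'[OF sums_summable[OF geo], of 0]) (use nd in simp)
  have lim: "p \<longlonglongrightarrow> \<xi>"
  proof (rule LIM_zero_cancel, rule Lim_null_comparison)
    show "\<forall>\<^sub>F k in sequentially. norm (p k - \<xi>) \<le> norm \<xi> * (1/2)^k"
      by (simp add: p)
    show "(\<lambda>k. norm \<xi> * (1/2)^k) \<longlonglongrightarrow> 0"
      by (intro tendsto_mult_right_zero LIMSEQ_power_zero) simp
  qed
  show ?thesis
  proof (rule that[of d "suminf (\<lambda>k. norm (d k))"])
    show "d k \<in> D" for k
      unfolding d_def using D p(1) by blast
    show "((\<lambda>k. norm (d k)) has_sum suminf (\<lambda>k. norm (d k))) UNIV"
      by (rule norm_summable_imp_has_sum) (use sd in \<open>simp_all add: summable_sums\<close>)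
    show "suminf (\<lambda>k. norm (d k)) \<le> 3 * norm \<xi>"
      unfolding sums_unique[OF geo] by (rule suminf_le[OF nd sd sums_summable[OF geo]])
    fix h :: "'a \<Rightarrow> complex" assume h: "bounded_linear h"
    show "((\<lambda>k. h (d k)) has_sum h \<xi>) UNIV"
    proof (rule norm_summable_imp_has_sum)
      obtain N where N: "\<And>x. norm (h x) \<le> norm x * N"
        using bounded_linear.bounded[OF h] by blast
      show "summable (\<lambda>k. norm (h (d k)))"
        by (rule summable_comparison_test'[OF summable_mult2[OF sd, of N], of 0]) (simp add: N)
      have "(\<lambda>k. h (p (Suc k)) - h (p k)) sums (h \<xi> - h (p 0))"
        by (rule telescope_sums) (rule bounded_linear.tendsto[OF h lim])
      then show "(\<lambda>k. h (d k)) sums h \<xi>"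
        by (simp add: d_def p_def linear_diff[OF bounded_linear.linear[OF h]] linear_0[OF bounded_linear.linear[OF h]])
    qed
  qed
qed

text \<open>Quantifying over all larger finite sets lets two vectors share the union of their
  supports.\<close>

definition finitely_supported :: "('g \<Rightarrow> 'h::chilbert_space set) \<Rightarrow> 'h set"
  where "finitely_supported Hs = {\<xi>. \<exists>F. finite F \<and> (\<forall>G. finite G \<longrightarrow> F \<subseteq> G \<longrightarrow> (\<Sum>t\<in>G. comp_proj Hs t \<xi>) = \<xi>)}"

context
  fixes Hs :: "'g \<Rightarrow> 'h::chilbert_space set"
  assumes Hs: "orthogonal_decomposition Hs"
begin

lemma subspace_finitely_supported: "complex_vector.subspace (finitely_supported Hs)"
proof (rule complex_vector.subspaceI)
  show "0 \<in> finitely_supported Hs"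
    by (simp add: finitely_supported_def comp_proj_0[OF Hs] exI[of _ "{}"])
next
  fix \<xi> \<eta> assume "\<xi> \<in> finitely_supported Hs" "\<eta> \<in> finitely_supported Hs"
  then obtain F F' where "finite F" "finite F'"
    "\<And>G. finite G \<Longrightarrow> F \<subseteq> G \<Longrightarrow> (\<Sum>t\<in>G. comp_proj Hs t \<xi>) = \<xi>"
    "\<And>G. finite G \<Longrightarrow> F' \<subseteq> G \<Longrightarrow> (\<Sum>t\<in>G. comp_proj Hs t \<eta>) = \<eta>"
    by (auto simp: finitely_supported_def)
  then show "\<xi> + \<eta> \<in> finitely_supported Hs"
    unfolding finitely_supported_def
    by (intro CollectI exI[of _ "F \<union> F'"]) (simp add: comp_proj_add[OF Hs] sum.distrib)
next
  fix c \<xi> assume "\<xi> \<in> finitely_supported Hs"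
  then show "c *\<^sub>C \<xi> \<in> finitely_supported Hs"
    by (simp add: finitely_supported_def comp_proj_scaleC[OF Hs] complex_vector.scale_sum_right[symmetric]) metis
qed

lemma finitely_supported_dense: "closure (finitely_supported Hs) = UNIV"
proof -
  have "Hs g \<subseteq> finitely_supported Hs" for g
  proof
    fix \<xi> assume \<xi>: "\<xi> \<in> Hs g"
    have "(\<Sum>t\<in>G. comp_proj Hs t \<xi>) = \<xi>" if "finite G" "{g} \<subseteq> G" for G
    proof -
      have "(\<Sum>t\<in>G. comp_proj Hs t \<xi>) = (\<Sum>t\<in>G. if t = g then \<xi> else 0)"
        by (rule sum.cong) (auto simp: comp_proj_id[OF Hs \<xi>] comp_proj_other[OF Hs _ \<xi>])
      then show ?thesis using that by simp
    qed
    then show "\<xi> \<in> finitely_supported Hs"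
      unfolding finitely_supported_def by (intro CollectI exI[of _ "{g}"]) simp
  qed
  then have "complex_vector.span (\<Union>g. Hs g) \<subseteq> finitely_supported Hs"
    by (intro complex_vector.span_minimal subspace_finitely_supported) auto
  then show ?thesis
    using closure_mono components_dense[OF Hs] by blast
qed

end

section \<open>Pullbacks of vector functionals under Schur multiplication\<close>

context
  fixes \<phi> :: "'g::group_add \<Rightarrow> complex"
    and Hs :: "'g \<Rightarrow> 'h::chilbert_space set"
    and T :: "('g ell2 \<Rightarrow>\<^sub>L 'g ell2) \<Rightarrow> ('g ell2 \<Rightarrow>\<^sub>L 'g ell2)"
    and \<Lambda> :: "'g \<Rightarrow> 'g \<Rightarrow> complex"
  assumes Hs: "orthogonal_decomposition Hs"
    and T: "completely_bounded reduced_cstar reduced_cstar T"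
    and T_left_regular: "\<And>g. T (left_regular g) = \<phi> g *\<^sub>C left_regular g"
    and \<Lambda>: "\<And>s t. \<Lambda> s t = \<phi> (s - t)"
begin

text \<open>Components outside \<open>F\<close> vanish, so the truncated values are constant once
  the truncation set contains \<open>F\<close>. Hence the functional sees only finitely many entries
  of \<open>x\<close>.\<close>

lemma cinner_schur_map_finitely_supported:
  assumes x: "x \<in> bounded_ops" and F: "finite F"
    and \<xi>: "(\<Sum>t\<in>F. comp_proj Hs t \<xi>) = \<xi>" and \<eta>: "(\<Sum>t\<in>F. comp_proj Hs t \<eta>) = \<eta>"
  shows "cinner (blinfun_apply (schur_map Hs \<Lambda> x) \<xi>) \<eta>
    = (\<Sum>s\<in>F. \<Sum>t\<in>F. \<phi> (s - t) * cinner (blinfun_apply x (comp_proj Hs t \<xi>)) (comp_proj Hs s \<eta>))"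
proof (rule tendsto_unique)
  show "((\<lambda>G. cinner (schur_trunc Hs \<Lambda> G x \<xi>) \<eta>) \<longlongrightarrow> cinner (blinfun_apply (schur_map Hs \<Lambda> x) \<xi>) \<eta>)
      (finite_subsets_at_top UNIV)"
    by (intro tendsto_cinner tendsto_const schur_trunc_tendsto_schur_map[OF Hs T T_left_regular \<Lambda> x])
  have out: "comp_proj Hs t \<zeta> = 0" if "t \<notin> F" "(\<Sum>t\<in>F. comp_proj Hs t \<zeta>) = \<zeta>" for t \<zeta>
  proof -
    have "comp_proj Hs t (\<Sum>t\<in>F. comp_proj Hs t \<zeta>) = 0"
      using that(1) by (auto simp: comp_proj_sum[OF Hs] comp_proj_comp_proj[OF Hs] intro!: sum.neutral)
    then show ?thesis using that(2) by simp
  qed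
  have "cinner (schur_trunc Hs \<Lambda> G x \<xi>) \<eta>
      = (\<Sum>s\<in>F. \<Sum>t\<in>F. \<phi> (s - t) * cinner (blinfun_apply x (comp_proj Hs t \<xi>)) (comp_proj Hs s \<eta>))"
    if G: "finite G \<and> F \<subseteq> G" for G
  proof -
    have "(\<Sum>s\<in>G. \<Sum>t\<in>G. \<phi> (s - t) * cinner (blinfun_apply x (comp_proj Hs t \<xi>)) (comp_proj Hs s \<eta>))
        = (\<Sum>s\<in>F. \<Sum>t\<in>G. \<phi> (s - t) * cinner (blinfun_apply x (comp_proj Hs t \<xi>)) (comp_proj Hs s \<eta>))"
      by (rule sum.mono_neutral_right) (use G in \<open>auto simp: out[OF _ \<eta>]\<close>)
    also have "\<dots> = (\<Sum>s\<in>F. \<Sum>t\<in>F. \<phi> (s - t) * cinner (blinfun_apply x (comp_proj Hs t \<xi>)) (comp_proj Hs s \<eta>))"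
      by (intro sum.cong refl sum.mono_neutral_right) (use G in \<open>auto simp: out[OF _ \<xi>]\<close>)
    finally show ?thesis
      by (simp add: cinner_schur_trunc[OF Hs T T_left_regular \<Lambda>])
  qed
  then show "((\<lambda>G. cinner (schur_trunc Hs \<Lambda> G x \<xi>) \<eta>) \<longlongrightarrow>
      (\<Sum>s\<in>F. \<Sum>t\<in>F. \<phi> (s - t) * cinner (blinfun_apply x (comp_proj Hs t \<xi>)) (comp_proj Hs s \<eta>)))
      (finite_subsets_at_top UNIV)"
    by (intro tendsto_eventually eventually_mono[OF eventually_subset_finite_subsets_at_top[OF F]])
qed simp

text \<open>Here the multiplier and the component norms form the fixed matrix \<open>b\<close>, and
  \<open>a\<close> is the test matrix, so \<open>multiplier_bound\<close> is exactly the hypothesis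
  \<open>dual\<close> of the separation lemma. One unit of the constant keeps \<open>K\<close>
  positive if the completely bounded norm is 0, the other pays for
  \<open>\<delta> = norm \<xi> * norm \<eta>\<close>.\<close>

lemma nuclear_schur_map_finitely_supported:
  assumes "\<xi> \<in> finitely_supported Hs" "\<eta> \<in> finitely_supported Hs"
  shows "nuclear ((reduced_cb_norm T + 2) * (norm \<xi> * norm \<eta>)) (\<lambda>x. cinner (blinfun_apply (schur_map Hs \<Lambda> x) \<xi>) \<eta>)"
proof (cases "norm \<xi> * norm \<eta> = 0")
  case True
  then have "(\<lambda>x. cinner (blinfun_apply (schur_map Hs \<Lambda> x) \<xi>) \<eta>) = (\<lambda>_. 0)"
    by auto
  then show ?thesis
    unfolding True by (simp only: mult_zero_right nuclear_zero order_refl)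
next
  case False
  then have pos: "0 < norm \<xi> * norm \<eta>"
    by simp
  obtain F1 F2 where F12: "finite F1" "finite F2"
    "\<And>G. finite G \<Longrightarrow> F1 \<subseteq> G \<Longrightarrow> (\<Sum>t\<in>G. comp_proj Hs t \<xi>) = \<xi>"
    "\<And>G. finite G \<Longrightarrow> F2 \<subseteq> G \<Longrightarrow> (\<Sum>t\<in>G. comp_proj Hs t \<eta>) = \<eta>"
    using assms by (auto simp: finitely_supported_def)
  define F where "F = F1 \<union> F2"
  have F: "finite F" and \<xi>: "(\<Sum>t\<in>F. comp_proj Hs t \<xi>) = \<xi>" and \<eta>: "(\<Sum>t\<in>F. comp_proj Hs t \<eta>) = \<eta>"
    using F12 by (auto simp: F_def)
  have L2: "L2_set (\<lambda>t. cmod (of_real (norm (comp_proj Hs t \<zeta>)))) F = norm \<zeta>" if "(\<Sum>t\<in>F. comp_proj Hs t \<zeta>) = \<zeta>" for \<zeta>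
  proof -
    have "(norm \<zeta>)\<^sup>2 = (\<Sum>t\<in>F. (norm (comp_proj Hs t \<zeta>))\<^sup>2)"
      using norm_sum_orthogonal[of F "\<lambda>t. comp_proj Hs t \<zeta>"] comp_proj_orth[OF Hs] that by simp
    then show ?thesis
      by (simp add: L2_set_def flip: \<open>(norm \<zeta>)\<^sup>2 = _\<close>)
  qed
  define b where "b = (\<lambda>p q. \<phi> (p - q) * of_real (norm (comp_proj Hs q \<xi>)) * cnj (of_real (norm (comp_proj Hs p \<eta>))))"
  have "nuclear ((reduced_cb_norm T + 1) * (norm \<xi> * norm \<eta>) + norm \<xi> * norm \<eta>)
      (\<lambda>x. \<Sum>p\<in>F. \<Sum>q\<in>F. b p q * cinner (blinfun_apply x (sgn (comp_proj Hs q \<xi>))) (sgn (comp_proj Hs p \<eta>)))"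
  proof (rule nuclear_finite_matrix[OF F _ pos])
    show "0 < (reduced_cb_norm T + 1) * (norm \<xi> * norm \<eta>)"
      using pos by (intro mult_pos_pos add_nonneg_pos) auto
    fix M :: real and a :: "'g \<Rightarrow> 'g \<Rightarrow> complex"
    assume M: "0 < M" and a: "\<And>u v. cmod (\<Sum>p\<in>F. \<Sum>q\<in>F. a p q * u q * cnj (v p))
        \<le> M * L2_set (\<lambda>q. cmod (u q)) F * L2_set (\<lambda>p. cmod (v p)) F"
    have "cmod (\<Sum>p\<in>F. \<Sum>q\<in>F. \<phi> (p - q) * a p q * of_real (norm (comp_proj Hs q \<xi>)) * cnj (of_real (norm (comp_proj Hs p \<eta>))))
        \<le> reduced_cb_norm T * M * L2_set (\<lambda>q. cmod (of_real (norm (comp_proj Hs q \<xi>)))) F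
          * L2_set (\<lambda>p. cmod (of_real (norm (comp_proj Hs p \<eta>)))) F"
      by (rule multiplier_bound[OF T T_left_regular F M a, where \<gamma> = "\<lambda>g. g"])
    also have "\<dots> = reduced_cb_norm T * M * (norm \<xi> * norm \<eta>)"
      unfolding L2[OF \<xi>] L2[OF \<eta>] by (simp add: mult_ac)
    also have "\<dots> \<le> (reduced_cb_norm T + 1) * M * (norm \<xi> * norm \<eta>)"
      by (intro mult_right_mono) (use M in auto)
    finally show "cmod (\<Sum>p\<in>F. \<Sum>q\<in>F. b p q * a p q) \<le> (reduced_cb_norm T + 1) * (norm \<xi> * norm \<eta>) * M"
      by (simp add: b_def mult_ac)
  qed (auto intro: comp_proj_orth[OF Hs])
  also have "(reduced_cb_norm T + 1) * (norm \<xi> * norm \<eta>) + norm \<xi> * norm \<eta> = (reduced_cb_norm T + 2) * (norm \<xi> * norm \<eta>)"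
    by (simp add: algebra_simps)
  finally have nuc: "nuclear ((reduced_cb_norm T + 2) * (norm \<xi> * norm \<eta>))
      (\<lambda>x. \<Sum>p\<in>F. \<Sum>q\<in>F. b p q * cinner (blinfun_apply x (sgn (comp_proj Hs q \<xi>))) (sgn (comp_proj Hs p \<eta>)))" .
  have "(\<Sum>p\<in>F. \<Sum>q\<in>F. b p q * cinner (blinfun_apply x (sgn (comp_proj Hs q \<xi>))) (sgn (comp_proj Hs p \<eta>)))
      = cinner (blinfun_apply (schur_map Hs \<Lambda> x) \<xi>) \<eta>" if x: "x \<in> bounded_ops" for x
  proof -
    have "b p q * cinner (blinfun_apply x (sgn (comp_proj Hs q \<xi>))) (sgn (comp_proj Hs p \<eta>))
        = \<phi> (p - q) * cinner (blinfun_apply x (comp_proj Hs q \<xi>)) (comp_proj Hs p \<eta>)" for p q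
    proof -
      have "cinner (blinfun_apply x (of_real (norm (comp_proj Hs q \<xi>)) *\<^sub>C sgn (comp_proj Hs q \<xi>)))
          (of_real (norm (comp_proj Hs p \<eta>)) *\<^sub>C sgn (comp_proj Hs p \<eta>))
        = of_real (norm (comp_proj Hs q \<xi>)) * cnj (of_real (norm (comp_proj Hs p \<eta>)))
          * cinner (blinfun_apply x (sgn (comp_proj Hs q \<xi>))) (sgn (comp_proj Hs p \<eta>))"
        by (simp add: bounded_ops_scaleC[OF x] cinner_scaleC_left cinner_scaleC_right)
      then show ?thesis
        by (simp add: norm_scaleC_sgn b_def mult_ac)
    qed
    then show ?thesis
      by (simp add: cinner_schur_map_finitely_supported[OF x F \<xi> \<eta>])
  qed
  with nuc show ?thesis
    by (rule nuclear_cong)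
qed

text \<open>Both vectors are expanded in series of finitely supported ones. Boundedness of the image
  operator lets the functional be summed in each argument in turn; the factor 9 is the product of
  the two factors 3 of the expansions.\<close>

lemma nuclear_schur_map:
  "nuclear (9 * (reduced_cb_norm T + 2) * (norm \<xi> * norm \<eta>)) (\<lambda>x. cinner (blinfun_apply (schur_map Hs \<Lambda> x) \<xi>) \<eta>)"
proof -
  let ?D = "finitely_supported Hs" and ?C = "reduced_cb_norm T + 2"
  have C: "0 \<le> ?C" by simp
  have "\<forall>\<xi>\<in>?D. \<forall>\<eta>\<in>?D. \<xi> - \<eta> \<in> ?D"
    by (simp add: complex_vector.subspace_diff[OF subspace_finitely_supported[OF Hs]])
  note series = dense_subspace_series[OF this
      finitely_supported_dense[OF Hs] complex_vector.subspace_0[OF subspace_finitely_supported[OF Hs]]]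
  obtain d s where d: "\<And>k::nat. d k \<in> ?D" "((\<lambda>k. norm (d k)) has_sum s) UNIV" "s \<le> 3 * norm \<xi>"
    "\<And>h :: 'h \<Rightarrow> complex. bounded_linear h \<Longrightarrow> ((\<lambda>k. h (d k)) has_sum h \<xi>) UNIV"
    by (rule series[where \<xi> = \<xi>]) (rule that)
  obtain d' s' where d': "\<And>k::nat. d' k \<in> ?D" "((\<lambda>k. norm (d' k)) has_sum s') UNIV" "s' \<le> 3 * norm \<eta>"
    "\<And>h :: 'h \<Rightarrow> complex. bounded_linear h \<Longrightarrow> ((\<lambda>k. h (d' k)) has_sum h \<eta>) UNIV"
    by (rule series[where \<xi> = \<eta>]) (rule that)
  have s: "0 \<le> s" "0 \<le> s'"
    using has_sum_nonneg[OF d(2)] has_sum_nonneg[OF d'(2)] by auto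
  have inner: "nuclear (?C * norm (d k) * s') (\<lambda>x. cinner (blinfun_apply (schur_map Hs \<Lambda> x) (d k)) \<eta>)" for k
  proof (rule nuclear_countable_sum)
    show "nuclear (?C * norm (d k) * norm (d' l)) (\<lambda>x. cinner (blinfun_apply (schur_map Hs \<Lambda> x) (d k)) (d' l))" for l
      using nuclear_schur_map_finitely_supported[OF d(1) d'(1)] by (simp add: mult.assoc)
    show "((\<lambda>l. ?C * norm (d k) * norm (d' l)) has_sum (?C * norm (d k) * s')) UNIV"
      by (rule has_sum_cmult_right[OF d'(2)])
  qed (rule d'(4)[OF bounded_bilinear.bounded_linear_right[OF bounded_bilinear_cinner]])
  have "nuclear (?C * s' * s) (\<lambda>x. cinner (blinfun_apply (schur_map Hs \<Lambda> x) \<xi>) \<eta>)"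
  proof (rule nuclear_countable_sum)
    show "nuclear (?C * s' * norm (d k)) (\<lambda>x. cinner (blinfun_apply (schur_map Hs \<Lambda> x) (d k)) \<eta>)" for k
      using inner[of k] by (simp add: mult_ac)
    show "((\<lambda>k. ?C * s' * norm (d k)) has_sum (?C * s' * s)) UNIV"
      by (rule has_sum_cmult_right[OF d(2)])
    show "((\<lambda>k. cinner (blinfun_apply (schur_map Hs \<Lambda> x) (d k)) \<eta>) has_sum
        cinner (blinfun_apply (schur_map Hs \<Lambda> x) \<xi>) \<eta>) UNIV" for x
      by (rule d(4)[OF bounded_linear_compose[OF bounded_bilinear.bounded_linear_left[OF bounded_bilinear_cinner]
            blinfun.bounded_linear_right]])
  qed
  moreover have "?C * s' * s \<le> 9 * ?C * (norm \<xi> * norm \<eta>)"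
  proof -
    have "s' * s \<le> (3 * norm \<eta>) * (3 * norm \<xi>)"
      by (intro mult_mono d d' s) auto
    then have "?C * (s' * s) \<le> ?C * ((3 * norm \<eta>) * (3 * norm \<xi>))"
      using C by (rule mult_left_mono)
    then show ?thesis by (simp add: mult_ac)
  qed
  ultimately show ?thesis
    by (rule nuclear_mono)
qed

text \<open>Products of norms from two square summable sequences are summable, so the constants of
  the single vector functionals are too.\<close>

lemma nuclear_schur_map_series:
  fixes \<xi> \<eta> :: "nat \<Rightarrow> 'h"
  assumes \<xi>: "summable (\<lambda>n. (norm (\<xi> n))\<^sup>2)" and \<eta>: "summable (\<lambda>n. (norm (\<eta> n))\<^sup>2)"
  shows "\<exists>K. nuclear K (\<lambda>x. \<Sum>n. cinner (blinfun_apply (schur_map Hs \<Lambda> x) (\<xi> n)) (\<eta> n))"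
proof -
  have sq: "(\<lambda>n. (norm (\<xi> n))\<^sup>2) summable_on UNIV" "(\<lambda>n. (norm (\<eta> n))\<^sup>2) summable_on UNIV"
    using \<xi> \<eta> by (simp_all add: summable_on_UNIV_nonneg_real_iff)
  have "(\<lambda>n. norm (\<xi> n) * norm (\<eta> n)) summable_on UNIV"
  proof (rule summable_on_comparison_test[OF summable_on_add[OF sq]])
    show "norm (\<xi> n) * norm (\<eta> n) \<le> (norm (\<xi> n))\<^sup>2 + (norm (\<eta> n))\<^sup>2" for n
      using sum_squares_bound[of "norm (\<xi> n)" "norm (\<eta> n)"]
        mult_nonneg_nonneg[OF norm_ge_zero[of "\<xi> n"] norm_ge_zero[of "\<eta> n"]] by linarith
  qed simp
  from has_sum_cmult_right[OF has_sum_infsum[OF this]]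
  have "nuclear (9 * (reduced_cb_norm T + 2) * (\<Sum>\<^sub>\<infinity>n. norm (\<xi> n) * norm (\<eta> n)))
      (\<lambda>x. \<Sum>n. cinner (blinfun_apply (schur_map Hs \<Lambda> x) (\<xi> n)) (\<eta> n))"
  proof (rule nuclear_countable_sum[OF nuclear_schur_map])
    fix x :: "'h \<Rightarrow>\<^sub>L 'h"
    have S: "(\<lambda>n. cinner (blinfun_apply (schur_map Hs \<Lambda> x) (\<xi> n)) (\<eta> n)) summable_on UNIV"
      by (rule abs_summable_summable, rule square_summable_cinner[OF sq])
    show "((\<lambda>n. cinner (blinfun_apply (schur_map Hs \<Lambda> x) (\<xi> n)) (\<eta> n)) has_sum
        (\<Sum>n. cinner (blinfun_apply (schur_map Hs \<Lambda> x) (\<xi> n)) (\<eta> n))) UNIV"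
      by (simp only: sums_unique[OF has_sum_imp_sums[OF has_sum_infsum[OF S]], symmetric] has_sum_infsum[OF S])
  qed
  then show ?thesis ..
qed

text \<open>Continuity is tested on the generating sets, whose preimages are given by nuclear
  functionals.\<close>

lemma continuous_map_schur_map: "continuous_map ultraweak ultraweak (schur_map Hs \<Lambda>)"
proof -
  define \<B> where "\<B> = {{x \<in> bounded_ops. (\<Sum>n. cinner (blinfun_apply x (\<xi> n)) (\<eta> n)) \<in> U} | (\<xi> :: nat \<Rightarrow> 'h) \<eta> U.
      summable (\<lambda>n. (norm (\<xi> n))\<^sup>2) \<and> summable (\<lambda>n. (norm (\<eta> n))\<^sup>2) \<and> open U}"
  have uw: "(ultraweak :: ('h \<Rightarrow>\<^sub>L 'h) topology) = topology_generated_by \<B>"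
    by (simp add: ultraweak_def \<B>_def)
  have B: "\<Union>\<B> = bounded_ops"
  proof
    show "\<Union>\<B> \<subseteq> bounded_ops"
      by (auto simp: \<B>_def)
    \<comment> \<open>Zero sequences with \<open>U = UNIV\<close> exhibit \<open>bounded_ops\<close>
      itself as a generator, which identifies the underlying space of the topology.\<close>
    have "{x \<in> bounded_ops. (\<Sum>n. cinner (blinfun_apply x ((\<lambda>_. 0) n)) ((\<lambda>_. 0) n)) \<in> UNIV} \<in> \<B>"
      unfolding \<B>_def
      by (rule CollectI, rule exI[of _ "\<lambda>_. 0"], rule exI[of _ "\<lambda>_. 0"], rule exI[of _ UNIV]) simp
    then have "bounded_ops \<in> \<B>"
      by simp
    then show "bounded_ops \<subseteq> \<Union>\<B>"
      by (rule Union_upper)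
  qed
  then have top: "topspace (ultraweak :: ('h \<Rightarrow>\<^sub>L 'h) topology) = bounded_ops"
    by (simp add: uw topology_generated_by_topspace)
  have "continuous_map ultraweak (topology_generated_by \<B>) (schur_map Hs \<Lambda>)"
  proof (rule continuous_on_generated_topo)
    show "schur_map Hs \<Lambda> ` topspace ultraweak \<subseteq> \<Union>\<B>"
      unfolding top B using schur_map_bounded[OF Hs T T_left_regular \<Lambda>] by (rule image_subsetI)
    fix V assume "V \<in> \<B>"
    then obtain \<xi> \<eta> :: "nat \<Rightarrow> 'h" and U
      where V: "V = {x \<in> bounded_ops. (\<Sum>n. cinner (blinfun_apply x (\<xi> n)) (\<eta> n)) \<in> U}"
        and *: "summable (\<lambda>n. (norm (\<xi> n))\<^sup>2)" "summable (\<lambda>n. (norm (\<eta> n))\<^sup>2)" "open U"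
      unfolding \<B>_def by (elim CollectE exE conjE)
    obtain K where K: "nuclear K (\<lambda>x. \<Sum>n. cinner (blinfun_apply (schur_map Hs \<Lambda> x) (\<xi> n)) (\<eta> n))"
      using nuclear_schur_map_series[OF *(1,2)] by (elim exE)
    have "schur_map Hs \<Lambda> -` V \<inter> topspace ultraweak
        = {x \<in> bounded_ops. (\<Sum>n. cinner (blinfun_apply (schur_map Hs \<Lambda> x) (\<xi> n)) (\<eta> n)) \<in> U}"
      unfolding top V using schur_map_bounded[OF Hs T T_left_regular \<Lambda>] by auto
    then show "openin ultraweak (schur_map Hs \<Lambda> -` V \<inter> topspace ultraweak)"
      using nuclear_openin_ultraweak[OF K *(3)] by simp
  qed
  then show ?thesis
    by (simp flip: uw)
qed

end

theorem theorem3p1: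
  fixes \<phi> :: "'g::group_add \<Rightarrow> complex"
    and Hs :: "'g \<Rightarrow> 'h::chilbert_space set"
    and T :: "('g ell2 \<Rightarrow>\<^sub>L 'g ell2) \<Rightarrow> ('g ell2 \<Rightarrow>\<^sub>L 'g ell2)"
    and \<Lambda> :: "'g \<Rightarrow> 'g \<Rightarrow> complex"
  assumes "orthogonal_decomposition Hs"
    and "completely_bounded reduced_cstar reduced_cstar T"
    and "\<And>g. T (left_regular g) = \<phi> g *\<^sub>C left_regular g"
    and "\<And>s t. \<Lambda> s t = \<phi> (s - t)"
  shows "(\<forall>x\<in>bounded_ops. schur_map Hs \<Lambda> x \<in> bounded_ops \<and>
        op_matrix Hs (schur_map Hs \<Lambda> x) = schur_product \<Lambda> (op_matrix Hs x)) \<and>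
      completely_bounded bounded_ops bounded_ops (schur_map Hs \<Lambda>) \<and>
      cb_norm bounded_ops (schur_map Hs \<Lambda>) \<le> cb_norm reduced_cstar T \<and>
      continuous_map ultraweak ultraweak (schur_map Hs \<Lambda>)"
  by (intro conjI ballI schur_map_bounded[OF assms] op_matrix_schur_map[OF assms]
      completely_bounded_schur_map[OF assms] cb_norm_schur_map_le[OF assms]
      continuous_map_schur_map[OF assms])

end
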